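(* Let $\langle \mathsf B,\mathcal F\rangle$ be a display map category with units and $\mathcal F$-dependent coproducts. A fibration $\mathsf p:\mathsf E\to\mathsf B$ with $\mathcal F$-coproducts is an instance of an $\mathcal F$-coproduct completion over $\mathsf B$, up to fibred equivalence (i.e. there is a fibration $\mathsf q$ over $\mathsf B$ with $\mathsf p\simeq\Sigma_{\mathcal F}(\mathsf q)$ as fibrations over $\mathsf B$), if and only if $\mathsf p$ has enough $(\mathcal F,\coprod)$-quantifier-free objects.
   Context: Fibrations $\mathsf p:\mathsf E\to\mathsf B$ are cloven Grothendieck fibrations; $\mathsf E_A$ is the fibre over $A$; vertical arrows are those over identities; $u^*$ is reindexing along $u$; canonical isomorphisms such as $g^*u^*\cong(ug)^*$ are suppressed. A display map category $\langle\mathsf B,\mathcal F\rangle$ is a category with a class $\mathcal F$ of morphisms such that pullbacks of $\mathcal F$-maps along arbitrary maps exist and lie in $\mathcal F$. Arrows of $\mathcal F$ are written $\twoheadrightarrow$. It has units if all isomorphisms are in $\mathcal F$, and $\mathcal F$-dependent coproducts if $\mathcal F$ is closed under composition. $\mathsf p$ has $\mathcal F$-coproducts if for each $v\in\mathcal F$ the functor $v^*$ has a left adjoint $\coprod_v$ and, for every pullback square with $v:L\twoheadrightarrow J$, $f:I\to J$ arbitrary, $u:K\twoheadrightarrow I$, $g:K\to L$, the canonical map $\coprod_u g^*\Rightarrow f^*\coprod_v$ is an isomorphism (Beck–Chevalley). $\alpha\in\mathsf E_A$ is $(\mathcal F,\coprod)$-quantifier splitting if for every $u:B\twoheadrightarrow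 A$ in $\mathcal F$, every $\beta\in\mathsf E_B$ and every vertical $h:\alpha\to\coprod_u\beta$ there exist a unique section $g:A\to B$ of $u$ ($ug=\mathrm{id}_A$) and a unique vertical $\overline h:\alpha\to g^*\beta$ with $h=g^*(\eta_\beta)\circ\overline h$, where $\eta$ is the unit of $\coprod_u\dashv u^*$ and $g^*u^*\coprod_u\beta\cong\coprod_u\beta$. It is $(\mathcal F,\coprod)$-quantifier-free if $f^*\alpha$ is $(\mathcal F,\coprod)$-quantifier splitting for every $f:I\to A$ in $\mathsf B$. $\mathsf p$ has enough $(\mathcal F,\coprod)$-quantifier-free objects if it has $\mathcal F$-coproducts and for every $\alpha\in\mathsf E_I$ there are $f:A\twoheadrightarrow I$ in $\mathcal F$ and a $(\mathcal F,\coprod)$-quantifier-free $\beta\in\mathsf E_A$ with $\alpha\cong\coprod_f\beta$. The $\mathcal F$-coproduct completion $\Sigma_{\mathcal F}(\mathsf p):\Sigma_{\mathcal F}(\mathsf E)\to\mathsf B$ of a fibration $\mathsf p$: objects over $I$ are pairs $(g:X\twoheadrightarrow I,\ \alpha\in\mathsf E_X)$ with $g\in\mathcal F$; a morphism $(g:X\twoheadrightarrow I,\alpha)\to(h:Y\twoheadrightarrow J,\beta)$ over $f_0:I\to J$ is a pair of $f_1:X\to Y$ with $hf_1=f_0g$ and $\phi:\alpha\to\beta$ in $\mathsf E$ over $f_1$. It has $\mathcal F$-coproducts given by $\coprod_k(g,\alpha)=(kg,\alpha)$ for $k\in\mathcal F$. *)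

theory Defs
  imports Main
begin

section \<open>Categories, functors, adjunctions\<close>

record ('o, 'a) cat =
  Obj :: "'o set"
  Arr :: "'a set"
  Dom :: "'a \<Rightarrow> 'o"
  Cod :: "'a \<Rightarrow> 'o"
  Id :: "'o \<Rightarrow> 'a"
  Comp :: "'a \<Rightarrow> 'a \<Rightarrow> 'a"  (infixl "\<cdot>\<index>" 70)

definition hom :: "('o, 'a) cat \<Rightarrow> 'o \<Rightarrow> 'o \<Rightarrow> 'a set" where
  "hom C A B = {f \<in> Arr C. Dom C f = A \<and> Cod C f = B}"

locale category =
  fixes C :: "('o, 'a) cat" (structure)
  assumes dom_in: "f \<in> Arr C \<Longrightarrow> Dom C f \<in> Obj C"
    and cod_in: "f \<in> Arr C \<Longrightarrow> Cod C f \<in> Obj C"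
    and id_in: "A \<in> Obj C \<Longrightarrow> Id C A \<in> hom C A A"
    and comp_in: "\<lbrakk>f \<in> hom C X Y; g \<in> hom C Y Z\<rbrakk> \<Longrightarrow> g \<cdot> f \<in> hom C X Z"
    and id_left: "f \<in> Arr C \<Longrightarrow> Id C (Cod C f) \<cdot> f = f"
    and id_right: "f \<in> Arr C \<Longrightarrow> f \<cdot> Id C (Dom C f) = f"
    and assoc: "\<lbrakk>f \<in> hom C W X; g \<in> hom C X Y; h \<in> hom C Y Z\<rbrakk> \<Longrightarrow> (h \<cdot> g) \<cdot> f = h \<cdot> (g \<cdot> f)"

definition inverse_arrows :: "('o, 'a) cat \<Rightarrow> 'a \<Rightarrow> 'a \<Rightarrow> bool" where
  "inverse_arrows C f g \<longleftrightarrow> f \<in> Arr C \<and> g \<in> hom C (Cod C f) (Dom C f) \<and>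
     g \<cdot>\<^bsub>C\<^esub> f = Id C (Dom C f) \<and> f \<cdot>\<^bsub>C\<^esub> g = Id C (Cod C f)"

definition is_iso :: "('o, 'a) cat \<Rightarrow> 'a \<Rightarrow> bool" where
  "is_iso C f \<longleftrightarrow> (\<exists>g. inverse_arrows C f g)"

definition inv_arrow :: "('o, 'a) cat \<Rightarrow> 'a \<Rightarrow> 'a" where
  "inv_arrow C f = (THE g. inverse_arrows C f g)"

definition isomorphic :: "('o, 'a) cat \<Rightarrow> 'o \<Rightarrow> 'o \<Rightarrow> bool" where
  "isomorphic C X Y \<longleftrightarrow> (\<exists>f \<in> hom C X Y. is_iso C f)"

record ('o1, 'a1, 'o2, 'a2) fctr =
  OMap :: "'o1 \<Rightarrow> 'o2"
  AMap :: "'a1 \<Rightarrow> 'a2"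

definition id_fctr :: "('o, 'a, 'o, 'a) fctr" where
  "id_fctr = \<lparr>OMap = (\<lambda>X. X), AMap = (\<lambda>f. f)\<rparr>"

definition comp_fctr ::
  "('o2, 'a2, 'o3, 'a3) fctr \<Rightarrow> ('o1, 'a1, 'o2, 'a2) fctr \<Rightarrow> ('o1, 'a1, 'o3, 'a3) fctr" where
  "comp_fctr G H = \<lparr>OMap = (\<lambda>X. OMap G (OMap H X)), AMap = (\<lambda>f. AMap G (AMap H f))\<rparr>"

locale cat_functor =
  source: category C + target: category D
  for C :: "('o1, 'a1) cat" and D :: "('o2, 'a2) cat" +
  fixes H :: "('o1, 'a1, 'o2, 'a2) fctr"
  assumes map_obj: "X \<in> Obj C \<Longrightarrow> OMap H X \<in> Obj D"
    and map_hom: "f \<in> hom C X Y \<Longrightarrow> AMap H f \<in> hom D (OMap H X) (OMap H Y)"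
    and map_id: "X \<in> Obj C \<Longrightarrow> AMap H (Id C X) = Id D (OMap H X)"
    and map_comp: "\<lbrakk>f \<in> hom C X Y; g \<in> hom C Y Z\<rbrakk>
      \<Longrightarrow> AMap H (g \<cdot>\<^bsub>C\<^esub> f) = AMap H g \<cdot>\<^bsub>D\<^esub> AMap H f"

locale nat_transformation =
  dom: cat_functor C D H + cod: cat_functor C D K
  for C :: "('o1, 'a1) cat" and D :: "('o2, 'a2) cat" and H K +
  fixes t :: "'o1 \<Rightarrow> 'a2"
  assumes component: "X \<in> Obj C \<Longrightarrow> t X \<in> hom D (OMap H X) (OMap K X)"
    and naturality: "f \<in> hom C X Y \<Longrightarrow> AMap K f \<cdot>\<^bsub>D\<^esub> t X = t Y \<cdot>\<^bsub>D\<^esub> AMap H f"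

locale adjunction =
  unit: nat_transformation C C id_fctr "comp_fctr R L" \<eta> +
  counit: nat_transformation D D "comp_fctr L R" id_fctr \<epsilon> +
  left: cat_functor C D L + right: cat_functor D C R
  for C :: "('o1, 'a1) cat" and D :: "('o2, 'a2) cat" and L R \<eta> \<epsilon> +
  assumes triangle_left: "X \<in> Obj C \<Longrightarrow> \<epsilon> (OMap L X) \<cdot>\<^bsub>D\<^esub> AMap L (\<eta> X) = Id D (OMap L X)"
    and triangle_right: "Y \<in> Obj D \<Longrightarrow> AMap R (\<epsilon> Y) \<cdot>\<^bsub>C\<^esub> \<eta> (OMap R Y) = Id C (OMap R Y)"


section \<open>Display map categories\<close>

text \<open>The square has \<open>f : I \<rightarrow> J\<close> at the bottom, \<open>v : L \<rightarrow> J\<close> on the right, \<open>u : K \<rightarrow> I\<close> on the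
  left and \<open>g : K \<rightarrow> L\<close> on top.\<close>

definition is_pullback :: "('b, 'c) cat \<Rightarrow> 'c \<Rightarrow> 'c \<Rightarrow> 'c \<Rightarrow> 'c \<Rightarrow> bool" where
  "is_pullback B f v u g \<longleftrightarrow>
     f \<in> Arr B \<and> v \<in> hom B (Dom B v) (Cod B f) \<and>
     u \<in> hom B (Dom B u) (Dom B f) \<and> g \<in> hom B (Dom B u) (Dom B v) \<and>
     f \<cdot>\<^bsub>B\<^esub> u = v \<cdot>\<^bsub>B\<^esub> g \<and>
     (\<forall>Z\<in>Obj B. \<forall>a\<in>hom B Z (Dom B f). \<forall>b\<in>hom B Z (Dom B v). f \<cdot>\<^bsub>B\<^esub> a = v \<cdot>\<^bsub>B\<^esub> b \<longrightarrow>
        (\<exists>!k. k \<in> hom B Z (Dom B u) \<and> u \<cdot>\<^bsub>B\<^esub> k = a \<and> g \<cdot>\<^bsub>B\<^esub> k = b))"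

locale display_map_category = category B
  for B :: "('b, 'c) cat" +
  fixes F :: "'c set"
  assumes display_arr: "F \<subseteq> Arr B"
    and pullback_exists: "\<lbrakk>v \<in> F; f \<in> Arr B; Cod B f = Cod B v\<rbrakk> \<Longrightarrow> \<exists>u g. is_pullback B f v u g"
    and pullback_display: "\<lbrakk>v \<in> F; is_pullback B f v u g\<rbrakk> \<Longrightarrow> u \<in> F"

definition has_units :: "('b, 'c) cat \<Rightarrow> 'c set \<Rightarrow> bool" where
  "has_units B F \<longleftrightarrow> (\<forall>f. is_iso B f \<longrightarrow> f \<in> F)"

definition has_dependent_coproducts :: "('b, 'c) cat \<Rightarrow> 'c set \<Rightarrow> bool" where
  "has_dependent_coproducts B F \<longleftrightarrow> (\<forall>f\<in>F. \<forall>g\<in>F. Dom B g = Cod B f \<longrightarrow> g \<cdot>\<^bsub>B\<^esub> f \<in> F)"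


section \<open>Fibrations\<close>

text \<open>A category over the base consists of a total category and a functor to the base. A cloven
  one carries in addition, for \<open>u : B \<rightarrow> A\<close> and \<open>\<alpha>\<close> over \<open>A\<close>, a chosen arrow
  \<open>Lift u \<alpha> : u\<^sup>*\<alpha> \<rightarrow> \<alpha>\<close> over \<open>u\<close>.\<close>

record ('b, 'c, 'e, 'f) over =
  Tot :: "('e, 'f) cat"
  Prj :: "('e, 'f, 'b, 'c) fctr"

record ('b, 'c, 'e, 'f) cloven = "('b, 'c, 'e, 'f) over" +
  Lift :: "'c \<Rightarrow> 'e \<Rightarrow> 'f"

definition cartesian :: "('b, 'c) cat \<Rightarrow> ('b, 'c, 'e, 'f, 'z) over_scheme \<Rightarrow> 'f \<Rightarrow> bool" where
  "cartesian B p k \<longleftrightarrow> k \<in> Arr (Tot p) \<and>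
     (\<forall>f w. f \<in> Arr (Tot p) \<and> Cod (Tot p) f = Cod (Tot p) k \<and>
        w \<in> hom B (OMap (Prj p) (Dom (Tot p) f)) (OMap (Prj p) (Dom (Tot p) k)) \<and>
        AMap (Prj p) f = AMap (Prj p) k \<cdot>\<^bsub>B\<^esub> w \<longrightarrow>
        (\<exists>!h. h \<in> hom (Tot p) (Dom (Tot p) f) (Dom (Tot p) k) \<and>
              AMap (Prj p) h = w \<and> k \<cdot>\<^bsub>Tot p\<^esub> h = f))"

definition cartesian_lift ::
  "('b, 'c) cat \<Rightarrow> ('b, 'c, 'e, 'f, 'z) over_scheme \<Rightarrow> 'c \<Rightarrow> 'e \<Rightarrow> 'f \<Rightarrow> bool" where
  "cartesian_lift B p u \<alpha> k \<longleftrightarrow>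
     cartesian B p k \<and> Cod (Tot p) k = \<alpha> \<and> AMap (Prj p) k = u"

definition fibration :: "('b, 'c) cat \<Rightarrow> ('b, 'c, 'e, 'f, 'z) over_scheme \<Rightarrow> bool" where
  "fibration B p \<longleftrightarrow> cat_functor (Tot p) B (Prj p) \<and>
     (\<forall>u\<in>Arr B. \<forall>\<alpha>\<in>Obj (Tot p). OMap (Prj p) \<alpha> = Cod B u \<longrightarrow> (\<exists>k. cartesian_lift B p u \<alpha> k))"

definition cloven_fibration :: "('b, 'c) cat \<Rightarrow> ('b, 'c, 'e, 'f) cloven \<Rightarrow> bool" where
  "cloven_fibration B p \<longleftrightarrow> cat_functor (Tot p) B (Prj p) \<and>
     (\<forall>u\<in>Arr B. \<forall>\<alpha>\<in>Obj (Tot p). OMap (Prj p) \<alpha> = Cod B u \<longrightarrow>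
        cartesian_lift B p u \<alpha> (Lift p u \<alpha>))"

definition fibre ::
  "('b, 'c) cat \<Rightarrow> ('b, 'c, 'e, 'f, 'z) over_scheme \<Rightarrow> 'b \<Rightarrow> ('e, 'f) cat" where
  "fibre B p A = (Tot p)
     \<lparr>Obj := {\<alpha> \<in> Obj (Tot p). OMap (Prj p) \<alpha> = A},
      Arr := {f \<in> Arr (Tot p). AMap (Prj p) f = Id B A}\<rparr>"

text \<open>For \<open>k\<close> cartesian, the unique arrow over \<open>w\<close> through which \<open>f\<close> factors along \<open>k\<close>.\<close>

definition factor :: "('b, 'c, 'e, 'f, 'z) over_scheme \<Rightarrow> 'f \<Rightarrow> 'c \<Rightarrow> 'f \<Rightarrow> 'f" where
  "factor p k w f = (THE h. h \<in> hom (Tot p) (Dom (Tot p) f) (Dom (Tot p) k) \<and>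
     AMap (Prj p) h = w \<and> k \<cdot>\<^bsub>Tot p\<^esub> h = f)"

definition reindex ::
  "('b, 'c) cat \<Rightarrow> ('b, 'c, 'e, 'f) cloven \<Rightarrow> 'c \<Rightarrow> ('e, 'f, 'e, 'f) fctr" where
  "reindex B p u =
     \<lparr>OMap = (\<lambda>\<alpha>. Dom (Tot p) (Lift p u \<alpha>)),
      AMap = (\<lambda>f. factor p (Lift p u (Cod (Tot p) f)) (Id B (Dom B u))
                    (f \<cdot>\<^bsub>Tot p\<^esub> Lift p u (Dom (Tot p) f)))\<rparr>"

text \<open>The canonical vertical isomorphism \<open>g\<^sup>*u\<^sup>*\<alpha> \<rightarrow> (ug)\<^sup>*\<alpha>\<close>.\<close>

definition reindex_comp ::
  "('b, 'c) cat \<Rightarrow> ('b, 'c, 'e, 'f) cloven \<Rightarrow> 'c \<Rightarrow> 'c \<Rightarrow> 'e \<Rightarrow> 'f" where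
  "reindex_comp B p u g \<alpha> = factor p (Lift p (u \<cdot>\<^bsub>B\<^esub> g) \<alpha>) (Id B (Dom B g))
     (Lift p u \<alpha> \<cdot>\<^bsub>Tot p\<^esub> Lift p g (OMap (reindex B p u) \<alpha>))"

text \<open>For \<open>vg = fu\<close>, the canonical vertical isomorphism \<open>g\<^sup>*v\<^sup>*\<alpha> \<rightarrow> u\<^sup>*f\<^sup>*\<alpha>\<close>.\<close>

definition reindex_square ::
  "('b, 'c) cat \<Rightarrow> ('b, 'c, 'e, 'f) cloven \<Rightarrow> 'c \<Rightarrow> 'c \<Rightarrow> 'c \<Rightarrow> 'c \<Rightarrow> 'e \<Rightarrow> 'f" where
  "reindex_square B p f v u g \<alpha> =
     inv_arrow (fibre B p (Dom B u)) (reindex_comp B p f u \<alpha>) \<cdot>\<^bsub>Tot p\<^esub> reindex_comp B p v g \<alpha>"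

text \<open>For \<open>ug = id\<close>, the canonical vertical isomorphism
  \<open>g\<^sup>*u\<^sup>*\<alpha> \<rightarrow> (ug)\<^sup>*\<alpha> = id\<^sup>*\<alpha> \<rightarrow> \<alpha>\<close>.\<close>

definition reindex_section ::
  "('b, 'c) cat \<Rightarrow> ('b, 'c, 'e, 'f) cloven \<Rightarrow> 'c \<Rightarrow> 'c \<Rightarrow> 'e \<Rightarrow> 'f" where
  "reindex_section B p u g \<alpha> = Lift p (u \<cdot>\<^bsub>B\<^esub> g) \<alpha> \<cdot>\<^bsub>Tot p\<^esub> reindex_comp B p u g \<alpha>"


section \<open>Coproducts along display maps\<close>

record ('c, 'e, 'f) coprods =
  Coprod :: "'c \<Rightarrow> ('e, 'f, 'e, 'f) fctr"
  Unit :: "'c \<Rightarrow> 'e \<Rightarrow> 'f"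
  Counit :: "'c \<Rightarrow> 'e \<Rightarrow> 'f"

text \<open>The component at \<open>\<beta>\<close> of the canonical map \<open>\<Coprod>\<^sub>u g\<^sup>* \<Rightarrow> f\<^sup>* \<Coprod>\<^sub>v\<close>, that is the mate
  \<open>\<Coprod>\<^sub>u g\<^sup>*\<beta> \<rightarrow> \<Coprod>\<^sub>u g\<^sup>* v\<^sup>* \<Coprod>\<^sub>v \<beta> \<cong> \<Coprod>\<^sub>u u\<^sup>* f\<^sup>* \<Coprod>\<^sub>v \<beta> \<rightarrow> f\<^sup>* \<Coprod>\<^sub>v \<beta>\<close>.\<close>

definition beck_chevalley_map ::
  "('b, 'c) cat \<Rightarrow> ('b, 'c, 'e, 'f) cloven \<Rightarrow> ('c, 'e, 'f) coprods
    \<Rightarrow> 'c \<Rightarrow> 'c \<Rightarrow> 'c \<Rightarrow> 'c \<Rightarrow> 'e \<Rightarrow> 'f" where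
  "beck_chevalley_map B p C f v u g \<beta> =
     Counit C u (OMap (reindex B p f) (OMap (Coprod C v) \<beta>)) \<cdot>\<^bsub>Tot p\<^esub>
     (AMap (Coprod C u) (reindex_square B p f v u g (OMap (Coprod C v) \<beta>)) \<cdot>\<^bsub>Tot p\<^esub>
      AMap (Coprod C u) (AMap (reindex B p g) (Unit C v \<beta>)))"

definition has_coproducts ::
  "('b, 'c) cat \<Rightarrow> 'c set \<Rightarrow> ('b, 'c, 'e, 'f) cloven \<Rightarrow> ('c, 'e, 'f) coprods \<Rightarrow> bool" where
  "has_coproducts B F p C \<longleftrightarrow>
     (\<forall>v\<in>F. adjunction (fibre B p (Dom B v)) (fibre B p (Cod B v))
               (Coprod C v) (reindex B p v) (Unit C v) (Counit C v)) \<and>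
     (\<forall>f v u g. v \<in> F \<and> u \<in> F \<and> is_pullback B f v u g \<longrightarrow>
        (\<forall>\<beta>\<in>Obj (fibre B p (Dom B v)).
           is_iso (fibre B p (Dom B f)) (beck_chevalley_map B p C f v u g \<beta>)))"

text \<open>Existence and uniqueness concern the pair of the section \<open>g\<close> and the vertical arrow \<open>k\<close>.\<close>

definition quantifier_splitting ::
  "('b, 'c) cat \<Rightarrow> 'c set \<Rightarrow> ('b, 'c, 'e, 'f) cloven \<Rightarrow> ('c, 'e, 'f) coprods \<Rightarrow> 'e \<Rightarrow> bool" where
  "quantifier_splitting B F p C \<alpha> \<longleftrightarrow> \<alpha> \<in> Obj (Tot p) \<and>
     (\<forall>u\<in>F. Cod B u = OMap (Prj p) \<alpha> \<longrightarrow>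
       (\<forall>\<beta>\<in>Obj (fibre B p (Dom B u)).
        \<forall>h\<in>hom (fibre B p (Cod B u)) \<alpha> (OMap (Coprod C u) \<beta>).
          \<exists>!gk. case gk of (g, k) \<Rightarrow>
            g \<in> hom B (Cod B u) (Dom B u) \<and> u \<cdot>\<^bsub>B\<^esub> g = Id B (Cod B u) \<and>
            k \<in> hom (fibre B p (Cod B u)) \<alpha> (OMap (reindex B p g) \<beta>) \<and>
            h = (reindex_section B p u g (OMap (Coprod C u) \<beta>) \<cdot>\<^bsub>Tot p\<^esub>
                 AMap (reindex B p g) (Unit C u \<beta>)) \<cdot>\<^bsub>Tot p\<^esub> k))"

definition quantifier_free ::
  "('b, 'c) cat \<Rightarrow> 'c set \<Rightarrow> ('b, 'c, 'e, 'f) cloven \<Rightarrow> ('c, 'e, 'f) coprods \<Rightarrow> 'e \<Rightarrow> bool" where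
  "quantifier_free B F p C \<alpha> \<longleftrightarrow> \<alpha> \<in> Obj (Tot p) \<and>
     (\<forall>f\<in>Arr B. Cod B f = OMap (Prj p) \<alpha> \<longrightarrow>
        quantifier_splitting B F p C (OMap (reindex B p f) \<alpha>))"

definition enough_quantifier_free ::
  "('b, 'c) cat \<Rightarrow> 'c set \<Rightarrow> ('b, 'c, 'e, 'f) cloven \<Rightarrow> ('c, 'e, 'f) coprods \<Rightarrow> bool" where
  "enough_quantifier_free B F p C \<longleftrightarrow> has_coproducts B F p C \<and>
     (\<forall>I\<in>Obj B. \<forall>\<alpha>\<in>Obj (fibre B p I).
        \<exists>f\<in>F. Cod B f = I \<and>
          (\<exists>\<beta>\<in>Obj (fibre B p (Dom B f)).
             quantifier_free B F p C \<beta> \<and>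
             isomorphic (fibre B p I) \<alpha> (OMap (Coprod C f) \<beta>)))"


section \<open>The coproduct completion\<close>

text \<open>An arrow of the completion records its source and target, which its components alone do
  not determine.\<close>

datatype ('c, 'e, 'f) sigma_arr =
  SigmaArr (Src: "'c \<times> 'e") (Tgt: "'c \<times> 'e") (Base: 'c) (Index: 'c) (Family: 'f)

definition sigma_obj ::
  "('b, 'c) cat \<Rightarrow> 'c set \<Rightarrow> ('b, 'c, 'e, 'f, 'z) over_scheme \<Rightarrow> ('c \<times> 'e) set" where
  "sigma_obj B F q = {(g, \<alpha>). g \<in> F \<and> \<alpha> \<in> Obj (fibre B q (Dom B g))}"

definition sigma_arrows ::
  "('b, 'c) cat \<Rightarrow> 'c set \<Rightarrow> ('b, 'c, 'e, 'f, 'z) over_scheme \<Rightarrow> ('c, 'e, 'f) sigma_arr set" where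
  "sigma_arrows B F q = {SigmaArr (g, \<alpha>) (h, \<beta>) f0 f1 \<phi> | g \<alpha> h \<beta> f0 f1 \<phi>.
     (g, \<alpha>) \<in> sigma_obj B F q \<and> (h, \<beta>) \<in> sigma_obj B F q \<and>
     f0 \<in> hom B (Cod B g) (Cod B h) \<and> f1 \<in> hom B (Dom B g) (Dom B h) \<and>
     h \<cdot>\<^bsub>B\<^esub> f1 = f0 \<cdot>\<^bsub>B\<^esub> g \<and>
     \<phi> \<in> hom (Tot q) \<alpha> \<beta> \<and> AMap (Prj q) \<phi> = f1}"

definition Sigma_cat ::
  "('b, 'c) cat \<Rightarrow> 'c set \<Rightarrow> ('b, 'c, 'e, 'f, 'z) over_scheme
    \<Rightarrow> ('c \<times> 'e, ('c, 'e, 'f) sigma_arr) cat" where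
  "Sigma_cat B F q =
     \<lparr>Obj = sigma_obj B F q,
      Arr = sigma_arrows B F q,
      Dom = Src,
      Cod = Tgt,
      Id = (\<lambda>x. SigmaArr x x (Id B (Cod B (fst x))) (Id B (Dom B (fst x))) (Id (Tot q) (snd x))),
      Comp = (\<lambda>m n. SigmaArr (Src n) (Tgt m) (Base m \<cdot>\<^bsub>B\<^esub> Base n) (Index m \<cdot>\<^bsub>B\<^esub> Index n)
                       (Family m \<cdot>\<^bsub>Tot q\<^esub> Family n))\<rparr>"

definition coproduct_completion ::
  "('b, 'c) cat \<Rightarrow> 'c set \<Rightarrow> ('b, 'c, 'e, 'f, 'z) over_scheme
    \<Rightarrow> ('b, 'c, 'c \<times> 'e, ('c, 'e, 'f) sigma_arr) over" where
  "coproduct_completion B F q =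
     \<lparr>Tot = Sigma_cat B F q,
      Prj = \<lparr>OMap = (\<lambda>x. Cod B (fst x)), AMap = Base\<rparr>\<rparr>"


section \<open>Fibred equivalence\<close>

definition fibred_functor ::
  "('b, 'c) cat \<Rightarrow> ('b, 'c, 'e1, 'f1, 'y) over_scheme \<Rightarrow> ('b, 'c, 'e2, 'f2, 'z) over_scheme
    \<Rightarrow> ('e1, 'f1, 'e2, 'f2) fctr \<Rightarrow> bool" where
  "fibred_functor B p q H \<longleftrightarrow> cat_functor (Tot p) (Tot q) H \<and>
     (\<forall>\<alpha>\<in>Obj (Tot p). OMap (Prj q) (OMap H \<alpha>) = OMap (Prj p) \<alpha>) \<and>
     (\<forall>f\<in>Arr (Tot p). AMap (Prj q) (AMap H f) = AMap (Prj p) f) \<and>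
     (\<forall>f. cartesian B p f \<longrightarrow> cartesian B q (AMap H f))"

definition vertical_nat_iso ::
  "('b, 'c) cat \<Rightarrow> ('b, 'c, 'e1, 'f1, 'y) over_scheme \<Rightarrow> ('b, 'c, 'e2, 'f2, 'z) over_scheme
    \<Rightarrow> ('e1, 'f1, 'e2, 'f2) fctr \<Rightarrow> ('e1, 'f1, 'e2, 'f2) fctr \<Rightarrow> ('e1 \<Rightarrow> 'f2) \<Rightarrow> bool" where
  "vertical_nat_iso B p q H K t \<longleftrightarrow> nat_transformation (Tot p) (Tot q) H K t \<and>
     (\<forall>\<alpha>\<in>Obj (Tot p). is_iso (Tot q) (t \<alpha>) \<and> AMap (Prj q) (t \<alpha>) = Id B (OMap (Prj p) \<alpha>))"

definition fibred_equivalent ::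
  "('b, 'c) cat \<Rightarrow> ('b, 'c, 'e1, 'f1, 'y) over_scheme \<Rightarrow> ('b, 'c, 'e2, 'f2, 'z) over_scheme
    \<Rightarrow> bool" where
  "fibred_equivalent B p q \<longleftrightarrow> fibration B p \<and> fibration B q \<and>
     (\<exists>H K s t. fibred_functor B p q H \<and> fibred_functor B q p K \<and>
        vertical_nat_iso B p p id_fctr (comp_fctr K H) s \<and>
        vertical_nat_iso B q q (comp_fctr H K) id_fctr t)"

end

theory Submission
  imports Defs
begin

text \<open>The composite of the unit \<open>\<beta> \<rightarrow> u\<^sup>*\<Coprod>\<^sub>u\<beta>\<close> with the chosen lift of \<open>u\<close> is an opcartesian arrow
  \<open>\<beta> \<rightarrow> \<Coprod>\<^sub>u\<beta>\<close> over \<open>u\<close>, and a pair of a section \<open>g\<close> and a vertical arrow \<open>\<alpha> \<rightarrow> g\<^sup>*\<beta>\<close> is the same as an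
  arrow \<open>\<alpha> \<rightarrow> \<beta>\<close>. Hence, by Beck--Chevalley, \<open>\<alpha>\<close> is quantifier-splitting iff arrows out of \<open>\<alpha>\<close> lift
  uniquely along all opcartesian arrows over display maps.

  In a completion the objects indexed by an identity have this property, stably under reindexing,
  and every object receives an opcartesian arrow over a display map from one of them; both facts
  transfer along an equivalence. Conversely, the quantifier-free objects form a subfibration \<open>q\<close>,
  the functor \<open>(g, \<alpha>) \<mapsto> \<Coprod>\<^sub>g\<alpha>\<close> from the completion of \<open>q\<close> is fully faithful by unique lifting, and it is
  essentially surjective when there are enough quantifier-free objects.\<close>

section \<open>Categories and isomorphisms\<close>

text \<open>The definitions speak of a chosen cleavage, chosen adjunctions and the coherence
  isomorphisms between them, none of which an equivalence over the base need preserve. Each is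
  therefore traded once for the equation that characterises it after composing with lifts; what
  follows uses only cartesian and opcartesian arrows. A second mismatch is that splitting is stated
  for vertical \<open>h\<close>, whereas full faithfulness concerns arrows over an arbitrary
  \<open>f0\<close>. Pulling the display map back along the base of \<open>h\<close> bridges the
  two, and this is what Beck-Chevalley is for.

  Full faithfulness then reads: an arrow from the coproduct of \<alpha> along \<open>g\<close> to
  that of \<beta> along \<open>h\<close>, over \<open>f0\<close>, is an arrow out of \<alpha> over
  \<open>f0 g\<close>, which lifts uniquely to some \<phi> from \<alpha> to \<beta>. The base
  \<open>f1\<close> of \<phi> is read off, not chosen, and the square \<open>h f1 = f0 g\<close> is
  the projection of the lifting equation. In the completion, units provide the objects indexed by an
  identity, and closure of \<open>F\<close> under composition provides the opcartesian arrows from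
  \<open>(g, \<alpha>)\<close> to \<open>(k g, \<alpha>)\<close> against which lifting is
  tested.\<close>

context category
begin

lemma comp_arr [simp]:
  assumes "f \<in> Arr C" "g \<in> Arr C" "Dom C g = Cod C f"
  shows "g \<cdot> f \<in> Arr C" "Dom C (g \<cdot> f) = Dom C f" "Cod C (g \<cdot> f) = Cod C g"
  using comp_in[of f "Dom C f" "Cod C f" g "Cod C g"] assms by (auto simp: hom_def)

lemma comp_assoc [simp]:
  assumes "f \<in> Arr C" "g \<in> Arr C" "h \<in> Arr C" "Dom C g = Cod C f" "Dom C h = Cod C g"
  shows "(h \<cdot> g) \<cdot> f = h \<cdot> (g \<cdot> f)"
  using assoc[of f "Dom C f" "Cod C f" g "Cod C g" h "Cod C h"] assms by (auto simp: hom_def)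

lemma id_arr [simp]:
  assumes "A \<in> Obj C"
  shows "Id C A \<in> Arr C" "Dom C (Id C A) = A" "Cod C (Id C A) = A"
  using id_in[OF assms] by (auto simp: hom_def)

lemma id_comp [simp]:
  "\<lbrakk>f \<in> Arr C; Cod C f = A\<rbrakk> \<Longrightarrow> Id C A \<cdot> f = f"
  "\<lbrakk>f \<in> Arr C; Dom C f = A\<rbrakk> \<Longrightarrow> f \<cdot> Id C A = f"
  using id_left id_right by auto

declare dom_in [simp] cod_in [simp]

lemma inverse_arrows_unique:
  assumes "inverse_arrows C f g" "inverse_arrows C f g'"
  shows "g = g'"
proof -
  have "g = (g' \<cdot> f) \<cdot> g" using assms by (auto simp: inverse_arrows_def hom_def)
  also have "\<dots> = g' \<cdot> (f \<cdot> g)"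
    using assms by (intro comp_assoc) (auto simp: inverse_arrows_def hom_def)
  also have "\<dots> = g'" using assms by (auto simp: inverse_arrows_def hom_def)
  finally show ?thesis .
qed

lemma inv_arrow:
  assumes "is_iso C f"
  shows "inverse_arrows C f (inv_arrow C f)"
  unfolding inv_arrow_def
  using assms inverse_arrows_unique by (metis (full_types) is_iso_def theI)

end

context cat_functor
begin

lemma map_arr [simp]:
  assumes "f \<in> Arr C"
  shows "AMap H f \<in> Arr D" "Dom D (AMap H f) = OMap H (Dom C f)" "Cod D (AMap H f) = OMap H (Cod C f)"
  using map_hom[of f "Dom C f" "Cod C f"] assms by (auto simp: hom_def)

lemma map_comp_arr [simp]:
  assumes "f \<in> Arr C" "g \<in> Arr C" "Dom C g = Cod C f"
  shows "AMap H (g \<cdot>\<^bsub>C\<^esub> f) = AMap H g \<cdot>\<^bsub>D\<^esub> AMap H f"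
  using map_comp[of f "Dom C f" "Cod C f" g "Cod C g"] assms by (auto simp: hom_def)

declare map_obj [simp] map_id [simp]

lemma map_inverse_arrows:
  assumes "inverse_arrows C f g"
  shows "inverse_arrows D (AMap H f) (AMap H g)"
proof -
  have [simp]: "f \<in> Arr C" "g \<in> Arr C" "Dom C g = Cod C f" "Cod C g = Dom C f"
    and *: "g \<cdot>\<^bsub>C\<^esub> f = Id C (Dom C f)" "f \<cdot>\<^bsub>C\<^esub> g = Id C (Cod C f)"
    using assms by (auto simp: inverse_arrows_def hom_def)
  have "AMap H g \<cdot>\<^bsub>D\<^esub> AMap H f = Id D (OMap H (Dom C f))"
    "AMap H f \<cdot>\<^bsub>D\<^esub> AMap H g = Id D (OMap H (Cod C f))"
    using arg_cong[OF *(1), of "AMap H"] arg_cong[OF *(2), of "AMap H"] by simp_all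
  then show ?thesis by (auto simp: inverse_arrows_def hom_def)
qed

end

section \<open>Categories over a base\<close>

text \<open>Keeping the base arrow as a parameter makes fibre homs the case of an identity, and lets
  base arrows be computed along with composites instead of being carried as side conditions.\<close>

definition hom_over ::
  "('b, 'c, 'e, 'f, 'z) over_scheme \<Rightarrow> 'c \<Rightarrow> 'e \<Rightarrow> 'e \<Rightarrow> 'f set" where
  "hom_over p w a b = {f \<in> hom (Tot p) a b. AMap (Prj p) f = w}"

lemma hom_over_iff:
  "f \<in> hom_over p w a b \<longleftrightarrow>
     f \<in> Arr (Tot p) \<and> Dom (Tot p) f = a \<and> Cod (Tot p) f = b \<and> AMap (Prj p) f = w"
  by (auto simp: hom_over_def hom_def)

lemma hom_overD:
  assumes "f \<in> hom_over p w a b"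
  shows "f \<in> Arr (Tot p)" "Dom (Tot p) f = a" "Cod (Tot p) f = b" "AMap (Prj p) f = w"
  using assms by (auto simp: hom_over_iff)

lemma hom_fibre: "hom (fibre B p A) a b = hom_over p (Id B A) a b"
  by (auto simp: hom_over_def hom_def fibre_def)

lemma Obj_fibre: "a \<in> Obj (fibre B p A) \<longleftrightarrow> a \<in> Obj (Tot p) \<and> OMap (Prj p) a = A"
  by (simp add: fibre_def)

lemma fibre_simps [simp]:
  "Dom (fibre B p A) = Dom (Tot p)" "Cod (fibre B p A) = Cod (Tot p)"
  "Id (fibre B p A) = Id (Tot p)" "Comp (fibre B p A) = Comp (Tot p)"
  "f \<in> Arr (fibre B p A) \<longleftrightarrow> f \<in> Arr (Tot p) \<and> AMap (Prj p) f = Id B A"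
  by (simp_all add: fibre_def)

text \<open>The strong form, with factorisations over every \<open>w\<close> out of the codomain
  rather than over the identity alone: an arrow out of a coproduct over an arbitrary base arrow has
  to be determined by its restriction along the injection.\<close>

definition opcartesian :: "('b, 'c) cat \<Rightarrow> ('b, 'c, 'e, 'f, 'z) over_scheme \<Rightarrow> 'f \<Rightarrow> bool" where
  "opcartesian B p k \<longleftrightarrow> k \<in> Arr (Tot p) \<and>
     (\<forall>f w. f \<in> Arr (Tot p) \<and> Dom (Tot p) f = Dom (Tot p) k \<and>
        w \<in> hom B (OMap (Prj p) (Cod (Tot p) k)) (OMap (Prj p) (Cod (Tot p) f)) \<and>
        AMap (Prj p) f = w \<cdot>\<^bsub>B\<^esub> AMap (Prj p) k \<longrightarrow>
        (\<exists>!h. h \<in> hom_over p w (Cod (Tot p) k) (Cod (Tot p) f) \<and> h \<cdot>\<^bsub>Tot p\<^esub> k = f))"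

locale over_category =
  cat_functor "Tot p" B "Prj p" for B :: "('b, 'c) cat" and p :: "('b, 'c, 'e, 'f, 'z) over_scheme"
begin

lemma hom_over_comp [intro]:
  assumes "f \<in> hom_over p v a b" "g \<in> hom_over p w b c"
  shows "g \<cdot>\<^bsub>Tot p\<^esub> f \<in> hom_over p (w \<cdot>\<^bsub>B\<^esub> v) a c"
  using assms by (auto simp: hom_over_iff)

lemma hom_over_base:
  assumes "f \<in> hom_over p w a b"
  shows "w \<in> Arr B" "Dom B w = OMap (Prj p) a" "Cod B w = OMap (Prj p) b"
    "a \<in> Obj (Tot p)" "b \<in> Obj (Tot p)"
  using assms by (auto simp: hom_over_iff)

lemmas over_simps = hom_overD hom_over_base

text \<open>The unit law of \<open>B\<close> is already applied, so that the base arrow stays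
  literally \<open>w\<close>; \<open>vertical_comp\<close> is the mirror image.\<close>

lemma comp_vertical [intro]:
  assumes "f \<in> hom_over p w a b" "g \<in> hom_over p (Id B A) b c" "A \<in> Obj B"
  shows "g \<cdot>\<^bsub>Tot p\<^esub> f \<in> hom_over p w a c"
  using hom_over_comp[OF assms(1,2)] over_simps[OF assms(1)] over_simps[OF assms(2)] assms(3)
  by simp

lemma vertical_comp [intro]:
  assumes "f \<in> hom_over p (Id B A) a b" "g \<in> hom_over p w b c" "A \<in> Obj B"
  shows "g \<cdot>\<^bsub>Tot p\<^esub> f \<in> hom_over p w a c"
  using hom_over_comp[OF assms(1,2)] over_simps[OF assms(1)] over_simps[OF assms(2)] assms(3)
  by simp

lemma hom_over_assoc:
  assumes "f \<in> hom_over p u a b" "g \<in> hom_over p v b c" "h \<in> hom_over p w c d"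
  shows "(h \<cdot>\<^bsub>Tot p\<^esub> g) \<cdot>\<^bsub>Tot p\<^esub> f = h \<cdot>\<^bsub>Tot p\<^esub> (g \<cdot>\<^bsub>Tot p\<^esub> f)"
  using assms by (simp add: hom_over_iff)

lemma id_vertical:
  "a \<in> Obj (Tot p) \<Longrightarrow> Id (Tot p) a \<in> hom_over p (Id B (OMap (Prj p) a)) a a"
  by (simp add: hom_over_iff)

lemma hom_over_id:
  assumes "f \<in> hom_over p w a b"
  shows "Id (Tot p) b \<cdot>\<^bsub>Tot p\<^esub> f = f" "f \<cdot>\<^bsub>Tot p\<^esub> Id (Tot p) a = f"
  using assms by (auto simp: hom_over_iff)

lemma hom_overI:
  "f \<in> Arr (Tot p) \<Longrightarrow> f \<in> hom_over p (AMap (Prj p) f) (Dom (Tot p) f) (Cod (Tot p) f)"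
  by (simp add: hom_over_iff)

section \<open>Universal properties of cartesian and opcartesian arrows\<close>

lemma cartesian_unique_factor:
  assumes "cartesian B p k" "k \<in> hom_over p u a b" "f \<in> hom_over p (u \<cdot>\<^bsub>B\<^esub> w) c b"
    "w \<in> hom B (OMap (Prj p) c) (OMap (Prj p) a)"
  shows "\<exists>!h. h \<in> hom_over p w c a \<and> k \<cdot>\<^bsub>Tot p\<^esub> h = f"
proof -
  have "\<exists>!h. h \<in> hom (Tot p) (Dom (Tot p) f) (Dom (Tot p) k) \<and>
              AMap (Prj p) h = w \<and> k \<cdot>\<^bsub>Tot p\<^esub> h = f"
    using assms(1)[unfolded cartesian_def, THEN conjunct2, rule_format, of f w]
      hom_overD[OF assms(2)] hom_overD[OF assms(3)] assms(4) by simp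
  then show ?thesis using assms(2,3) by (simp add: hom_over_def hom_def conj_ac)
qed

lemma cartesian_cancel:
  assumes "cartesian B p k" "k \<in> hom_over p u a b" "h \<in> hom_over p w c a" "h' \<in> hom_over p w c a"
    "k \<cdot>\<^bsub>Tot p\<^esub> h = k \<cdot>\<^bsub>Tot p\<^esub> h'"
  shows "h = h'"
  using cartesian_unique_factor[OF assms(1,2) hom_over_comp[OF assms(3,2)]] assms(3-5)
    hom_over_base[OF assms(3)] by (auto simp: hom_def)

lemma cartesian_factor:
  assumes "cartesian B p k" "k \<in> hom_over p u a b" "f \<in> hom_over p (u \<cdot>\<^bsub>B\<^esub> w) c b"
    "w \<in> hom B (OMap (Prj p) c) (OMap (Prj p) a)"
  shows "factor p k w f \<in> hom_over p w c a" "k \<cdot>\<^bsub>Tot p\<^esub> factor p k w f = f"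
proof -
  have "factor p k w f = (THE h. h \<in> hom_over p w c a \<and> k \<cdot>\<^bsub>Tot p\<^esub> h = f)"
    using assms(2,3) by (simp add: factor_def hom_over_def hom_def conj_ac)
  with theI'[OF cartesian_unique_factor[OF assms]]
  show "factor p k w f \<in> hom_over p w c a" "k \<cdot>\<^bsub>Tot p\<^esub> factor p k w f = f" by simp_all
qed

lemma cartesianI:
  assumes "k \<in> hom_over p u a b"
    and "\<And>f c w. f \<in> hom_over p (u \<cdot>\<^bsub>B\<^esub> w) c b \<Longrightarrow> w \<in> hom B (OMap (Prj p) c) (OMap (Prj p) a)
      \<Longrightarrow> \<exists>h \<in> hom_over p w c a. k \<cdot>\<^bsub>Tot p\<^esub> h = f"
    and "\<And>c w h h'. h \<in> hom_over p w c a \<Longrightarrow> h' \<in> hom_over p w c a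
      \<Longrightarrow> k \<cdot>\<^bsub>Tot p\<^esub> h = k \<cdot>\<^bsub>Tot p\<^esub> h' \<Longrightarrow> h = h'"
  shows "cartesian B p k"
  unfolding cartesian_def
proof (intro conjI allI impI)
  show "k \<in> Arr (Tot p)" using assms(1) by (simp add: hom_over_iff)
  fix f w
  assume *: "f \<in> Arr (Tot p) \<and> Cod (Tot p) f = Cod (Tot p) k \<and>
    w \<in> hom B (OMap (Prj p) (Dom (Tot p) f)) (OMap (Prj p) (Dom (Tot p) k)) \<and>
    AMap (Prj p) f = AMap (Prj p) k \<cdot>\<^bsub>B\<^esub> w"
  have "f \<in> hom_over p (u \<cdot>\<^bsub>B\<^esub> w) (Dom (Tot p) f) b"
    using * assms(1) by (simp add: hom_over_iff)
  then have "\<exists>!h. h \<in> hom_over p w (Dom (Tot p) f) a \<and> k \<cdot>\<^bsub>Tot p\<^esub> h = f"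
    using assms(2)[of f w] assms(3)[of _ w "Dom (Tot p) f"] * hom_overD(2)[OF assms(1)] by metis
  then show "\<exists>!h. h \<in> hom (Tot p) (Dom (Tot p) f) (Dom (Tot p) k) \<and>
              AMap (Prj p) h = w \<and> k \<cdot>\<^bsub>Tot p\<^esub> h = f"
    using assms(1) by (simp add: hom_over_def hom_def conj_ac)
qed

lemma opcartesian_unique_factor:
  assumes "opcartesian B p k" "k \<in> hom_over p u a b" "f \<in> hom_over p (w \<cdot>\<^bsub>B\<^esub> u) a c"
    "w \<in> hom B (OMap (Prj p) b) (OMap (Prj p) c)"
  shows "\<exists>!h. h \<in> hom_over p w b c \<and> h \<cdot>\<^bsub>Tot p\<^esub> k = f"
  using assms(1)[unfolded opcartesian_def, THEN conjunct2, rule_format, of f w]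
    hom_overD[OF assms(2)] hom_overD[OF assms(3)] assms(4) by simp

lemma opcartesian_cancel:
  assumes "opcartesian B p k" "k \<in> hom_over p u a b" "h \<in> hom_over p w b c" "h' \<in> hom_over p w b c"
    "h \<cdot>\<^bsub>Tot p\<^esub> k = h' \<cdot>\<^bsub>Tot p\<^esub> k"
  shows "h = h'"
  using opcartesian_unique_factor[OF assms(1,2) hom_over_comp[OF assms(2,3)]] assms(3-5)
    hom_over_base[OF assms(3)] by (auto simp: hom_def)

lemma opcartesianI:
  assumes "k \<in> hom_over p u a b"
    and "\<And>f c w. f \<in> hom_over p (w \<cdot>\<^bsub>B\<^esub> u) a c \<Longrightarrow> w \<in> hom B (OMap (Prj p) b) (OMap (Prj p) c)
      \<Longrightarrow> \<exists>h \<in> hom_over p w b c. h \<cdot>\<^bsub>Tot p\<^esub> k = f"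
    and "\<And>c w h h'. h \<in> hom_over p w b c \<Longrightarrow> h' \<in> hom_over p w b c
      \<Longrightarrow> h \<cdot>\<^bsub>Tot p\<^esub> k = h' \<cdot>\<^bsub>Tot p\<^esub> k \<Longrightarrow> h = h'"
  shows "opcartesian B p k"
  unfolding opcartesian_def
proof (intro conjI allI impI)
  show "k \<in> Arr (Tot p)" using assms(1) by (simp add: hom_over_iff)
  fix f w
  assume *: "f \<in> Arr (Tot p) \<and> Dom (Tot p) f = Dom (Tot p) k \<and>
        w \<in> hom B (OMap (Prj p) (Cod (Tot p) k)) (OMap (Prj p) (Cod (Tot p) f)) \<and>
        AMap (Prj p) f = w \<cdot>\<^bsub>B\<^esub> AMap (Prj p) k"
  have "f \<in> hom_over p (w \<cdot>\<^bsub>B\<^esub> u) a (Cod (Tot p) f)"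
    using * assms(1) by (simp add: hom_over_iff)
  then show "\<exists>!h. h \<in> hom_over p w (Cod (Tot p) k) (Cod (Tot p) f) \<and> h \<cdot>\<^bsub>Tot p\<^esub> k = f"
    using assms(2)[of f w] assms(3)[of _ w "Cod (Tot p) f"] * hom_overD(3)[OF assms(1)] by metis
qed

text \<open>Carries the inverse as an argument, so that cancellation needs no
  \<open>inv_arrow\<close>. Both arrows lie over the same identity, so the two ends can be exchanged
  freely.\<close>

definition vertical_iso :: "'e \<Rightarrow> 'e \<Rightarrow> 'f \<Rightarrow> 'f \<Rightarrow> bool" where
  "vertical_iso a b i j \<longleftrightarrow> i \<in> hom_over p (Id B (OMap (Prj p) a)) a b \<and>
     j \<in> hom_over p (Id B (OMap (Prj p) a)) b a \<and>
     j \<cdot>\<^bsub>Tot p\<^esub> i = Id (Tot p) a \<and> i \<cdot>\<^bsub>Tot p\<^esub> j = Id (Tot p) b"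

lemma vertical_isoD:
  assumes "vertical_iso a b i j"
  shows "i \<in> hom_over p (Id B (OMap (Prj p) a)) a b" "j \<in> hom_over p (Id B (OMap (Prj p) a)) b a"
    "j \<cdot>\<^bsub>Tot p\<^esub> i = Id (Tot p) a" "i \<cdot>\<^bsub>Tot p\<^esub> j = Id (Tot p) b"
    "OMap (Prj p) b = OMap (Prj p) a" "a \<in> Obj (Tot p)" "b \<in> Obj (Tot p)" "OMap (Prj p) a \<in> Obj B"
proof -
  show i: "i \<in> hom_over p (Id B (OMap (Prj p) a)) a b" "j \<in> hom_over p (Id B (OMap (Prj p) a)) b a"
    "j \<cdot>\<^bsub>Tot p\<^esub> i = Id (Tot p) a" "i \<cdot>\<^bsub>Tot p\<^esub> j = Id (Tot p) b"
    using assms by (auto simp: vertical_iso_def)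
  show "OMap (Prj p) b = OMap (Prj p) a" "a \<in> Obj (Tot p)" "b \<in> Obj (Tot p)" "OMap (Prj p) a \<in> Obj B"
    using hom_over_base[OF i(1)] by auto
qed

lemma vertical_iso_sym: "vertical_iso a b i j \<Longrightarrow> vertical_iso b a j i"
  using vertical_isoD(5)[of a b i j] by (auto simp: vertical_iso_def)

lemma vertical_iso_is_iso:
  assumes "vertical_iso a b i j"
  shows "is_iso (Tot p) i"
  using vertical_isoD[OF assms] unfolding is_iso_def inverse_arrows_def hom_def hom_over_iff by blast

text \<open>Projecting to the base turns \<open>j\<close> into an inverse of an identity. By
  uniqueness of inverses it lies over that identity, so the inverse of a vertical arrow is
  vertical.\<close>

lemma is_iso_vertical_iso:
  assumes "is_iso (Tot p) i" "i \<in> hom_over p (Id B (OMap (Prj p) a)) a b"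
  obtains j where "vertical_iso a b i j"
proof -
  from assms(1) obtain j where j: "inverse_arrows (Tot p) i j" by (auto simp: is_iso_def)
  have "inverse_arrows B (AMap (Prj p) i) (AMap (Prj p) j)" by (rule map_inverse_arrows[OF j])
  moreover have "inverse_arrows B (AMap (Prj p) i) (AMap (Prj p) i)"
    using over_simps[OF assms(2)] by (auto simp: inverse_arrows_def hom_def)
  ultimately have "AMap (Prj p) j = AMap (Prj p) i"
    by (rule target.inverse_arrows_unique)
  then have "vertical_iso a b i j"
    using assms(2) j by (auto simp: vertical_iso_def hom_over_iff inverse_arrows_def hom_def)
  then show ?thesis by (rule that)
qed

lemma is_iso_fibre_iff:
  assumes "i \<in> hom_over p (Id B A) a b" "A = OMap (Prj p) a"
  shows "is_iso (fibre B p A) i \<longleftrightarrow> is_iso (Tot p) i"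
proof
  assume "is_iso (fibre B p A) i"
  then show "is_iso (Tot p) i"
    unfolding is_iso_def inverse_arrows_def hom_fibre by (auto simp: hom_over_def)
next
  assume "is_iso (Tot p) i"
  with assms obtain j where "vertical_iso a b i j" by (blast intro: is_iso_vertical_iso)
  then show "is_iso (fibre B p A) i"
    unfolding is_iso_def inverse_arrows_def hom_fibre using assms
    by (auto simp: vertical_iso_def hom_over_iff intro!: exI[of _ j])
qed

lemma isomorphic_fibre_iff:
  assumes "A = OMap (Prj p) a"
  shows "isomorphic (fibre B p A) a b \<longleftrightarrow> (\<exists>i j. vertical_iso a b i j)"
  unfolding isomorphic_def hom_fibre
  using assms is_iso_fibre_iff is_iso_vertical_iso vertical_iso_is_iso vertical_isoD(1)
  by metis

section \<open>Vertical isomorphisms as comparisons between universal arrows\<close>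

lemma vertical_iso_cancel:
  assumes "vertical_iso a b i j"
  shows "f \<in> hom_over p w b c \<Longrightarrow> (f \<cdot>\<^bsub>Tot p\<^esub> i) \<cdot>\<^bsub>Tot p\<^esub> j = f"
    and "f \<in> hom_over p w c a \<Longrightarrow> j \<cdot>\<^bsub>Tot p\<^esub> (i \<cdot>\<^bsub>Tot p\<^esub> f) = f"
proof -
  note v = vertical_isoD[OF assms]
  show "f \<in> hom_over p w b c \<Longrightarrow> (f \<cdot>\<^bsub>Tot p\<^esub> i) \<cdot>\<^bsub>Tot p\<^esub> j = f"
    using hom_over_assoc[OF v(2) v(1), of f w c] v hom_over_id by auto
  show "f \<in> hom_over p w c a \<Longrightarrow> j \<cdot>\<^bsub>Tot p\<^esub> (i \<cdot>\<^bsub>Tot p\<^esub> f) = f"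
    using hom_over_assoc[OF _ v(1) v(2), of f w c] v hom_over_id by auto
qed

lemma vertical_iso_cartesian:
  assumes "vertical_iso a b i j"
  shows "cartesian B p i"
proof (rule cartesianI)
  note v = vertical_isoD[OF assms]
  show "i \<in> hom_over p (Id B (OMap (Prj p) a)) a b" by (rule v)
  fix f c w
  assume f: "f \<in> hom_over p (Id B (OMap (Prj p) a) \<cdot>\<^bsub>B\<^esub> w) c b"
    and w: "w \<in> hom B (OMap (Prj p) c) (OMap (Prj p) a)"
  have "f \<in> hom_over p w c b" using f w by (simp add: hom_def)
  then show "\<exists>h \<in> hom_over p w c a. i \<cdot>\<^bsub>Tot p\<^esub> h = f"
    using v vertical_iso_cancel(2)[OF vertical_iso_sym[OF assms]]
    by (intro bexI[of _ "j \<cdot>\<^bsub>Tot p\<^esub> f"]) auto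
next
  fix c w h h'
  assume "h \<in> hom_over p w c a" "h' \<in> hom_over p w c a" "i \<cdot>\<^bsub>Tot p\<^esub> h = i \<cdot>\<^bsub>Tot p\<^esub> h'"
  then show "h = h'" using vertical_iso_cancel(2)[OF assms] by metis
qed

lemma cartesian_comp:
  assumes "cartesian B p k" "k \<in> hom_over p u a b" "cartesian B p l" "l \<in> hom_over p v b c"
  shows "cartesian B p (l \<cdot>\<^bsub>Tot p\<^esub> k)"
proof (rule cartesianI)
  show "l \<cdot>\<^bsub>Tot p\<^esub> k \<in> hom_over p (v \<cdot>\<^bsub>B\<^esub> u) a c" using assms by auto
  note u = hom_over_base[OF assms(2)] and v = hom_over_base[OF assms(4)]
  fix f d w
  assume f: "f \<in> hom_over p ((v \<cdot>\<^bsub>B\<^esub> u) \<cdot>\<^bsub>B\<^esub> w) d c" and w: "w \<in> hom B (OMap (Prj p) d) (OMap (Prj p) a)"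
  have f': "f \<in> hom_over p (v \<cdot>\<^bsub>B\<^esub> (u \<cdot>\<^bsub>B\<^esub> w)) d c" using f u v w by (simp add: hom_def)
  have uw: "u \<cdot>\<^bsub>B\<^esub> w \<in> hom B (OMap (Prj p) d) (OMap (Prj p) b)" using u v w by (simp add: hom_def)
  obtain h where h: "h \<in> hom_over p (u \<cdot>\<^bsub>B\<^esub> w) d b" "l \<cdot>\<^bsub>Tot p\<^esub> h = f"
    using cartesian_unique_factor[OF assms(3,4) f' uw] by blast
  obtain g where g: "g \<in> hom_over p w d a" "k \<cdot>\<^bsub>Tot p\<^esub> g = h"
    using cartesian_unique_factor[OF assms(1,2) h(1) w] by blast
  show "\<exists>g \<in> hom_over p w d a. (l \<cdot>\<^bsub>Tot p\<^esub> k) \<cdot>\<^bsub>Tot p\<^esub> g = f"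
    using g h hom_over_assoc[OF g(1) assms(2,4)] by auto
next
  fix d w h h'
  assume h: "h \<in> hom_over p w d a" and h': "h' \<in> hom_over p w d a"
    and eq: "(l \<cdot>\<^bsub>Tot p\<^esub> k) \<cdot>\<^bsub>Tot p\<^esub> h = (l \<cdot>\<^bsub>Tot p\<^esub> k) \<cdot>\<^bsub>Tot p\<^esub> h'"
  have "l \<cdot>\<^bsub>Tot p\<^esub> (k \<cdot>\<^bsub>Tot p\<^esub> h) = l \<cdot>\<^bsub>Tot p\<^esub> (k \<cdot>\<^bsub>Tot p\<^esub> h')"
    using eq hom_over_assoc[OF h assms(2,4)] hom_over_assoc[OF h' assms(2,4)] by simp
  then have "k \<cdot>\<^bsub>Tot p\<^esub> h = k \<cdot>\<^bsub>Tot p\<^esub> h'"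
    using cartesian_cancel[OF assms(3,4) hom_over_comp[OF h assms(2)] hom_over_comp[OF h' assms(2)]] by simp
  then show "h = h'" by (rule cartesian_cancel[OF assms(1,2) h h'])
qed

text \<open>Each arrow is factored through the other over the identity, and cancellation makes the
  factors inverse. The two equations are kept in the conclusion because they later identify the
  comparison with a prescribed arrow.\<close>

lemma cartesian_unique:
  assumes "cartesian B p k" "k \<in> hom_over p u a c" "cartesian B p l" "l \<in> hom_over p u b c"
  obtains i j where "vertical_iso a b i j" "l \<cdot>\<^bsub>Tot p\<^esub> i = k" "k \<cdot>\<^bsub>Tot p\<^esub> j = l"
proof -
  note u = hom_over_base[OF assms(2)] and v = hom_over_base[OF assms(4)]
  let ?A = "OMap (Prj p) a"
  have A: "Id B ?A \<in> hom B (OMap (Prj p) a) (OMap (Prj p) b)"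
    "Id B ?A \<in> hom B (OMap (Prj p) b) (OMap (Prj p) a)"
    using u v by (auto simp: hom_def)
  have k: "k \<in> hom_over p (u \<cdot>\<^bsub>B\<^esub> Id B ?A) a c" and l: "l \<in> hom_over p (u \<cdot>\<^bsub>B\<^esub> Id B ?A) b c"
    using u v assms by auto
  obtain i where i: "i \<in> hom_over p (Id B ?A) a b" "l \<cdot>\<^bsub>Tot p\<^esub> i = k"
    using cartesian_unique_factor[OF assms(3,4) k A(1)] by blast
  obtain j where j: "j \<in> hom_over p (Id B ?A) b a" "k \<cdot>\<^bsub>Tot p\<^esub> j = l"
    using cartesian_unique_factor[OF assms(1,2) l A(2)] by blast
  have ob: "?A \<in> Obj B" "OMap (Prj p) b = ?A" using u v by auto
  have "j \<cdot>\<^bsub>Tot p\<^esub> i = Id (Tot p) a"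
  proof (rule cartesian_cancel[OF assms(1,2)])
    show "j \<cdot>\<^bsub>Tot p\<^esub> i \<in> hom_over p (Id B ?A) a a" using i j ob by auto
    show "Id (Tot p) a \<in> hom_over p (Id B ?A) a a" using u by (simp add: id_vertical)
    show "k \<cdot>\<^bsub>Tot p\<^esub> (j \<cdot>\<^bsub>Tot p\<^esub> i) = k \<cdot>\<^bsub>Tot p\<^esub> Id (Tot p) a"
      using hom_over_assoc[OF i(1) j(1) assms(2)] i j hom_over_id[OF assms(2)] by simp
  qed
  moreover have "i \<cdot>\<^bsub>Tot p\<^esub> j = Id (Tot p) b"
  proof (rule cartesian_cancel[OF assms(3,4)])
    show "i \<cdot>\<^bsub>Tot p\<^esub> j \<in> hom_over p (Id B ?A) b b" using i j ob by auto
    show "Id (Tot p) b \<in> hom_over p (Id B ?A) b b" using v ob id_vertical[of b] by simp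
    show "l \<cdot>\<^bsub>Tot p\<^esub> (i \<cdot>\<^bsub>Tot p\<^esub> j) = l \<cdot>\<^bsub>Tot p\<^esub> Id (Tot p) b"
      using hom_over_assoc[OF j(1) i(1) assms(4)] i j hom_over_id[OF assms(4)] by simp
  qed
  ultimately have "vertical_iso a b i j" using i j by (simp add: vertical_iso_def)
  then show ?thesis using i j that by blast
qed

lemma opcartesian_unique:
  assumes "opcartesian B p k" "k \<in> hom_over p u c a" "opcartesian B p l" "l \<in> hom_over p u c b"
  obtains i j where "vertical_iso a b i j" "i \<cdot>\<^bsub>Tot p\<^esub> k = l" "j \<cdot>\<^bsub>Tot p\<^esub> l = k"
proof -
  note u = hom_over_base[OF assms(2)] and v = hom_over_base[OF assms(4)]
  let ?A = "OMap (Prj p) a"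
  have A: "Id B ?A \<in> hom B (OMap (Prj p) a) (OMap (Prj p) b)"
    "Id B ?A \<in> hom B (OMap (Prj p) b) (OMap (Prj p) a)"
    using u v by (auto simp: hom_def)
  have k: "k \<in> hom_over p (Id B ?A \<cdot>\<^bsub>B\<^esub> u) c a" and l: "l \<in> hom_over p (Id B ?A \<cdot>\<^bsub>B\<^esub> u) c b"
    using u v assms by auto
  obtain i where i: "i \<in> hom_over p (Id B ?A) a b" "i \<cdot>\<^bsub>Tot p\<^esub> k = l"
    using opcartesian_unique_factor[OF assms(1,2) l A(1)] by blast
  obtain j where j: "j \<in> hom_over p (Id B ?A) b a" "j \<cdot>\<^bsub>Tot p\<^esub> l = k"
    using opcartesian_unique_factor[OF assms(3,4) k A(2)] by blast
  have ob: "?A \<in> Obj B" "OMap (Prj p) b = ?A" using u v by auto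
  have "j \<cdot>\<^bsub>Tot p\<^esub> i = Id (Tot p) a"
  proof (rule opcartesian_cancel[OF assms(1,2)])
    show "j \<cdot>\<^bsub>Tot p\<^esub> i \<in> hom_over p (Id B ?A) a a" using i j ob by auto
    show "Id (Tot p) a \<in> hom_over p (Id B ?A) a a" using u by (simp add: id_vertical)
    show "(j \<cdot>\<^bsub>Tot p\<^esub> i) \<cdot>\<^bsub>Tot p\<^esub> k = Id (Tot p) a \<cdot>\<^bsub>Tot p\<^esub> k"
      using hom_over_assoc[OF assms(2) i(1) j(1)] i j hom_over_id[OF assms(2)] by simp
  qed
  moreover have "i \<cdot>\<^bsub>Tot p\<^esub> j = Id (Tot p) b"
  proof (rule opcartesian_cancel[OF assms(3,4)])
    show "i \<cdot>\<^bsub>Tot p\<^esub> j \<in> hom_over p (Id B ?A) b b" using i j ob by auto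
    show "Id (Tot p) b \<in> hom_over p (Id B ?A) b b" using v ob id_vertical[of b] by simp
    show "(i \<cdot>\<^bsub>Tot p\<^esub> j) \<cdot>\<^bsub>Tot p\<^esub> l = Id (Tot p) b \<cdot>\<^bsub>Tot p\<^esub> l"
      using hom_over_assoc[OF assms(4) j(1) i(1)] i j hom_over_id[OF assms(4)] by simp
  qed
  ultimately have "vertical_iso a b i j" using i j by (simp add: vertical_iso_def)
  then show ?thesis using i j that by blast
qed

end

text \<open>The lifted arrows need not be vertical, so that the notion mentions neither the cleavage nor
  the chosen coproducts and is invariant under equivalences over the base.\<close>

definition op_projective ::
  "('b, 'c) cat \<Rightarrow> 'c set \<Rightarrow> ('b, 'c, 'e, 'f, 'z) over_scheme \<Rightarrow> 'e \<Rightarrow> bool" where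
  "op_projective B F p a \<longleftrightarrow> a \<in> Obj (Tot p) \<and>
     (\<forall>k h. opcartesian B p k \<and> AMap (Prj p) k \<in> F \<and> h \<in> hom (Tot p) a (Cod (Tot p) k) \<longrightarrow>
        (\<exists>!m. m \<in> hom (Tot p) a (Dom (Tot p) k) \<and> k \<cdot>\<^bsub>Tot p\<^esub> m = h))"

section \<open>Lifting along opcartesian arrows over display maps\<close>

context over_category
begin

lemma op_projective_iso:
  assumes i: "vertical_iso a b i j" and "op_projective B F p b"
  shows "op_projective B F p a"
  unfolding op_projective_def
proof (intro conjI allI impI)
  note v = vertical_isoD[OF i]
  show "a \<in> Obj (Tot p)" by (rule v)
  fix k h
  assume *: "opcartesian B p k \<and> AMap (Prj p) k \<in> F \<and> h \<in> hom (Tot p) a (Cod (Tot p) k)"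
  have k: "k \<in> Arr (Tot p)" using * by (simp add: opcartesian_def)
  have [simp]: "i \<in> Arr (Tot p)" "Dom (Tot p) i = a" "Cod (Tot p) i = b"
    "j \<in> Arr (Tot p)" "Dom (Tot p) j = b" "Cod (Tot p) j = a"
    "j \<cdot>\<^bsub>Tot p\<^esub> i = Id (Tot p) a" "i \<cdot>\<^bsub>Tot p\<^esub> j = Id (Tot p) b"
    using v by (simp_all add: hom_over_iff)
  have "h \<cdot>\<^bsub>Tot p\<^esub> j \<in> hom (Tot p) b (Cod (Tot p) k)" using * by (simp add: hom_def)
  then have ex: "\<exists>!m. m \<in> hom (Tot p) b (Dom (Tot p) k) \<and> k \<cdot>\<^bsub>Tot p\<^esub> m = h \<cdot>\<^bsub>Tot p\<^esub> j"
    using assms(2) * unfolding op_projective_def by blast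
  then obtain m where m: "m \<in> hom (Tot p) b (Dom (Tot p) k)" "k \<cdot>\<^bsub>Tot p\<^esub> m = h \<cdot>\<^bsub>Tot p\<^esub> j"
    by blast
  have "k \<cdot>\<^bsub>Tot p\<^esub> (m \<cdot>\<^bsub>Tot p\<^esub> i) = (k \<cdot>\<^bsub>Tot p\<^esub> m) \<cdot>\<^bsub>Tot p\<^esub> i"
    using m(1) k by (simp add: hom_def)
  also have "\<dots> = h" using m * by (simp add: hom_def)
  finally have 1: "k \<cdot>\<^bsub>Tot p\<^esub> (m \<cdot>\<^bsub>Tot p\<^esub> i) = h" .
  show "\<exists>!m. m \<in> hom (Tot p) a (Dom (Tot p) k) \<and> k \<cdot>\<^bsub>Tot p\<^esub> m = h"
  proof (intro ex1I[of _ "m \<cdot>\<^bsub>Tot p\<^esub> i"] conjI)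
    show "m \<cdot>\<^bsub>Tot p\<^esub> i \<in> hom (Tot p) a (Dom (Tot p) k)" using m by (simp add: hom_def)
    show "k \<cdot>\<^bsub>Tot p\<^esub> (m \<cdot>\<^bsub>Tot p\<^esub> i) = h" by (rule 1)
    fix n assume n: "n \<in> hom (Tot p) a (Dom (Tot p) k) \<and> k \<cdot>\<^bsub>Tot p\<^esub> n = h"
    then have "n \<cdot>\<^bsub>Tot p\<^esub> j \<in> hom (Tot p) b (Dom (Tot p) k)" "k \<cdot>\<^bsub>Tot p\<^esub> (n \<cdot>\<^bsub>Tot p\<^esub> j) = h \<cdot>\<^bsub>Tot p\<^esub> j"
      using k source.comp_assoc[of j n k] by (auto simp: hom_def simp del: source.comp_assoc)
    then have "n \<cdot>\<^bsub>Tot p\<^esub> j = m" using ex m by blast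
    then have "(n \<cdot>\<^bsub>Tot p\<^esub> j) \<cdot>\<^bsub>Tot p\<^esub> i = m \<cdot>\<^bsub>Tot p\<^esub> i" by simp
    then show "n = m \<cdot>\<^bsub>Tot p\<^esub> i" using n by (simp add: hom_def)
  qed
qed

text \<open>One opcartesian arrow for each display map \<open>v\<close> and object \<open>b\<close>
  over its domain is enough to test on: any other with the same source and base differs from it by a
  vertical isomorphism of codomains, along which lifting problems are transported. In a fibration
  with coproducts the test arrows are the injections \<open>inj\<close>, in the completion those of
  \<open>sigma_opcartesian\<close>.\<close>

lemma op_projectiveI:
  assumes a: "a \<in> Obj (Tot p)"
    and lifts: "\<And>v b. v \<in> F \<Longrightarrow> b \<in> Obj (Tot p) \<Longrightarrow> OMap (Prj p) b = Dom B v \<Longrightarrow>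
      \<exists>l y. opcartesian B p l \<and> l \<in> hom_over p v b y \<and>
        (\<forall>h\<in>hom (Tot p) a y. \<exists>!m. m \<in> hom (Tot p) a b \<and> l \<cdot>\<^bsub>Tot p\<^esub> m = h)"
  shows "op_projective B F p a"
  unfolding op_projective_def
proof (intro conjI allI impI a)
  fix k h
  define v b y where "v = AMap (Prj p) k" and "b = Dom (Tot p) k" and "y = Cod (Tot p) k"
  assume "opcartesian B p k \<and> AMap (Prj p) k \<in> F \<and> h \<in> hom (Tot p) a (Cod (Tot p) k)"
  then have op: "opcartesian B p k" and v: "v \<in> F" and h: "h \<in> hom (Tot p) a y"
    by (simp_all add: v_def y_def)
  have k: "k \<in> hom_over p v b y"
    using op by (simp add: hom_over_iff v_def b_def y_def opcartesian_def)
  have b: "b \<in> Obj (Tot p)" "OMap (Prj p) b = Dom B v" using hom_over_base[OF k] by auto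
  obtain l z where l: "opcartesian B p l" "l \<in> hom_over p v b z"
    and ex: "\<And>h. h \<in> hom (Tot p) a z \<Longrightarrow> \<exists>!m. m \<in> hom (Tot p) a b \<and> l \<cdot>\<^bsub>Tot p\<^esub> m = h"
    using lifts[OF v b] by blast
  obtain i j where ij: "vertical_iso z y i j" "i \<cdot>\<^bsub>Tot p\<^esub> l = k" "j \<cdot>\<^bsub>Tot p\<^esub> k = l"
    using opcartesian_unique[OF l op k] by blast
  note V = vertical_isoD[OF ij(1)]
  have hh: "h \<in> hom_over p (AMap (Prj p) h) a y" using h by (simp add: hom_over_def)
  have "j \<cdot>\<^bsub>Tot p\<^esub> h \<in> hom (Tot p) a z" using hom_over_comp[OF hh V(2)] by (simp add: hom_over_def)
  note ex' = ex[OF this]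
  have "l \<cdot>\<^bsub>Tot p\<^esub> m = j \<cdot>\<^bsub>Tot p\<^esub> h \<longleftrightarrow> k \<cdot>\<^bsub>Tot p\<^esub> m = h" if "m \<in> hom (Tot p) a b" for m
  proof -
    have m: "m \<in> hom_over p (AMap (Prj p) m) a b" using that by (simp add: hom_over_def)
    have 1: "i \<cdot>\<^bsub>Tot p\<^esub> (l \<cdot>\<^bsub>Tot p\<^esub> m) = k \<cdot>\<^bsub>Tot p\<^esub> m"
      using hom_over_assoc[OF m l(2) V(1)] ij by simp
    have 2: "j \<cdot>\<^bsub>Tot p\<^esub> (k \<cdot>\<^bsub>Tot p\<^esub> m) = l \<cdot>\<^bsub>Tot p\<^esub> m" using hom_over_assoc[OF m k V(2)] ij by simp
    show ?thesis
      using 1 2 vertical_iso_cancel(2)[OF vertical_iso_sym[OF ij(1)] hh] by metis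
  qed
  then show "\<exists>!m. m \<in> hom (Tot p) a (Dom (Tot p) k) \<and> k \<cdot>\<^bsub>Tot p\<^esub> m = h"
    using ex' unfolding b_def[symmetric] by metis
qed

text \<open>Serves to move the source of an opcartesian arrow into the image of an equivalence,
  which reaches an object only up to vertical isomorphism.\<close>

lemma opcartesian_precomp_iso:
  assumes k: "opcartesian B p k" "k \<in> hom_over p u a b" and ij: "vertical_iso c a i j"
  shows "opcartesian B p (k \<cdot>\<^bsub>Tot p\<^esub> i)"
proof (rule opcartesianI)
  note v = vertical_isoD[OF ij]
  show ki: "k \<cdot>\<^bsub>Tot p\<^esub> i \<in> hom_over p u c b" by (rule vertical_comp[OF v(1) k(2) v(8)])
  fix f x w
  assume f: "f \<in> hom_over p (w \<cdot>\<^bsub>B\<^esub> u) c x" and w: "w \<in> hom B (OMap (Prj p) b) (OMap (Prj p) x)"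
  have "f \<cdot>\<^bsub>Tot p\<^esub> j \<in> hom_over p (w \<cdot>\<^bsub>B\<^esub> u) a x" by (rule vertical_comp[OF v(2) f v(8)])
  then obtain h where h: "h \<in> hom_over p w b x" "h \<cdot>\<^bsub>Tot p\<^esub> k = f \<cdot>\<^bsub>Tot p\<^esub> j"
    using opcartesian_unique_factor[OF k _ w] by blast
  have "h \<cdot>\<^bsub>Tot p\<^esub> (k \<cdot>\<^bsub>Tot p\<^esub> i) = f"
    using hom_over_assoc[OF v(1) k(2) h(1)] h(2) vertical_iso_cancel(1)[OF vertical_iso_sym[OF ij] f]
    by simp
  with h show "\<exists>h\<in>hom_over p w b x. h \<cdot>\<^bsub>Tot p\<^esub> (k \<cdot>\<^bsub>Tot p\<^esub> i) = f" by blast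
next
  note v = vertical_isoD[OF ij]
  fix x w h h'
  assume h: "h \<in> hom_over p w b x" "h' \<in> hom_over p w b x"
    and eq: "h \<cdot>\<^bsub>Tot p\<^esub> (k \<cdot>\<^bsub>Tot p\<^esub> i) = h' \<cdot>\<^bsub>Tot p\<^esub> (k \<cdot>\<^bsub>Tot p\<^esub> i)"
  have "(h \<cdot>\<^bsub>Tot p\<^esub> k) \<cdot>\<^bsub>Tot p\<^esub> i = (h' \<cdot>\<^bsub>Tot p\<^esub> k) \<cdot>\<^bsub>Tot p\<^esub> i"
    using hom_over_assoc[OF v(1) k(2) h(1)] hom_over_assoc[OF v(1) k(2) h(2)] eq by simp
  then have "h \<cdot>\<^bsub>Tot p\<^esub> k = h' \<cdot>\<^bsub>Tot p\<^esub> k"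
    using vertical_iso_cancel(1)[OF ij] hom_over_comp[OF k(2)] h by metis
  then show "h = h'" by (rule opcartesian_cancel[OF k h])
qed

end

section \<open>Equivalences over a base\<close>

text \<open>Working form of an equivalence: fully faithful over each base arrow \<open>w\<close>
  separately, and essentially surjective up to vertical isomorphism. That cartesian and opcartesian
  arrows are preserved and reflected is derived from this.\<close>

locale over_equivalence =
  P: over_category B p + Q: over_category B q + H: cat_functor "Tot p" "Tot q" H
  for B :: "('b, 'c) cat" and p :: "('b, 'c, 'e1, 'f1, 'y) over_scheme"
    and q :: "('b, 'c, 'e2, 'f2, 'z) over_scheme" and H +
  assumes over_obj [simp]: "a \<in> Obj (Tot p) \<Longrightarrow> OMap (Prj q) (OMap H a) = OMap (Prj p) a"
    and over_arr [simp]: "f \<in> Arr (Tot p) \<Longrightarrow> AMap (Prj q) (AMap H f) = AMap (Prj p) f"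
    and full_faithful: "\<lbrakk>a \<in> Obj (Tot p); b \<in> Obj (Tot p); h \<in> hom_over q w (OMap H a) (OMap H b)\<rbrakk>
      \<Longrightarrow> \<exists>!f. f \<in> hom_over p w a b \<and> AMap H f = h"
    and ess_surj: "x \<in> Obj (Tot q) \<Longrightarrow> \<exists>a\<in>Obj (Tot p). \<exists>i j. Q.vertical_iso (OMap H a) x i j"
begin

section \<open>Preservation and reflection of universal arrows\<close>

lemma map_hom_over: "f \<in> hom_over p w a b \<Longrightarrow> AMap H f \<in> hom_over q w (OMap H a) (OMap H b)"
  by (simp add: hom_over_iff)

lemma map_comp_over:
  "f \<in> hom_over p v a b \<Longrightarrow> g \<in> hom_over p w b c
    \<Longrightarrow> AMap H (g \<cdot>\<^bsub>Tot p\<^esub> f) = AMap H g \<cdot>\<^bsub>Tot q\<^esub> AMap H f"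
  by (simp add: hom_over_iff)

lemma faithful:
  assumes "f \<in> hom_over p w a b" "g \<in> hom_over p w a b" "AMap H f = AMap H g"
  shows "f = g"
  using full_faithful[OF _ _ map_hom_over[OF assms(1)]] assms P.hom_over_base[OF assms(1)] by metis

lemma full:
  assumes "a \<in> Obj (Tot p)" "b \<in> Obj (Tot p)" "h \<in> hom_over q w (OMap H a) (OMap H b)"
  obtains f where "f \<in> hom_over p w a b" "AMap H f = h"
  using full_faithful[OF assms] that by blast

text \<open>A factorisation problem in \<open>p\<close> is solved between the images in
  \<open>q\<close>; fullness over the same \<open>w\<close> brings back the solution, and
  faithfulness brings back its equation.\<close>

lemma reflects_cartesian:
  assumes k: "k \<in> hom_over p u a b" and "cartesian B q (AMap H k)"
  shows "cartesian B p k"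
proof (rule P.cartesianI[OF k])
  note Hk = map_hom_over[OF k] and u = P.hom_over_base[OF k]
  fix f c w
  assume f: "f \<in> hom_over p (u \<cdot>\<^bsub>B\<^esub> w) c b" and w: "w \<in> hom B (OMap (Prj p) c) (OMap (Prj p) a)"
  have c: "c \<in> Obj (Tot p)" using P.hom_over_base[OF f] by simp
  obtain h where h: "h \<in> hom_over q w (OMap H c) (OMap H a)" "AMap H k \<cdot>\<^bsub>Tot q\<^esub> h = AMap H f"
    using Q.cartesian_unique_factor[OF assms(2) Hk map_hom_over[OF f]] w u c by auto
  obtain g where g: "g \<in> hom_over p w c a" "AMap H g = h" using full[OF c u(4) h(1)] .
  have "k \<cdot>\<^bsub>Tot p\<^esub> g = f"
    by (rule faithful[OF P.hom_over_comp[OF g(1) k] f]) (simp add: map_comp_over[OF g(1) k] g h)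
  then show "\<exists>h \<in> hom_over p w c a. k \<cdot>\<^bsub>Tot p\<^esub> h = f" using g by blast
next
  fix c w h h'
  assume h: "h \<in> hom_over p w c a" "h' \<in> hom_over p w c a" "k \<cdot>\<^bsub>Tot p\<^esub> h = k \<cdot>\<^bsub>Tot p\<^esub> h'"
  have "AMap H k \<cdot>\<^bsub>Tot q\<^esub> AMap H h = AMap H k \<cdot>\<^bsub>Tot q\<^esub> AMap H h'"
    using h map_comp_over[OF h(1) k] map_comp_over[OF h(2) k] by simp
  then have "AMap H h = AMap H h'"
    by (rule Q.cartesian_cancel[OF assms(2) map_hom_over[OF k] map_hom_over[OF h(1)] map_hom_over[OF h(2)]])
  then show "h = h'" by (rule faithful[OF h(1,2)])
qed

lemma reflects_opcartesian:
  assumes k: "k \<in> hom_over p u a b" and "opcartesian B q (AMap H k)"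
  shows "opcartesian B p k"
proof (rule P.opcartesianI[OF k])
  note Hk = map_hom_over[OF k] and u = P.hom_over_base[OF k]
  fix f c w
  assume f: "f \<in> hom_over p (w \<cdot>\<^bsub>B\<^esub> u) a c" and w: "w \<in> hom B (OMap (Prj p) b) (OMap (Prj p) c)"
  have c: "c \<in> Obj (Tot p)" using P.hom_over_base[OF f] by simp
  obtain h where h: "h \<in> hom_over q w (OMap H b) (OMap H c)" "h \<cdot>\<^bsub>Tot q\<^esub> AMap H k = AMap H f"
    using Q.opcartesian_unique_factor[OF assms(2) Hk map_hom_over[OF f]] w u c by auto
  obtain g where g: "g \<in> hom_over p w b c" "AMap H g = h" using full[OF u(5) c h(1)] .
  have "g \<cdot>\<^bsub>Tot p\<^esub> k = f"
    by (rule faithful[OF P.hom_over_comp[OF k g(1)] f]) (simp add: map_comp_over[OF k g(1)] g h)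
  then show "\<exists>h \<in> hom_over p w b c. h \<cdot>\<^bsub>Tot p\<^esub> k = f" using g by blast
next
  fix c w h h'
  assume h: "h \<in> hom_over p w b c" "h' \<in> hom_over p w b c" "h \<cdot>\<^bsub>Tot p\<^esub> k = h' \<cdot>\<^bsub>Tot p\<^esub> k"
  have "AMap H h \<cdot>\<^bsub>Tot q\<^esub> AMap H k = AMap H h' \<cdot>\<^bsub>Tot q\<^esub> AMap H k"
    using h map_comp_over[OF k h(1)] map_comp_over[OF k h(2)] by simp
  then have "AMap H h = AMap H h'"
    by (rule Q.opcartesian_cancel[OF assms(2) map_hom_over[OF k] map_hom_over[OF h(1)] map_hom_over[OF h(2)]])
  then show "h = h'" by (rule faithful[OF h(1,2)])
qed

text \<open>The test object \<open>x\<close> of a factorisation problem in \<open>q\<close> need not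
  be an image. It is replaced by some \<open>OMap H c\<close> along a vertical isomorphism, the
  problem is solved in \<open>p\<close>, and the solution is carried back along
  \<open>j\<close>.\<close>

lemma preserves_cartesian:
  assumes k: "k \<in> hom_over p u a b" and "cartesian B p k"
  shows "cartesian B q (AMap H k)"
proof (rule Q.cartesianI[OF map_hom_over[OF k]])
  note Hk = map_hom_over[OF k] and u = P.hom_over_base[OF k]
  fix f x w
  assume f: "f \<in> hom_over q (u \<cdot>\<^bsub>B\<^esub> w) x (OMap H b)"
    and w: "w \<in> hom B (OMap (Prj q) x) (OMap (Prj q) (OMap H a))"
  have "x \<in> Obj (Tot q)" using Q.hom_over_base[OF f] by simp
  then obtain c i j where c: "c \<in> Obj (Tot p)" and ij: "Q.vertical_iso (OMap H c) x i j"
    using ess_surj by blast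
  note v = Q.vertical_isoD[OF ij]
  have "f \<cdot>\<^bsub>Tot q\<^esub> i \<in> hom_over q (u \<cdot>\<^bsub>B\<^esub> w) (OMap H c) (OMap H b)"
    by (rule Q.vertical_comp[OF v(1) f v(8)])
  then obtain f' where f': "f' \<in> hom_over p (u \<cdot>\<^bsub>B\<^esub> w) c b" "AMap H f' = f \<cdot>\<^bsub>Tot q\<^esub> i"
    using full[OF c u(5)] by blast
  have "w \<in> hom B (OMap (Prj p) c) (OMap (Prj p) a)" using w v(5) c u by simp
  then obtain h where h: "h \<in> hom_over p w c a" "k \<cdot>\<^bsub>Tot p\<^esub> h = f'"
    using P.cartesian_unique_factor[OF assms(2) k f'(1)] by blast
  note Hh = map_hom_over[OF h(1)]
  have hj: "AMap H h \<cdot>\<^bsub>Tot q\<^esub> j \<in> hom_over q w x (OMap H a)"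
    by (rule Q.vertical_comp[OF v(2) Hh v(8)])
  have "AMap H k \<cdot>\<^bsub>Tot q\<^esub> (AMap H h \<cdot>\<^bsub>Tot q\<^esub> j) = (f \<cdot>\<^bsub>Tot q\<^esub> i) \<cdot>\<^bsub>Tot q\<^esub> j"
    using Q.hom_over_assoc[OF v(2) Hh Hk] map_comp_over[OF h(1) k] h f' by simp
  also have "\<dots> = f" by (rule Q.vertical_iso_cancel(1)[OF ij f])
  finally show "\<exists>h \<in> hom_over q w x (OMap H a). AMap H k \<cdot>\<^bsub>Tot q\<^esub> h = f" using hj by blast
next
  note Hk = map_hom_over[OF k] and u = P.hom_over_base[OF k]
  fix x w h h'
  assume h: "h \<in> hom_over q w x (OMap H a)" "h' \<in> hom_over q w x (OMap H a)"
    and eq: "AMap H k \<cdot>\<^bsub>Tot q\<^esub> h = AMap H k \<cdot>\<^bsub>Tot q\<^esub> h'"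
  have "x \<in> Obj (Tot q)" using Q.hom_over_base[OF h(1)] by simp
  then obtain c i j where c: "c \<in> Obj (Tot p)" and ij: "Q.vertical_iso (OMap H c) x i j"
    using ess_surj by blast
  note v = Q.vertical_isoD[OF ij]
  obtain g where g: "g \<in> hom_over p w c a" "AMap H g = h \<cdot>\<^bsub>Tot q\<^esub> i"
    using full[OF c u(4) Q.vertical_comp[OF v(1) h(1) v(8)]] .
  obtain g' where g': "g' \<in> hom_over p w c a" "AMap H g' = h' \<cdot>\<^bsub>Tot q\<^esub> i"
    using full[OF c u(4) Q.vertical_comp[OF v(1) h(2) v(8)]] .
  have "k \<cdot>\<^bsub>Tot p\<^esub> g = k \<cdot>\<^bsub>Tot p\<^esub> g'"
  proof (rule faithful[OF P.hom_over_comp[OF g(1) k] P.hom_over_comp[OF g'(1) k]])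
    show "AMap H (k \<cdot>\<^bsub>Tot p\<^esub> g) = AMap H (k \<cdot>\<^bsub>Tot p\<^esub> g')"
      using map_comp_over[OF g(1) k] map_comp_over[OF g'(1) k] g g' eq
        Q.hom_over_assoc[OF v(1) h(1) Hk] Q.hom_over_assoc[OF v(1) h(2) Hk] by simp
  qed
  then have "g = g'" by (rule P.cartesian_cancel[OF assms(2) k g(1) g'(1)])
  then have "h \<cdot>\<^bsub>Tot q\<^esub> i = h' \<cdot>\<^bsub>Tot q\<^esub> i" using g g' by simp
  then show "h = h'" using Q.vertical_iso_cancel(1)[OF ij] h by metis
qed

text \<open>As for cartesian arrows, except that the test object to be replaced is now the target,
  so the isomorphism is composed on the left.\<close>

lemma preserves_opcartesian:
  assumes k: "k \<in> hom_over p u a b" and "opcartesian B p k"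
  shows "opcartesian B q (AMap H k)"
proof (rule Q.opcartesianI[OF map_hom_over[OF k]])
  note Hk = map_hom_over[OF k] and u = P.hom_over_base[OF k]
  fix f x w
  assume f: "f \<in> hom_over q (w \<cdot>\<^bsub>B\<^esub> u) (OMap H a) x"
    and w: "w \<in> hom B (OMap (Prj q) (OMap H b)) (OMap (Prj q) x)"
  have "x \<in> Obj (Tot q)" using Q.hom_over_base[OF f] by simp
  then obtain c i j where c: "c \<in> Obj (Tot p)" and ij: "Q.vertical_iso (OMap H c) x i j"
    using ess_surj by blast
  note v = Q.vertical_isoD[OF ij]
  have "j \<cdot>\<^bsub>Tot q\<^esub> f \<in> hom_over q (w \<cdot>\<^bsub>B\<^esub> u) (OMap H a) (OMap H c)"
    by (rule Q.comp_vertical[OF f v(2) v(8)])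
  then obtain f' where f': "f' \<in> hom_over p (w \<cdot>\<^bsub>B\<^esub> u) a c" "AMap H f' = j \<cdot>\<^bsub>Tot q\<^esub> f"
    using full[OF u(4) c] by blast
  have "w \<in> hom B (OMap (Prj p) b) (OMap (Prj p) c)" using w v(5) c u by simp
  then obtain h where h: "h \<in> hom_over p w b c" "h \<cdot>\<^bsub>Tot p\<^esub> k = f'"
    using P.opcartesian_unique_factor[OF assms(2) k f'(1)] by blast
  note Hh = map_hom_over[OF h(1)]
  have ih: "i \<cdot>\<^bsub>Tot q\<^esub> AMap H h \<in> hom_over q w (OMap H b) x"
    by (rule Q.comp_vertical[OF Hh v(1) v(8)])
  have "(i \<cdot>\<^bsub>Tot q\<^esub> AMap H h) \<cdot>\<^bsub>Tot q\<^esub> AMap H k = i \<cdot>\<^bsub>Tot q\<^esub> (j \<cdot>\<^bsub>Tot q\<^esub> f)"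
    using Q.hom_over_assoc[OF Hk Hh v(1)] map_comp_over[OF k h(1)] h f' by simp
  also have "\<dots> = f" by (rule Q.vertical_iso_cancel(2)[OF Q.vertical_iso_sym[OF ij] f])
  finally show "\<exists>h \<in> hom_over q w (OMap H b) x. h \<cdot>\<^bsub>Tot q\<^esub> AMap H k = f" using ih by blast
next
  note Hk = map_hom_over[OF k] and u = P.hom_over_base[OF k]
  fix x w h h'
  assume h: "h \<in> hom_over q w (OMap H b) x" "h' \<in> hom_over q w (OMap H b) x"
    and eq: "h \<cdot>\<^bsub>Tot q\<^esub> AMap H k = h' \<cdot>\<^bsub>Tot q\<^esub> AMap H k"
  have "x \<in> Obj (Tot q)" using Q.hom_over_base[OF h(1)] by simp
  then obtain c i j where c: "c \<in> Obj (Tot p)" and ij: "Q.vertical_iso (OMap H c) x i j"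
    using ess_surj by blast
  note v = Q.vertical_isoD[OF ij]
  obtain g where g: "g \<in> hom_over p w b c" "AMap H g = j \<cdot>\<^bsub>Tot q\<^esub> h"
    using full[OF u(5) c Q.comp_vertical[OF h(1) v(2) v(8)]] .
  obtain g' where g': "g' \<in> hom_over p w b c" "AMap H g' = j \<cdot>\<^bsub>Tot q\<^esub> h'"
    using full[OF u(5) c Q.comp_vertical[OF h(2) v(2) v(8)]] .
  have "g \<cdot>\<^bsub>Tot p\<^esub> k = g' \<cdot>\<^bsub>Tot p\<^esub> k"
  proof (rule faithful[OF P.hom_over_comp[OF k g(1)] P.hom_over_comp[OF k g'(1)]])
    show "AMap H (g \<cdot>\<^bsub>Tot p\<^esub> k) = AMap H (g' \<cdot>\<^bsub>Tot p\<^esub> k)"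
      using map_comp_over[OF k g(1)] map_comp_over[OF k g'(1)] g g' eq
        Q.hom_over_assoc[OF Hk h(1) v(2)] Q.hom_over_assoc[OF Hk h(2) v(2)] by simp
  qed
  then have "g = g'" by (rule P.opcartesian_cancel[OF assms(2) k g(1) g'(1)])
  then have "j \<cdot>\<^bsub>Tot q\<^esub> h = j \<cdot>\<^bsub>Tot q\<^esub> h'" using g g' by simp
  then show "h = h'" using Q.vertical_iso_cancel(2)[OF Q.vertical_iso_sym[OF ij]] h by metis
qed

text \<open>A lifting problem in \<open>p\<close> becomes one in \<open>q\<close> against an arrow
  that is again opcartesian over a display map; its unique solution returns by full
  faithfulness.\<close>

lemma reflects_op_projective:
  assumes a: "a \<in> Obj (Tot p)" and "op_projective B F q (OMap H a)"
  shows "op_projective B F p a"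
  unfolding op_projective_def
proof (intro conjI allI impI)
  show "a \<in> Obj (Tot p)" by (rule a)
  fix k h
  let ?x = "Dom (Tot p) k" and ?y = "Cod (Tot p) k"
  assume *: "opcartesian B p k \<and> AMap (Prj p) k \<in> F \<and> h \<in> hom (Tot p) a ?y"
  have k: "k \<in> Arr (Tot p)" "k \<in> hom_over p (AMap (Prj p) k) ?x ?y"
    using * by (simp_all add: opcartesian_def hom_over_iff)
  have x: "?x \<in> Obj (Tot p)" using k by simp
  have "opcartesian B q (AMap H k)" using preserves_opcartesian[OF k(2)] * by simp
  moreover have "AMap (Prj q) (AMap H k) \<in> F" using * k by simp
  moreover have "AMap H h \<in> hom (Tot q) (OMap H a) (Cod (Tot q) (AMap H k))"
    using * k by (simp add: hom_def)
  ultimately have ex: "\<exists>!m. m \<in> hom (Tot q) (OMap H a) (Dom (Tot q) (AMap H k)) \<and>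
      AMap H k \<cdot>\<^bsub>Tot q\<^esub> m = AMap H h"
    using assms(2) unfolding op_projective_def by blast
  then obtain m where m: "m \<in> hom (Tot q) (OMap H a) (OMap H ?x)" "AMap H k \<cdot>\<^bsub>Tot q\<^esub> m = AMap H h"
    using k by auto
  define w where "w = AMap (Prj q) m"
  have "m \<in> hom_over q w (OMap H a) (OMap H ?x)" using m(1) by (simp add: hom_over_def w_def)
  then obtain n where n: "n \<in> hom_over p w a ?x" "AMap H n = m" using full[OF a x] by blast
  have h: "h \<in> hom_over p (AMap (Prj p) h) a ?y" using * by (simp add: hom_over_def)
  \<comment> \<open>The lift \<open>m\<close> brings its own base arrow \<open>w\<close>. Projecting
    its equation shows that \<open>h\<close> lies over the base of \<open>k\<close> after
    \<open>w\<close>, which puts both sides of \<open>kn\<close> in one hom-set, as faithfulness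
    requires.\<close>
  have "AMap (Prj p) h = AMap (Prj q) (AMap H h)" using hom_overD(1)[OF h] by simp
  also have "\<dots> = AMap (Prj p) k \<cdot>\<^bsub>B\<^esub> w"
    unfolding m(2)[symmetric] using m(1) k by (simp add: hom_def w_def)
  finally have hw: "h \<in> hom_over p (AMap (Prj p) k \<cdot>\<^bsub>B\<^esub> w) a ?y" using h by simp
  have kn: "k \<cdot>\<^bsub>Tot p\<^esub> n = h"
    by (rule faithful[OF P.hom_over_comp[OF n(1) k(2)] hw])
       (simp add: map_comp_over[OF n(1) k(2)] n m)
  show "\<exists>!m. m \<in> hom (Tot p) a ?x \<and> k \<cdot>\<^bsub>Tot p\<^esub> m = h"
  proof (intro ex1I[of _ n] conjI)
    show "n \<in> hom (Tot p) a ?x" "k \<cdot>\<^bsub>Tot p\<^esub> n = h" using n kn by (simp_all add: hom_over_def)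
    fix n' assume n': "n' \<in> hom (Tot p) a ?x \<and> k \<cdot>\<^bsub>Tot p\<^esub> n' = h"
    have "n' \<in> hom_over p (AMap (Prj p) n') a ?x" using n' by (simp add: hom_over_def)
    note n'' = map_hom_over[OF this] map_comp_over[OF this k(2)]
    have "AMap H n' \<in> hom (Tot q) (OMap H a) (Dom (Tot q) (AMap H k))"
      using n''(1) k by (simp add: hom_over_def)
    moreover have "AMap H k \<cdot>\<^bsub>Tot q\<^esub> AMap H n' = AMap H h" using n'' n' by simp
    moreover have "m \<in> hom (Tot q) (OMap H a) (Dom (Tot q) (AMap H k))" using m k by simp
    ultimately have eq: "AMap H n' = m" using ex m(2) by blast
    \<comment> \<open>Faithfulness compares arrows over the same base arrow only, so the base of the
      competitor has to be matched first.\<close>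
    have "AMap (Prj p) n' = w"
      using eq n' over_arr[of n'] by (simp add: hom_def w_def)
    then have "n' \<in> hom_over p w a ?x" using n' by (simp add: hom_over_def)
    then show "n' = n" using faithful[OF _ n(1)] eq n(2) by simp
  qed
qed

section \<open>A quasi-inverse obtained by choice\<close>

definition preimage :: "'c \<Rightarrow> 'e1 \<Rightarrow> 'e1 \<Rightarrow> 'f2 \<Rightarrow> 'f1" where
  "preimage w a b h = (THE f. f \<in> hom_over p w a b \<and> AMap H f = h)"

lemma preimage:
  assumes "a \<in> Obj (Tot p)" "b \<in> Obj (Tot p)" "h \<in> hom_over q w (OMap H a) (OMap H b)"
  shows "preimage w a b h \<in> hom_over p w a b" "AMap H (preimage w a b h) = h"
  using theI'[OF full_faithful[OF assms]] by (simp_all add: preimage_def)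

definition inv_obj :: "'e2 \<Rightarrow> 'e1" where
  "inv_obj x = (SOME a. a \<in> Obj (Tot p) \<and> (\<exists>i j. Q.vertical_iso (OMap H a) x i j))"

definition inv_to :: "'e2 \<Rightarrow> 'f2" where
  "inv_to x = (SOME i. \<exists>j. Q.vertical_iso (OMap H (inv_obj x)) x i j)"

definition inv_from :: "'e2 \<Rightarrow> 'f2" where
  "inv_from x = (SOME j. Q.vertical_iso (OMap H (inv_obj x)) x (inv_to x) j)"

lemma inv_obj:
  assumes "x \<in> Obj (Tot q)"
  shows "inv_obj x \<in> Obj (Tot p)" "Q.vertical_iso (OMap H (inv_obj x)) x (inv_to x) (inv_from x)"
proof -
  have *: "inv_obj x \<in> Obj (Tot p) \<and> (\<exists>i j. Q.vertical_iso (OMap H (inv_obj x)) x i j)"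
    unfolding inv_obj_def by (rule someI_ex) (use ess_surj[OF assms] in blast)
  then show "inv_obj x \<in> Obj (Tot p)" by simp
  from * have "\<exists>i j. Q.vertical_iso (OMap H (inv_obj x)) x i j" by simp
  then have "\<exists>j. Q.vertical_iso (OMap H (inv_obj x)) x (inv_to x) j"
    unfolding inv_to_def by (rule someI_ex)
  then show "Q.vertical_iso (OMap H (inv_obj x)) x (inv_to x) (inv_from x)"
    unfolding inv_from_def by (rule someI_ex)
qed

lemma over_inv_obj:
  assumes "x \<in> Obj (Tot q)"
  shows "OMap (Prj p) (inv_obj x) = OMap (Prj q) x"
  using inv_obj[OF assms] Q.vertical_isoD(5) over_obj by metis

lemma inv_to:
  assumes "x \<in> Obj (Tot q)"
  shows "inv_to x \<in> hom_over q (Id B (OMap (Prj q) x)) (OMap H (inv_obj x)) x"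
    "inv_from x \<in> hom_over q (Id B (OMap (Prj q) x)) x (OMap H (inv_obj x))"
    "inv_from x \<cdot>\<^bsub>Tot q\<^esub> inv_to x = Id (Tot q) (OMap H (inv_obj x))"
    "inv_to x \<cdot>\<^bsub>Tot q\<^esub> inv_from x = Id (Tot q) x"
  using Q.vertical_isoD[OF inv_obj(2)[OF assms]] by simp_all

text \<open>On arrows, conjugation by the chosen isomorphisms, brought back to \<open>p\<close> by
  full faithfulness; \<open>H\<close> of the result is the conjugate itself.\<close>

definition inv_fctr :: "('e2, 'f2, 'e1, 'f1) fctr" where
  "inv_fctr = \<lparr>OMap = inv_obj,
     AMap = (\<lambda>f. preimage (AMap (Prj q) f) (inv_obj (Dom (Tot q) f)) (inv_obj (Cod (Tot q) f))
       (inv_from (Cod (Tot q) f) \<cdot>\<^bsub>Tot q\<^esub> (f \<cdot>\<^bsub>Tot q\<^esub> inv_to (Dom (Tot q) f))))\<rparr>"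

lemma inv_fctr_arr:
  assumes f: "f \<in> hom_over q w x y"
  shows "AMap inv_fctr f \<in> hom_over p w (inv_obj x) (inv_obj y)"
    "AMap H (AMap inv_fctr f) = inv_from y \<cdot>\<^bsub>Tot q\<^esub> (f \<cdot>\<^bsub>Tot q\<^esub> inv_to x)"
proof -
  note b = Q.hom_over_base[OF f]
  have "inv_from y \<cdot>\<^bsub>Tot q\<^esub> (f \<cdot>\<^bsub>Tot q\<^esub> inv_to x) \<in> hom_over q w (OMap H (inv_obj x)) (OMap H (inv_obj y))"
    using Q.comp_vertical[OF Q.vertical_comp[OF inv_to(1)[OF b(4)] f] inv_to(2)[OF b(5)]] b by simp
  from preimage[OF inv_obj(1)[OF b(4)] inv_obj(1)[OF b(5)] this]
  show "AMap inv_fctr f \<in> hom_over p w (inv_obj x) (inv_obj y)"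
    "AMap H (AMap inv_fctr f) = inv_from y \<cdot>\<^bsub>Tot q\<^esub> (f \<cdot>\<^bsub>Tot q\<^esub> inv_to x)"
    using hom_overD[OF f] by (simp_all add: inv_fctr_def)
qed

lemma inv_to_natural:
  assumes f: "f \<in> hom_over q w x y"
  shows "inv_to y \<cdot>\<^bsub>Tot q\<^esub> AMap H (AMap inv_fctr f) = f \<cdot>\<^bsub>Tot q\<^esub> inv_to x"
    "AMap H (AMap inv_fctr f) \<cdot>\<^bsub>Tot q\<^esub> inv_from x = inv_from y \<cdot>\<^bsub>Tot q\<^esub> f"
proof -
  note b = Q.hom_over_base[OF f]
  note x = inv_to[OF b(4)] and y = inv_to[OF b(5)]
  have fx: "f \<cdot>\<^bsub>Tot q\<^esub> inv_to x \<in> hom_over q w (OMap H (inv_obj x)) y"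
    using Q.vertical_comp[OF x(1) f] b by simp
  show "inv_to y \<cdot>\<^bsub>Tot q\<^esub> AMap H (AMap inv_fctr f) = f \<cdot>\<^bsub>Tot q\<^esub> inv_to x"
    unfolding inv_fctr_arr[OF f]
    by (rule Q.vertical_iso_cancel(2)[OF Q.vertical_iso_sym[OF inv_obj(2)[OF b(5)]] fx])
  have "AMap H (AMap inv_fctr f) \<cdot>\<^bsub>Tot q\<^esub> inv_from x = inv_from y \<cdot>\<^bsub>Tot q\<^esub> ((f \<cdot>\<^bsub>Tot q\<^esub> inv_to x) \<cdot>\<^bsub>Tot q\<^esub> inv_from x)"
    unfolding inv_fctr_arr[OF f] by (rule Q.hom_over_assoc[OF x(2) fx y(2)])
  also have "(f \<cdot>\<^bsub>Tot q\<^esub> inv_to x) \<cdot>\<^bsub>Tot q\<^esub> inv_from x = f"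
    by (rule Q.vertical_iso_cancel(1)[OF inv_obj(2)[OF b(4)] f])
  finally show "AMap H (AMap inv_fctr f) \<cdot>\<^bsub>Tot q\<^esub> inv_from x = inv_from y \<cdot>\<^bsub>Tot q\<^esub> f" .
qed

text \<open>Both functor laws are checked after applying the faithful \<open>H\<close>, where the
  isomorphism at the middle object cancels against its inverse.\<close>

lemma inv_fctr_functor: "cat_functor (Tot q) (Tot p) inv_fctr"
proof
  fix x assume x: "x \<in> Obj (Tot q)"
  show "OMap inv_fctr x \<in> Obj (Tot p)" using inv_obj[OF x] by (simp add: inv_fctr_def)
  show "AMap inv_fctr (Id (Tot q) x) = Id (Tot p) (OMap inv_fctr x)"
  proof (rule faithful)
    show "AMap inv_fctr (Id (Tot q) x) \<in> hom_over p (Id B (OMap (Prj q) x)) (inv_obj x) (inv_obj x)"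
      by (rule inv_fctr_arr(1)[OF Q.id_vertical[OF x]])
    show "Id (Tot p) (OMap inv_fctr x) \<in> hom_over p (Id B (OMap (Prj q) x)) (inv_obj x) (inv_obj x)"
      using P.id_vertical[OF inv_obj(1)[OF x]] over_inv_obj[OF x] by (simp add: inv_fctr_def)
    show "AMap H (AMap inv_fctr (Id (Tot q) x)) = AMap H (Id (Tot p) (OMap inv_fctr x))"
      unfolding inv_fctr_arr(2)[OF Q.id_vertical[OF x]] using inv_obj[OF x] inv_to[OF x]
      by (simp add: inv_fctr_def Q.hom_over_id)
  qed
next
  fix f x y assume f: "f \<in> hom (Tot q) x y"
  have "f \<in> hom_over q (AMap (Prj q) f) x y" using f by (simp add: hom_over_def)
  from inv_fctr_arr(1)[OF this] show "AMap inv_fctr f \<in> hom (Tot p) (OMap inv_fctr x) (OMap inv_fctr y)"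
    by (simp add: hom_over_def inv_fctr_def)
  fix g z assume g: "g \<in> hom (Tot q) y z"
  define v w where "v = AMap (Prj q) f" and "w = AMap (Prj q) g"
  have F: "f \<in> hom_over q v x y" and G: "g \<in> hom_over q w y z"
    using f g by (simp_all add: hom_over_def v_def w_def)
  note fg = inv_fctr_arr(1)[OF F] inv_fctr_arr(1)[OF G] inv_fctr_arr(1)[OF Q.hom_over_comp[OF F G]]
  note b = Q.hom_over_base[OF F] Q.hom_over_base[OF G]
  note x = inv_to[OF b(4)] and y = inv_to[OF b(5)] and z = inv_to[OF b(10)]
  show "AMap inv_fctr (g \<cdot>\<^bsub>Tot q\<^esub> f) = AMap inv_fctr g \<cdot>\<^bsub>Tot p\<^esub> AMap inv_fctr f"
  proof (rule faithful[OF fg(3) P.hom_over_comp[OF fg(1,2)]])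
    note Hf = map_hom_over[OF fg(1)] and Hg = map_hom_over[OF fg(2)]
    have gy: "g \<cdot>\<^bsub>Tot q\<^esub> inv_to y \<in> hom_over q w (OMap H (inv_obj y)) z"
      using Q.vertical_comp[OF y(1) G] b by simp
    have "AMap H (AMap inv_fctr g) \<cdot>\<^bsub>Tot q\<^esub> AMap H (AMap inv_fctr f)
       = inv_from z \<cdot>\<^bsub>Tot q\<^esub> (g \<cdot>\<^bsub>Tot q\<^esub> (inv_to y \<cdot>\<^bsub>Tot q\<^esub> AMap H (AMap inv_fctr f)))"
      unfolding inv_fctr_arr(2)[OF G]
      using Q.hom_over_assoc[OF Hf gy z(2)] Q.hom_over_assoc[OF Hf y(1) G] by simp
    also have "g \<cdot>\<^bsub>Tot q\<^esub> (inv_to y \<cdot>\<^bsub>Tot q\<^esub> AMap H (AMap inv_fctr f)) = (g \<cdot>\<^bsub>Tot q\<^esub> f) \<cdot>\<^bsub>Tot q\<^esub> inv_to x"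
      using Q.hom_over_assoc[OF x(1) F G] inv_to_natural(1)[OF F] by simp
    finally show "AMap H (AMap inv_fctr (g \<cdot>\<^bsub>Tot q\<^esub> f)) = AMap H (AMap inv_fctr g \<cdot>\<^bsub>Tot p\<^esub> AMap inv_fctr f)"
      using map_comp_over[OF fg(1,2)] inv_fctr_arr(2)[OF Q.hom_over_comp[OF F G]] by simp
  qed
qed

text \<open>\<open>H\<close> sends the image of a cartesian \<open>f\<close> to \<open>f\<close>
  with vertical isomorphisms composed on both sides. These are cartesian, hence so is the composite,
  and \<open>H\<close> reflects cartesian arrows.\<close>

lemma inv_fctr_fibred: "fibred_functor B q p inv_fctr"
  unfolding fibred_functor_def
proof (intro conjI ballI allI impI)
  show "cat_functor (Tot q) (Tot p) inv_fctr" by (rule inv_fctr_functor)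
  show "OMap (Prj p) (OMap inv_fctr x) = OMap (Prj q) x" if "x \<in> Obj (Tot q)" for x
    using over_inv_obj[OF that] by (simp add: inv_fctr_def)
  show "AMap (Prj p) (AMap inv_fctr f) = AMap (Prj q) f" if "f \<in> Arr (Tot q)" for f
    using inv_fctr_arr(1)[OF Q.hom_overI[OF that]] by (simp add: hom_over_def)
  fix f assume c: "cartesian B q f"
  then have f: "f \<in> hom_over q (AMap (Prj q) f) (Dom (Tot q) f) (Cod (Tot q) f)"
    by (intro Q.hom_overI) (simp add: cartesian_def)
  note b = Q.hom_over_base[OF f]
  note x = inv_obj(2)[OF b(4)] and y = Q.vertical_iso_sym[OF inv_obj(2)[OF b(5)]]
  note Vx = Q.vertical_isoD[OF x] and Vy = Q.vertical_isoD[OF y]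
  note 1 = Q.cartesian_comp[OF Q.vertical_iso_cartesian[OF x] Vx(1) c f]
  note 2 = Q.cartesian_comp[OF 1 Q.hom_over_comp[OF Vx(1) f] Q.vertical_iso_cartesian[OF y] Vy(1)]
  show "cartesian B p (AMap inv_fctr f)"
    using reflects_cartesian[OF inv_fctr_arr(1)[OF f]] 2 inv_fctr_arr(2)[OF f] by simp
qed

lemma fctr_fibred: "fibred_functor B p q H"
  unfolding fibred_functor_def
proof (intro conjI ballI allI impI)
  show "cat_functor (Tot p) (Tot q) H" by (rule H.cat_functor_axioms)
  fix f assume c: "cartesian B p f"
  then have "f \<in> Arr (Tot p)" by (simp add: cartesian_def)
  then show "cartesian B q (AMap H f)" by (rule preserves_cartesian[OF P.hom_overI c])
qed simp_all

text \<open>A cartesian arrow over \<open>u\<close> into \<open>OMap H a\<close> may start outside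
  the image of \<open>H\<close>. Precomposing with \<open>inv_to\<close> moves its source into the
  image and keeps it cartesian, after which full faithfulness applies.\<close>

lemma fibration_source:
  assumes "fibration B q"
  shows "fibration B p"
  unfolding fibration_def
proof (intro conjI ballI impI)
  show "cat_functor (Tot p) B (Prj p)" by (rule P.cat_functor_axioms)
  fix u a assume u: "u \<in> Arr B" and a: "a \<in> Obj (Tot p)" "OMap (Prj p) a = Cod B u"
  obtain k where k: "cartesian_lift B q u (OMap H a) k"
    using assms u a unfolding fibration_def by (metis H.map_obj over_obj)
  define x where "x = Dom (Tot q) k"
  have K: "k \<in> hom_over q u x (OMap H a)" "cartesian B q k"
    using k by (auto simp: cartesian_lift_def cartesian_def hom_over_iff x_def)
  note b = Q.hom_over_base[OF K(1)]
  note x = inv_obj[OF b(4)]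
  note v = Q.vertical_isoD[OF x(2)]
  have ki: "k \<cdot>\<^bsub>Tot q\<^esub> inv_to x \<in> hom_over q u (OMap H (inv_obj x)) (OMap H a)"
    by (rule Q.vertical_comp[OF v(1) K(1) v(8)])
  note l = preimage[OF x(1) a(1) ki]
  have "cartesian B p (preimage u (inv_obj x) a (k \<cdot>\<^bsub>Tot q\<^esub> inv_to x))"
    by (rule reflects_cartesian[OF l(1)])
       (simp add: l(2) Q.cartesian_comp[OF Q.vertical_iso_cartesian[OF x(2)] v(1) K(2,1)])
  then show "\<exists>k. cartesian_lift B p u a k" using hom_overD[OF l(1)] by (auto simp: cartesian_lift_def)
qed

lemma cat_functor_id_target: "cat_functor (Tot q) (Tot q) id_fctr"
  by unfold_locales (simp_all add: id_fctr_def)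

lemma cat_functor_id_source: "cat_functor (Tot p) (Tot p) id_fctr"
  by unfold_locales (simp_all add: id_fctr_def)

text \<open>Directed from the identity to the composite, with components \<open>inv_from\<close>,
  because \<open>fibred_equivalent\<close> is established with \<open>q\<close> as its first
  fibration and asks for this direction there.\<close>

lemma counit_iso: "vertical_nat_iso B q q id_fctr (comp_fctr H inv_fctr) inv_from"
  unfolding vertical_nat_iso_def
proof (intro conjI ballI)
  interpret G: cat_functor "Tot q" "Tot p" inv_fctr by (rule inv_fctr_functor)
  show "nat_transformation (Tot q) (Tot q) id_fctr (comp_fctr H inv_fctr) inv_from"
  proof (intro nat_transformation.intro cat_functor_id_target nat_transformation_axioms.intro)
    show "cat_functor (Tot q) (Tot q) (comp_fctr H inv_fctr)"
      by unfold_locales (auto simp: comp_fctr_def hom_def)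
    show "inv_from x \<in> hom (Tot q) (OMap id_fctr x) (OMap (comp_fctr H inv_fctr) x)"
      if "x \<in> Obj (Tot q)" for x
      using inv_to(2)[OF that] by (simp add: id_fctr_def comp_fctr_def inv_fctr_def hom_over_def)
    fix f x y assume f: "f \<in> hom (Tot q) x y"
    have "f \<in> hom_over q (AMap (Prj q) f) x y" using f by (simp add: hom_over_def)
    from inv_to_natural(2)[OF this]
    show "AMap (comp_fctr H inv_fctr) f \<cdot>\<^bsub>Tot q\<^esub> inv_from x = inv_from y \<cdot>\<^bsub>Tot q\<^esub> AMap id_fctr f"
      by (simp add: id_fctr_def comp_fctr_def)
  qed
  fix x assume x: "x \<in> Obj (Tot q)"
  show "is_iso (Tot q) (inv_from x)"
    by (rule Q.vertical_iso_is_iso[OF Q.vertical_iso_sym[OF inv_obj(2)[OF x]]])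
  show "AMap (Prj q) (inv_from x) = Id B (OMap (Prj q) x)"
    using inv_to(2)[OF x] by (simp add: hom_over_def)
qed

text \<open>Chosen as the arrow that \<open>H\<close> sends to \<open>inv_to\<close> at
  \<open>OMap H a\<close>, so that its naturality reduces under \<open>H\<close> to that of
  \<open>inv_to\<close>.\<close>

definition inv_unit :: "'e1 \<Rightarrow> 'f1" where
  "inv_unit a = preimage (Id B (OMap (Prj p) a)) (inv_obj (OMap H a)) a (inv_to (OMap H a))"

lemma reflects_vertical_iso:
  assumes "f \<in> hom_over p (Id B (OMap (Prj p) a)) a b" "Q.vertical_iso (OMap H a) (OMap H b) (AMap H f) j"
  shows "\<exists>g. P.vertical_iso a b f g"
proof -
  note b = P.hom_over_base[OF assms(1)] and v = Q.vertical_isoD[OF assms(2)]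
  obtain g where g: "g \<in> hom_over p (Id B (OMap (Prj p) a)) b a" "AMap H g = j"
    using full[OF b(5,4)] v(2) b by auto
  have "g \<cdot>\<^bsub>Tot p\<^esub> f = Id (Tot p) a"
    by (rule faithful[OF P.comp_vertical[OF assms(1) g(1)] P.id_vertical])
       (use map_comp_over[OF assms(1) g(1)] b g v in simp_all)
  moreover have "f \<cdot>\<^bsub>Tot p\<^esub> g = Id (Tot p) b"
  proof (rule faithful[OF P.comp_vertical[OF g(1) assms(1)]])
    show "Id (Tot p) b \<in> hom_over p (Id B (OMap (Prj p) a)) b b"
      using P.id_vertical[OF b(5)] b by simp
  qed (use map_comp_over[OF g(1) assms(1)] b g v in simp_all)
  ultimately show ?thesis using assms(1) g(1) by (auto simp: P.vertical_iso_def)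
qed

lemma inv_unit:
  assumes "a \<in> Obj (Tot p)"
  shows "inv_unit a \<in> hom_over p (Id B (OMap (Prj p) a)) (inv_obj (OMap H a)) a"
    "AMap H (inv_unit a) = inv_to (OMap H a)"
    "is_iso (Tot p) (inv_unit a)"
proof -
  have Ha: "OMap H a \<in> Obj (Tot q)" using assms by simp
  note x = inv_to[OF Ha] and y = inv_obj[OF Ha]
  note u = preimage[OF y(1) assms x(1)]
  show 1: "inv_unit a \<in> hom_over p (Id B (OMap (Prj p) a)) (inv_obj (OMap H a)) a"
    and 2: "AMap H (inv_unit a) = inv_to (OMap H a)"
    using u assms by (simp_all add: inv_unit_def)
  have "\<exists>g. P.vertical_iso (inv_obj (OMap H a)) a (inv_unit a) g"
    by (rule reflects_vertical_iso) (use 1 2 y over_inv_obj[OF Ha] assms in simp_all)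
  then show "is_iso (Tot p) (inv_unit a)" using P.vertical_iso_is_iso by blast
qed

lemma unit_iso: "vertical_nat_iso B p p (comp_fctr inv_fctr H) id_fctr inv_unit"
  unfolding vertical_nat_iso_def
proof (intro conjI ballI)
  interpret G: cat_functor "Tot q" "Tot p" inv_fctr by (rule inv_fctr_functor)
  show "nat_transformation (Tot p) (Tot p) (comp_fctr inv_fctr H) id_fctr inv_unit"
  proof (intro nat_transformation.intro cat_functor_id_source nat_transformation_axioms.intro)
    show "cat_functor (Tot p) (Tot p) (comp_fctr inv_fctr H)"
      by unfold_locales (auto simp: comp_fctr_def hom_def)
    show "inv_unit a \<in> hom (Tot p) (OMap (comp_fctr inv_fctr H) a) (OMap id_fctr a)"
      if "a \<in> Obj (Tot p)" for a
      using inv_unit(1)[OF that] by (simp add: id_fctr_def comp_fctr_def inv_fctr_def hom_over_def)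
    fix f a b assume f: "f \<in> hom (Tot p) a b"
    define w where "w = AMap (Prj p) f"
    have F: "f \<in> hom_over p w a b" using f by (simp add: hom_over_def w_def)
    note b = P.hom_over_base[OF F]
    note Hf = map_hom_over[OF F]
    note GHf = inv_fctr_arr(1)[OF Hf]
    note ua = inv_unit[OF b(4)] and ub = inv_unit[OF b(5)]
    have "f \<cdot>\<^bsub>Tot p\<^esub> inv_unit a = inv_unit b \<cdot>\<^bsub>Tot p\<^esub> AMap inv_fctr (AMap H f)"
    proof (rule faithful)
      show "f \<cdot>\<^bsub>Tot p\<^esub> inv_unit a \<in> hom_over p w (inv_obj (OMap H a)) b"
        using P.vertical_comp[OF ua(1) F] b by simp
      show "inv_unit b \<cdot>\<^bsub>Tot p\<^esub> AMap inv_fctr (AMap H f) \<in> hom_over p w (inv_obj (OMap H a)) b"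
        using P.comp_vertical[OF GHf ub(1)] b by simp
      show "AMap H (f \<cdot>\<^bsub>Tot p\<^esub> inv_unit a) = AMap H (inv_unit b \<cdot>\<^bsub>Tot p\<^esub> AMap inv_fctr (AMap H f))"
        using map_comp_over[OF ua(1) F] map_comp_over[OF GHf ub(1)] ua(2) ub(2)
          inv_to_natural(1)[OF Hf] by simp
    qed
    then show "AMap id_fctr f \<cdot>\<^bsub>Tot p\<^esub> inv_unit a = inv_unit b \<cdot>\<^bsub>Tot p\<^esub> AMap (comp_fctr inv_fctr H) f"
      by (simp add: id_fctr_def comp_fctr_def)
  qed
  fix a assume a: "a \<in> Obj (Tot p)"
  show "is_iso (Tot p) (inv_unit a)" by (rule inv_unit(3)[OF a])
  show "AMap (Prj p) (inv_unit a) = Id B (OMap (Prj p) a)"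
    using inv_unit(1)[OF a] by (simp add: hom_over_def)
qed

text \<open>Source and target of \<open>H\<close> are exchanged on purpose: in the application
  \<open>H\<close> goes from the completion to the given fibration, and the statement wanted names
  the given fibration first.\<close>

theorem fibred_equivalent:
  assumes "fibration B q"
  shows "fibred_equivalent B q p"
  unfolding fibred_equivalent_def
  using assms fibration_source inv_fctr_fibred fctr_fibred counit_iso unit_iso by blast

end

text \<open>Faithfulness of \<open>H\<close> is cancellation of \<open>s\<close>, that of
  \<open>K\<close> is cancellation of \<open>t\<close>. For fullness, \<open>f\<close> is the
  conjugate by \<open>s\<close> of the image of \<open>h\<close> under \<open>K\<close>. Naturality
  of \<open>s\<close> shows that \<open>K\<close> identifies the image of \<open>f\<close> under
  \<open>H\<close> with \<open>h\<close>, and faithfulness of \<open>K\<close> finishes.\<close>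

lemma fibred_equivalentE:
  assumes "fibred_equivalent B p q"
  obtains H where "over_equivalence B p q H"
proof -
  from assms obtain H K s t where fp: "fibration B p" and fq: "fibration B q"
    and H: "fibred_functor B p q H" and K: "fibred_functor B q p K"
    and s: "vertical_nat_iso B p p id_fctr (comp_fctr K H) s"
    and t: "vertical_nat_iso B q q (comp_fctr H K) id_fctr t"
    unfolding fibred_equivalent_def by blast
  interpret P: over_category B p using fp by (simp add: fibration_def over_category_def)
  interpret Q: over_category B q using fq by (simp add: fibration_def over_category_def)
  interpret H: cat_functor "Tot p" "Tot q" H using H by (simp add: fibred_functor_def)
  interpret K: cat_functor "Tot q" "Tot p" K using K by (simp add: fibred_functor_def)
  have [simp]: "\<And>a. a \<in> Obj (Tot p) \<Longrightarrow> OMap (Prj q) (OMap H a) = OMap (Prj p) a"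
    "\<And>f. f \<in> Arr (Tot p) \<Longrightarrow> AMap (Prj q) (AMap H f) = AMap (Prj p) f"
    "\<And>a. a \<in> Obj (Tot q) \<Longrightarrow> OMap (Prj p) (OMap K a) = OMap (Prj q) a"
    "\<And>f. f \<in> Arr (Tot q) \<Longrightarrow> AMap (Prj p) (AMap K f) = AMap (Prj q) f"
    using H K by (simp_all add: fibred_functor_def)
  interpret S: nat_transformation "Tot p" "Tot p" id_fctr "comp_fctr K H" s
    using s by (simp add: vertical_nat_iso_def)
  interpret T: nat_transformation "Tot q" "Tot q" "comp_fctr H K" id_fctr t
    using t by (simp add: vertical_nat_iso_def)
  have S: "\<exists>j. P.vertical_iso a (OMap K (OMap H a)) (s a) j" if a: "a \<in> Obj (Tot p)" for a
  proof -
    have "s a \<in> hom_over p (Id B (OMap (Prj p) a)) a (OMap K (OMap H a))"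
      using S.component[OF a] s a by (simp add: vertical_nat_iso_def hom_over_def id_fctr_def comp_fctr_def)
    moreover have "is_iso (Tot p) (s a)" using s a by (simp add: vertical_nat_iso_def)
    ultimately show ?thesis using P.is_iso_vertical_iso by blast
  qed
  have T: "\<exists>j. Q.vertical_iso (OMap H (OMap K x)) x (t x) j" if x: "x \<in> Obj (Tot q)" for x
  proof -
    have "t x \<in> hom_over q (Id B (OMap (Prj q) (OMap H (OMap K x)))) (OMap H (OMap K x)) x"
      using T.component[OF x] t x by (simp add: vertical_nat_iso_def hom_over_def id_fctr_def comp_fctr_def)
    moreover have "is_iso (Tot q) (t x)" using t x by (simp add: vertical_nat_iso_def)
    ultimately show ?thesis using Q.is_iso_vertical_iso by blast
  qed
  have Snat: "AMap K (AMap H f) \<cdot>\<^bsub>Tot p\<^esub> s a = s b \<cdot>\<^bsub>Tot p\<^esub> f" if "f \<in> hom_over p w a b" for f w a b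
    using S.naturality[of f a b] that by (simp add: hom_over_def id_fctr_def comp_fctr_def)
  have Tnat: "g \<cdot>\<^bsub>Tot q\<^esub> t x = t y \<cdot>\<^bsub>Tot q\<^esub> AMap H (AMap K g)" if "g \<in> hom_over q w x y" for g w x y
    using T.naturality[of g x y] that by (simp add: hom_over_def id_fctr_def comp_fctr_def)
  have faithH: "f = f'" if f: "f \<in> hom_over p w a b" and f': "f' \<in> hom_over p w a b"
    and eq: "AMap H f = AMap H f'" for f f' w a b
  proof -
    obtain j where j: "P.vertical_iso b (OMap K (OMap H b)) (s b) j"
      using S P.hom_over_base(5)[OF f] by blast
    have "s b \<cdot>\<^bsub>Tot p\<^esub> f = s b \<cdot>\<^bsub>Tot p\<^esub> f'" using Snat[OF f] Snat[OF f'] eq by simp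
    then show ?thesis using P.vertical_iso_cancel(2)[OF j] f f' by metis
  qed
  have faithK: "g = g'" if g: "g \<in> hom_over q w x y" and g': "g' \<in> hom_over q w x y"
    and eq: "AMap K g = AMap K g'" for g g' w x y
  proof -
    obtain j where j: "Q.vertical_iso (OMap H (OMap K x)) x (t x) j"
      using T Q.hom_over_base(4)[OF g] by blast
    have "g \<cdot>\<^bsub>Tot q\<^esub> t x = g' \<cdot>\<^bsub>Tot q\<^esub> t x" using Tnat[OF g] Tnat[OF g'] eq by simp
    then show ?thesis using Q.vertical_iso_cancel(1)[OF j] g g' by metis
  qed
  have "over_equivalence B p q H"
  proof
    show "OMap (Prj q) (OMap H a) = OMap (Prj p) a" if "a \<in> Obj (Tot p)" for a using that by simp
    show "AMap (Prj q) (AMap H f) = AMap (Prj p) f" if "f \<in> Arr (Tot p)" for f using that by simp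
    show "\<exists>a\<in>Obj (Tot p). \<exists>i j. Q.vertical_iso (OMap H a) x i j" if "x \<in> Obj (Tot q)" for x
      using T[OF that] that by (intro bexI[of _ "OMap K x"]) auto
    fix a b h w
    assume a: "a \<in> Obj (Tot p)" and b: "b \<in> Obj (Tot p)" and h: "h \<in> hom_over q w (OMap H a) (OMap H b)"
    obtain ja where ja: "P.vertical_iso a (OMap K (OMap H a)) (s a) ja" using S[OF a] by blast
    obtain jb where jb: "P.vertical_iso b (OMap K (OMap H b)) (s b) jb" using S[OF b] by blast
    note va = P.vertical_isoD[OF ja] and vb = P.vertical_isoD[OF jb]
    have Kh: "AMap K h \<in> hom_over p w (OMap K (OMap H a)) (OMap K (OMap H b))"
      using h by (simp add: hom_over_iff)
    note Khs = P.vertical_comp[OF va(1) Kh va(8)]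
    define f where "f = jb \<cdot>\<^bsub>Tot p\<^esub> (AMap K h \<cdot>\<^bsub>Tot p\<^esub> s a)"
    have f: "f \<in> hom_over p w a b" unfolding f_def by (rule P.comp_vertical[OF Khs vb(2,8)])
    have "AMap K (AMap H f) \<cdot>\<^bsub>Tot p\<^esub> s a = AMap K h \<cdot>\<^bsub>Tot p\<^esub> s a"
      unfolding Snat[OF f] unfolding f_def
      by (rule P.vertical_iso_cancel(2)[OF P.vertical_iso_sym[OF jb] Khs])
    moreover have "AMap K (AMap H f) \<in> hom_over p w (OMap K (OMap H a)) (OMap K (OMap H b))"
      using f by (simp add: hom_over_iff)
    ultimately have "AMap K (AMap H f) = AMap K h"
      using P.vertical_iso_cancel(1)[OF ja] Kh by metis
    moreover have "AMap H f \<in> hom_over q w (OMap H a) (OMap H b)"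
      using f by (simp add: hom_over_iff)
    ultimately have "AMap H f = h" using faithK h by blast
    with f show "\<exists>!f. f \<in> hom_over p w a b \<and> AMap H f = h" using faithH by blast
  qed
  then show thesis by (rule that)
qed

text \<open>Ensures that \<open>inv_arrow\<close>, a definite description, denotes an actual inverse
  in a fibre, as \<open>reindex_square\<close> requires.\<close>

lemma (in over_category) category_fibre:
  assumes "A \<in> Obj B"
  shows "category (fibre B p A)"
proof
  note [simp] = assms
  fix f assume "f \<in> Arr (fibre B p A)"
  then have f: "f \<in> Arr (Tot p)" "AMap (Prj p) f = Id B A" by simp_all
  then have "OMap (Prj p) (Dom (Tot p) f) = A" "OMap (Prj p) (Cod (Tot p) f) = A"
    using map_arr(2,3)[OF f(1)] by simp_all
  with f show "Dom (fibre B p A) f \<in> Obj (fibre B p A)" "Cod (fibre B p A) f \<in> Obj (fibre B p A)"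
    by (simp_all add: Obj_fibre)
  from f show "Id (fibre B p A) (Cod (fibre B p A) f) \<cdot>\<^bsub>fibre B p A\<^esub> f = f"
    "f \<cdot>\<^bsub>fibre B p A\<^esub> Id (fibre B p A) (Dom (fibre B p A) f) = f" by simp_all
next
  fix a assume "a \<in> Obj (fibre B p A)"
  then show "Id (fibre B p A) a \<in> hom (fibre B p A) a a"
    using id_vertical[of a] by (simp add: Obj_fibre hom_fibre)
next
  fix f g x y z assume "f \<in> hom (fibre B p A) x y" "g \<in> hom (fibre B p A) y z"
  then show "g \<cdot>\<^bsub>fibre B p A\<^esub> f \<in> hom (fibre B p A) x z"
    using comp_vertical[of f "Id B A" x y g A z] assms by (simp add: hom_fibre)
next
  fix f g h w x y z
  assume "f \<in> hom (fibre B p A) w x" "g \<in> hom (fibre B p A) x y" "h \<in> hom (fibre B p A) y z"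
  then show "(h \<cdot>\<^bsub>fibre B p A\<^esub> g) \<cdot>\<^bsub>fibre B p A\<^esub> f = h \<cdot>\<^bsub>fibre B p A\<^esub> (g \<cdot>\<^bsub>fibre B p A\<^esub> f)"
    using hom_over_assoc[of f "Id B A" w x g "Id B A" y h] by (simp add: hom_fibre)
qed

section \<open>Reindexing and coproducts\<close>

locale coproduct_fibration =
  over_category B p + display: display_map_category B F
  for B :: "('b, 'c) cat" and F :: "'c set" and p :: "('b, 'c, 'e, 'f) cloven" +
  fixes C :: "('c, 'e, 'f) coprods"
  assumes cloven: "cloven_fibration B p"
    and coproducts: "has_coproducts B F p C"
begin

abbreviation ecomp :: "'f \<Rightarrow> 'f \<Rightarrow> 'f" (infixl "\<bullet>" 70) where "g \<bullet> f \<equiv> g \<cdot>\<^bsub>Tot p\<^esub> f"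
abbreviation "ob \<equiv> OMap (Prj p)"
abbreviation "re u \<equiv> OMap (reindex B p u)"
abbreviation "co u \<equiv> OMap (Coprod C u)"

lemma lift:
  assumes "u \<in> Arr B" "a \<in> Obj (Tot p)" "ob a = Cod B u"
  shows "Lift p u a \<in> hom_over p u (re u a) a" "cartesian B p (Lift p u a)"
    "re u a \<in> Obj (Tot p)" "ob (re u a) = Dom B u"
proof -
  have *: "cartesian_lift B p u a (Lift p u a)"
    using cloven assms by (auto simp: cloven_fibration_def)
  then show 1: "Lift p u a \<in> hom_over p u (re u a) a" "cartesian B p (Lift p u a)"
    by (auto simp: cartesian_lift_def cartesian_def hom_over_iff reindex_def)
  show "re u a \<in> Obj (Tot p)" "ob (re u a) = Dom B u" using hom_over_base[OF 1(1)] by auto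
qed

lemma reindex_arr:
  assumes "u \<in> Arr B" "f \<in> hom_over p (Id B (Cod B u)) a b"
  shows "AMap (reindex B p u) f \<in> hom_over p (Id B (Dom B u)) (re u a) (re u b)"
    "Lift p u b \<bullet> AMap (reindex B p u) f = f \<bullet> Lift p u a"
proof -
  note b = hom_over_base[OF assms(2)]
  have ob: "ob a = Cod B u" "ob b = Cod B u" using assms(1) b by simp_all
  note la = lift[OF assms(1) b(4) ob(1)] and lb = lift[OF assms(1) b(5) ob(2)]
  have "f \<bullet> Lift p u a \<in> hom_over p (u \<cdot>\<^bsub>B\<^esub> Id B (Dom B u)) (re u a) b"
    using comp_vertical[OF la(1) assms(2)] assms(1) by simp
  from cartesian_factor[OF lb(2,1) this]
  show "AMap (reindex B p u) f \<in> hom_over p (Id B (Dom B u)) (re u a) (re u b)"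
    "Lift p u b \<bullet> AMap (reindex B p u) f = f \<bullet> Lift p u a"
    using assms la lb hom_overD[OF assms(2)] by (simp_all add: reindex_def hom_def)
qed

section \<open>The adjunction along one display map and its injections\<close>

context
  fixes v assumes v: "v \<in> F"
begin

lemma display_base [simp]: "v \<in> Arr B" "Dom B v \<in> Obj B" "Cod B v \<in> Obj B"
  using v display.display_arr by auto

interpretation A: adjunction "fibre B p (Dom B v)" "fibre B p (Cod B v)"
  "Coprod C v" "reindex B p v" "Unit C v" "Counit C v"
  using coproducts v by (simp add: has_coproducts_def)

lemma co_obj:
  assumes "b \<in> Obj (Tot p)" "ob b = Dom B v"
  shows "co v b \<in> Obj (Tot p)" "ob (co v b) = Cod B v"
  using A.left.map_obj[of b] assms by (simp_all add: Obj_fibre)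

lemma co_arr:
  assumes "f \<in> hom_over p (Id B (Dom B v)) a b"
  shows "AMap (Coprod C v) f \<in> hom_over p (Id B (Cod B v)) (co v a) (co v b)"
  using A.left.map_hom[of f a b] assms by (simp add: hom_fibre)

lemma co_comp:
  assumes "f \<in> hom_over p (Id B (Dom B v)) a b" "g \<in> hom_over p (Id B (Dom B v)) b c"
  shows "AMap (Coprod C v) (g \<bullet> f) = AMap (Coprod C v) g \<bullet> AMap (Coprod C v) f"
  using A.left.map_comp[of f a b g c] assms by (simp add: hom_fibre)

lemma reindex_comp_arr:
  assumes "f \<in> hom_over p (Id B (Cod B v)) a b" "g \<in> hom_over p (Id B (Cod B v)) b c"
  shows "AMap (reindex B p v) (g \<bullet> f) = AMap (reindex B p v) g \<bullet> AMap (reindex B p v) f"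
  using A.right.map_comp[of f a b g c] assms by (simp add: hom_fibre)

lemma unit:
  assumes "b \<in> Obj (Tot p)" "ob b = Dom B v"
  shows "Unit C v b \<in> hom_over p (Id B (Dom B v)) b (re v (co v b))"
  using A.unit.component[of b] assms
  by (simp add: Obj_fibre hom_fibre id_fctr_def comp_fctr_def)

lemma unit_natural:
  assumes "f \<in> hom_over p (Id B (Dom B v)) a b"
  shows "AMap (reindex B p v) (AMap (Coprod C v) f) \<bullet> Unit C v a = Unit C v b \<bullet> f"
  using A.unit.naturality[of f a b] assms by (simp add: hom_fibre id_fctr_def comp_fctr_def)

lemma counit:
  assumes "y \<in> Obj (Tot p)" "ob y = Cod B v"
  shows "Counit C v y \<in> hom_over p (Id B (Cod B v)) (co v (re v y)) y"
  using A.counit.component[of y] assms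
  by (simp add: Obj_fibre hom_fibre id_fctr_def comp_fctr_def)

lemma counit_natural:
  assumes "f \<in> hom_over p (Id B (Cod B v)) a b"
  shows "f \<bullet> Counit C v a = Counit C v b \<bullet> AMap (Coprod C v) (AMap (reindex B p v) f)"
  using A.counit.naturality[of f a b] assms by (simp add: hom_fibre id_fctr_def comp_fctr_def)

lemma triangles:
  "b \<in> Obj (Tot p) \<Longrightarrow> ob b = Dom B v \<Longrightarrow>
     Counit C v (co v b) \<bullet> AMap (Coprod C v) (Unit C v b) = Id (Tot p) (co v b)"
  "y \<in> Obj (Tot p) \<Longrightarrow> ob y = Cod B v \<Longrightarrow>
     AMap (reindex B p v) (Counit C v y) \<bullet> Unit C v (re v y) = Id (Tot p) (re v y)"
  using A.triangle_left[of b] A.triangle_right[of y] by (simp_all add: Obj_fibre)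

definition inj :: "'e \<Rightarrow> 'f" where
  "inj b = Lift p v (co v b) \<bullet> Unit C v b"

lemma inj:
  assumes "b \<in> Obj (Tot p)" "ob b = Dom B v"
  shows "inj b \<in> hom_over p v b (co v b)"
  unfolding inj_def
  using vertical_comp[OF unit[OF assms] lift(1)[OF _ co_obj[OF assms]]] by simp

text \<open>Existence in the universal property of \<open>inj b\<close>, over the identity: the
  adjoint transpose of \<open>f\<close> factors \<open>Lift p v y \<bullet> f\<close>. The first
  computation is the triangle identity by which transposing back returns \<open>f\<close>.\<close>

lemma transpose:
  assumes f: "f \<in> hom_over p (Id B (Dom B v)) b (re v y)" and y: "y \<in> Obj (Tot p)" "ob y = Cod B v"
  shows "Counit C v y \<bullet> AMap (Coprod C v) f \<in> hom_over p (Id B (Cod B v)) (co v b) y"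
    "(Counit C v y \<bullet> AMap (Coprod C v) f) \<bullet> inj b = Lift p v y \<bullet> f"
proof -
  have b: "b \<in> Obj (Tot p)" "ob b = Dom B v" using hom_over_base[OF f] by auto
  note Lf = co_arr[OF f]
  note e = counit[OF y] and ly = lift[OF _ y] and n = unit[OF b] and lb = lift[OF _ co_obj[OF b]]
  note y' = ly(3,4)[OF display_base(1)]
  let ?g = "Counit C v y \<bullet> AMap (Coprod C v) f"
  show g: "?g \<in> hom_over p (Id B (Cod B v)) (co v b) y"
    using comp_vertical[OF Lf e] by simp
  note Re = reindex_arr[OF display_base(1) e]
  note RLf = reindex_arr[OF display_base(1) Lf] and ny = unit[OF y']
  have "AMap (reindex B p v) ?g \<bullet> Unit C v b =
      AMap (reindex B p v) (Counit C v y) \<bullet> (AMap (reindex B p v) (AMap (Coprod C v) f) \<bullet> Unit C v b)"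
    unfolding reindex_comp_arr[OF Lf e] by (rule hom_over_assoc[OF n RLf(1) Re(1)])
  also have "\<dots> = (AMap (reindex B p v) (Counit C v y) \<bullet> Unit C v (re v y)) \<bullet> f"
    unfolding unit_natural[OF f] by (rule hom_over_assoc[OF f ny Re(1), symmetric])
  also have "\<dots> = f" unfolding triangles(2)[OF y] by (rule hom_over_id[OF f])
  finally have 1: "AMap (reindex B p v) ?g \<bullet> Unit C v b = f" .
  note Rg = reindex_arr[OF display_base(1) g]
  have "?g \<bullet> inj b = (?g \<bullet> Lift p v (co v b)) \<bullet> Unit C v b"
    unfolding inj_def by (rule hom_over_assoc[OF n lb(1)[OF display_base(1)] g, symmetric])
  also have "\<dots> = Lift p v y \<bullet> (AMap (reindex B p v) ?g \<bullet> Unit C v b)"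
    unfolding Rg(2)[symmetric] by (rule hom_over_assoc[OF n Rg(1) ly(1)[OF display_base(1)]])
  finally show "?g \<bullet> inj b = Lift p v y \<bullet> f" unfolding 1 .
qed

text \<open>Uniqueness over the identity. From \<open>k \<bullet> inj b\<close>, cancelling the
  cartesian lift of \<open>y\<close> leaves the reindexed \<open>k\<close> after the unit; the
  coproduct functor followed by the counit then gives back \<open>k\<close>, by the other triangle
  identity.\<close>

lemma vertical_inj_cancel:
  assumes b: "b \<in> Obj (Tot p)" "ob b = Dom B v"
    and h: "h \<in> hom_over p (Id B (Cod B v)) (co v b) y" "h' \<in> hom_over p (Id B (Cod B v)) (co v b) y"
    and eq: "h \<bullet> inj b = h' \<bullet> inj b"
  shows "h = h'"
proof -
  have y: "y \<in> Obj (Tot p)" "ob y = Cod B v" using hom_over_base[OF h(1)] by auto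
  note e = counit[OF y] and ly = lift[OF display_base(1) y] and n = unit[OF b]
    and lb = lift[OF display_base(1) co_obj[OF b]]
  have Lift_R: "Lift p v y \<bullet> (AMap (reindex B p v) k \<bullet> Unit C v b) = k \<bullet> inj b"
    and Rn: "AMap (reindex B p v) k \<bullet> Unit C v b \<in> hom_over p (Id B (Dom B v)) b (re v y)"
    and k: "k = Counit C v y \<bullet> AMap (Coprod C v) (AMap (reindex B p v) k \<bullet> Unit C v b)"
    if "k \<in> hom_over p (Id B (Cod B v)) (co v b) y" for k
  proof -
    note Rk = reindex_arr[OF display_base(1) that]
    have "Lift p v y \<bullet> (AMap (reindex B p v) k \<bullet> Unit C v b) = (k \<bullet> Lift p v (co v b)) \<bullet> Unit C v b"
      unfolding Rk(2)[symmetric] by (rule hom_over_assoc[OF n Rk(1) ly(1), symmetric])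
    then show "Lift p v y \<bullet> (AMap (reindex B p v) k \<bullet> Unit C v b) = k \<bullet> inj b"
      unfolding inj_def using hom_over_assoc[OF n lb(1) that] by simp
    show "AMap (reindex B p v) k \<bullet> Unit C v b \<in> hom_over p (Id B (Dom B v)) b (re v y)"
      using comp_vertical[OF n Rk(1)] by simp
    have "Counit C v y \<bullet> AMap (Coprod C v) (AMap (reindex B p v) k \<bullet> Unit C v b)
       = (Counit C v y \<bullet> AMap (Coprod C v) (AMap (reindex B p v) k)) \<bullet> AMap (Coprod C v) (Unit C v b)"
      unfolding co_comp[OF n Rk(1)] by (rule hom_over_assoc[OF co_arr[OF n] co_arr[OF Rk(1)] e, symmetric])
    also have "\<dots> = k \<bullet> (Counit C v (co v b) \<bullet> AMap (Coprod C v) (Unit C v b))"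
      unfolding counit_natural[OF that, symmetric]
      by (rule hom_over_assoc[OF co_arr[OF n] counit[OF co_obj[OF b]] that])
    also have "\<dots> = k" unfolding triangles(1)[OF b] by (rule hom_over_id[OF that])
    finally show "k = Counit C v y \<bullet> AMap (Coprod C v) (AMap (reindex B p v) k \<bullet> Unit C v b)" ..
  qed
  have "AMap (reindex B p v) h \<bullet> Unit C v b = AMap (reindex B p v) h' \<bullet> Unit C v b"
    using cartesian_cancel[OF ly(2,1) Rn[OF h(1)] Rn[OF h(2)]] Lift_R[OF h(1)] Lift_R[OF h(2)] eq by simp
  with k[OF h(1)] k[OF h(2)] show "h = h'" by simp
qed

text \<open>The adjunction relates fibres, so it gives factorisations over the identity. For general
  \<open>w\<close> the target \<open>y\<close> is replaced by its reindexing along \<open>w\<close>: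
  arrows into \<open>y\<close> over \<open>w\<close> are vertical arrows into \<open>re w y\<close>,
  where the two preceding lemmas apply.\<close>

lemma inj_opcartesian:
  assumes b: "b \<in> Obj (Tot p)" "ob b = Dom B v"
  shows "opcartesian B p (inj b)"
proof (rule opcartesianI[OF inj[OF b]])
  note i = inj[OF b]
  fix f y w
  assume f: "f \<in> hom_over p (w \<cdot>\<^bsub>B\<^esub> v) b y" and w: "w \<in> hom B (ob (co v b)) (ob y)"
  have y: "y \<in> Obj (Tot p)" using hom_over_base[OF f] by simp
  have w': "w \<in> Arr B" "Dom B w = Cod B v" "Cod B w = ob y" using w co_obj[OF b] by (auto simp: hom_def)
  note lw = lift[OF w'(1) y w'(3)[symmetric]]
  have wy: "ob (re w y) = Cod B v" using lw w' by simp
  note lv = lift[OF display_base(1) lw(3) wy]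
  \<comment> \<open>The arrow \<open>f\<close> is factored through two cartesian lifts, that of
    \<open>w\<close> and then that of \<open>v\<close>; the remaining vertical arrow
    \<open>k\<close> is what can be transposed.\<close>
  obtain g where g: "g \<in> hom_over p v b (re w y)" "Lift p w y \<bullet> g = f"
    using cartesian_unique_factor[OF lw(2,1) f] b lw w' by (auto simp: hom_def)
  obtain k where k: "k \<in> hom_over p (Id B (Dom B v)) b (re v (re w y))" "Lift p v (re w y) \<bullet> k = g"
    using cartesian_unique_factor[OF lv(2,1), of g "Id B (Dom B v)" b] g b lv by (auto simp: hom_def)
  note t = transpose[OF k(1) lw(3) wy]
  let ?h = "Counit C v (re w y) \<bullet> AMap (Coprod C v) k"
  have "(Lift p w y \<bullet> ?h) \<bullet> inj b = f"
    using hom_over_assoc[OF i t(1) lw(1)] t(2) k(2) g(2) by simp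
  moreover have "Lift p w y \<bullet> ?h \<in> hom_over p w (co v b) y"
    using vertical_comp[OF t(1) lw(1)] by simp
  ultimately show "\<exists>h\<in>hom_over p w (co v b) y. h \<bullet> inj b = f" by blast
next
  note i = inj[OF b]
  fix y w h h'
  assume h: "h \<in> hom_over p w (co v b) y" "h' \<in> hom_over p w (co v b) y" "h \<bullet> inj b = h' \<bullet> inj b"
  have y: "y \<in> Obj (Tot p)" and w': "w \<in> Arr B" "Dom B w = Cod B v" "Cod B w = ob y"
    using hom_over_base[OF h(1)] co_obj[OF b] by auto
  note lw = lift[OF w'(1) y w'(3)[symmetric]]
  have vert: "\<exists>k. k \<in> hom_over p (Id B (Cod B v)) (co v b) (re w y) \<and> Lift p w y \<bullet> k = h"
    if "h \<in> hom_over p w (co v b) y" for h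
    using cartesian_unique_factor[OF lw(2,1), of h "Id B (Cod B v)" "co v b"] that w' co_obj[OF b] lw
    by (auto simp: hom_def)
  obtain k where k: "k \<in> hom_over p (Id B (Cod B v)) (co v b) (re w y)" "Lift p w y \<bullet> k = h"
    using vert[OF h(1)] by blast
  obtain k' where k': "k' \<in> hom_over p (Id B (Cod B v)) (co v b) (re w y)" "Lift p w y \<bullet> k' = h'"
    using vert[OF h(2)] by blast
  have "k \<bullet> inj b = k' \<bullet> inj b"
  proof (rule cartesian_cancel[OF lw(2,1)])
    show "k \<bullet> inj b \<in> hom_over p v b (re w y)" "k' \<bullet> inj b \<in> hom_over p v b (re w y)"
      using comp_vertical[OF i k(1)] comp_vertical[OF i k'(1)] by simp_all
    show "Lift p w y \<bullet> (k \<bullet> inj b) = Lift p w y \<bullet> (k' \<bullet> inj b)"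
      using hom_over_assoc[OF i k(1) lw(1)] hom_over_assoc[OF i k'(1) lw(1)] k k' h by simp
  qed
  then have "k = k'" by (rule vertical_inj_cancel[OF b k(1) k'(1)])
  then show "h = h'" using k k' by simp
qed

end

section \<open>Coherence isomorphisms, splitting and the Beck-Chevalley map in terms of
  lifts\<close>

lemma reindex_comp:
  assumes u: "u \<in> Arr B" and g: "g \<in> Arr B" "Cod B g = Dom B u"
    and a: "a \<in> Obj (Tot p)" "ob a = Cod B u"
  shows "reindex_comp B p u g a \<in> hom_over p (Id B (Dom B g)) (re g (re u a)) (re (u \<cdot>\<^bsub>B\<^esub> g) a)"
    "Lift p (u \<cdot>\<^bsub>B\<^esub> g) a \<bullet> reindex_comp B p u g a = Lift p u a \<bullet> Lift p g (re u a)"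
    "\<exists>j. vertical_iso (re g (re u a)) (re (u \<cdot>\<^bsub>B\<^esub> g) a) (reindex_comp B p u g a) j"
proof -
  have ug: "u \<cdot>\<^bsub>B\<^esub> g \<in> Arr B" "ob a = Cod B (u \<cdot>\<^bsub>B\<^esub> g)" "Dom B (u \<cdot>\<^bsub>B\<^esub> g) = Dom B g" using u g a by simp_all
  note lu = lift[OF u a]
  have ua: "ob (re u a) = Cod B g" using lu g by simp
  note lg = lift[OF g(1) lu(3) ua] and lug = lift[OF ug(1) a(1) ug(2)]
  have lulg: "Lift p u a \<bullet> Lift p g (re u a) \<in> hom_over p (u \<cdot>\<^bsub>B\<^esub> g) (re g (re u a)) a"
    by (rule hom_over_comp[OF lg(1) lu(1)])
  have "Lift p u a \<bullet> Lift p g (re u a) \<in> hom_over p ((u \<cdot>\<^bsub>B\<^esub> g) \<cdot>\<^bsub>B\<^esub> Id B (Dom B g)) (re g (re u a)) a"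
    using lulg u g by simp
  from cartesian_factor[OF lug(2,1) this]
  show 1: "reindex_comp B p u g a \<in> hom_over p (Id B (Dom B g)) (re g (re u a)) (re (u \<cdot>\<^bsub>B\<^esub> g) a)"
    and 2: "Lift p (u \<cdot>\<^bsub>B\<^esub> g) a \<bullet> reindex_comp B p u g a = Lift p u a \<bullet> Lift p g (re u a)"
    using lg lug g ug by (simp_all add: reindex_comp_def hom_def)
  obtain i j where ij: "vertical_iso (re g (re u a)) (re (u \<cdot>\<^bsub>B\<^esub> g) a) i j"
    "Lift p (u \<cdot>\<^bsub>B\<^esub> g) a \<bullet> i = Lift p u a \<bullet> Lift p g (re u a)"
    using cartesian_unique[OF cartesian_comp[OF lg(2,1) lu(2,1)] lulg lug(2,1)] by blast
  \<comment> \<open>Two factorisations of one arrow through a cartesian lift agree, so the arrow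
    given by \<open>factor\<close> is the comparison isomorphism and inherits its inverse.\<close>
  have "i = reindex_comp B p u g a"
    using cartesian_cancel[OF lug(2,1) _ 1] vertical_isoD(1)[OF ij(1)] lg(4) ij(2) 2 by simp
  then show "\<exists>j. vertical_iso (re g (re u a)) (re (u \<cdot>\<^bsub>B\<^esub> g) a) (reindex_comp B p u g a) j"
    using ij by blast
qed

text \<open>The composite with the two lifts pins down the canonical isomorphism; this equation is
  the coherence that the Beck-Chevalley map calls for.\<close>

lemma reindex_square:
  assumes f: "f \<in> Arr B" and v: "v \<in> Arr B" "Cod B v = Cod B f"
    and u: "u \<in> Arr B" "Cod B u = Dom B f" and g: "g \<in> Arr B" "Cod B g = Dom B v" "Dom B g = Dom B u"
    and sq: "f \<cdot>\<^bsub>B\<^esub> u = v \<cdot>\<^bsub>B\<^esub> g" and a: "a \<in> Obj (Tot p)" "ob a = Cod B f"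
  shows "reindex_square B p f v u g a \<in> hom_over p (Id B (Dom B u)) (re g (re v a)) (re u (re f a))"
    "Lift p f a \<bullet> (Lift p u (re f a) \<bullet> reindex_square B p f v u g a) = Lift p v a \<bullet> Lift p g (re v a)"
proof -
  have av: "ob a = Cod B v" using a v by simp
  note fu = reindex_comp[OF f u a] and vg = reindex_comp[OF v(1) g(1,2) a(1) av]
  note lf = lift[OF f a]
  have af: "ob (re f a) = Cod B u" using lf u by simp
  note lu = lift[OF u(1) lf(3) af]
  have fu': "f \<cdot>\<^bsub>B\<^esub> u \<in> Arr B" "ob a = Cod B (f \<cdot>\<^bsub>B\<^esub> u)" using f u a by simp_all
  note lfu = lift[OF fu'(1) a(1) fu'(2)]
  obtain j where "vertical_iso (re u (re f a)) (re (f \<cdot>\<^bsub>B\<^esub> u) a) (reindex_comp B p f u a) j"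
    using fu(3) by blast
  then have "is_iso (Tot p) (reindex_comp B p f u a)" by (rule vertical_iso_is_iso)
  then have iso: "is_iso (fibre B p (Dom B u)) (reindex_comp B p f u a)"
    using is_iso_fibre_iff[OF fu(1)] vg(1) hom_over_base[OF fu(1)] u by simp
  have "category (fibre B p (Dom B u))" using category_fibre u by simp
  from category.inv_arrow[OF this iso] have inv: "inverse_arrows (fibre B p (Dom B u)) (reindex_comp B p f u a)
      (inv_arrow (fibre B p (Dom B u)) (reindex_comp B p f u a))" (is "inverse_arrows _ _ ?i") .
  have i: "?i \<in> hom_over p (Id B (Dom B u)) (re (f \<cdot>\<^bsub>B\<^esub> u) a) (re u (re f a))"
    "reindex_comp B p f u a \<bullet> ?i = Id (Tot p) (re (f \<cdot>\<^bsub>B\<^esub> u) a)"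
    using inv hom_overD[OF fu(1)] by (auto simp: inverse_arrows_def hom_fibre)
  have vg1: "reindex_comp B p v g a \<in> hom_over p (Id B (Dom B u)) (re g (re v a)) (re (f \<cdot>\<^bsub>B\<^esub> u) a)"
    using vg(1) g sq by simp
  show s: "reindex_square B p f v u g a \<in> hom_over p (Id B (Dom B u)) (re g (re v a)) (re u (re f a))"
    unfolding reindex_square_def using comp_vertical[OF vg1 i(1)] u by simp
  have "Lift p f a \<bullet> (Lift p u (re f a) \<bullet> reindex_square B p f v u g a) =
    (Lift p (f \<cdot>\<^bsub>B\<^esub> u) a \<bullet> reindex_comp B p f u a) \<bullet> reindex_square B p f v u g a"
    unfolding fu(2) by (rule hom_over_assoc[OF s lu(1) lf(1), symmetric])
  also have "\<dots> = Lift p (f \<cdot>\<^bsub>B\<^esub> u) a \<bullet> (reindex_comp B p f u a \<bullet> (?i \<bullet> reindex_comp B p v g a))"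
    unfolding reindex_square_def[symmetric] by (rule hom_over_assoc[OF s fu(1) lfu(1)])
  also have "reindex_comp B p f u a \<bullet> (?i \<bullet> reindex_comp B p v g a) = reindex_comp B p v g a"
    using hom_over_assoc[OF vg1 i(1) fu(1)] i(2) hom_over_id[OF vg1] by simp
  also have "Lift p (f \<cdot>\<^bsub>B\<^esub> u) a \<bullet> reindex_comp B p v g a = Lift p v a \<bullet> Lift p g (re v a)"
    using vg(2) sq by simp
  finally show "Lift p f a \<bullet> (Lift p u (re f a) \<bullet> reindex_square B p f v u g a) = Lift p v a \<bullet> Lift p g (re v a)" .
qed

text \<open>The identification of a double reindexing with the object itself dissolves on composing
  with lifts, leaving the injection after the lift of \<open>g\<close>. The splitting equation
  thereby becomes \<open>h = inj u b \<bullet> m\<close> with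
  \<open>m = Lift p g b \<bullet> k\<close>.\<close>

lemma reindex_section:
  assumes u: "u \<in> F" and g: "g \<in> hom B (Cod B u) (Dom B u)"
    and b: "b \<in> Obj (Tot p)" "ob b = Dom B u" and k: "k \<in> hom_over p (Id B (Cod B u)) a (re g b)"
  shows "(reindex_section B p u g (co u b) \<bullet> AMap (reindex B p g) (Unit C u b)) \<bullet> k
    = inj u b \<bullet> (Lift p g b \<bullet> k)"
proof -
  note u' = display_base[OF u]
  have g': "g \<in> Arr B" "Cod B g = Dom B u" "Dom B g = Cod B u" using g by (auto simp: hom_def)
  note cb = co_obj[OF u b] and n = unit[OF u b] and i = inj[OF u b]
  note lu = lift[OF u'(1) cb]
  have gb: "ob b = Cod B g" and gub: "ob (re u (co u b)) = Cod B g" using b g' lu by simp_all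
  note lg = lift[OF g'(1) b(1) gb] and lgu = lift[OF g'(1) lu(3) gub]
  have n': "Unit C u b \<in> hom_over p (Id B (Cod B g)) b (re u (co u b))" using n g' by simp
  note Rn = reindex_arr[OF g'(1) n']
  have "reindex_section B p u g (co u b) \<bullet> AMap (reindex B p g) (Unit C u b)
     = (Lift p u (co u b) \<bullet> Lift p g (re u (co u b))) \<bullet> AMap (reindex B p g) (Unit C u b)"
    unfolding reindex_section_def reindex_comp(2)[OF u'(1) g'(1,2) cb] by simp
  also have "\<dots> = Lift p u (co u b) \<bullet> (Unit C u b \<bullet> Lift p g b)"
    using hom_over_assoc[OF Rn(1) lgu(1) lu(1)] Rn(2) by simp
  also have "\<dots> = inj u b \<bullet> Lift p g b"
    unfolding inj_def[OF u] by (rule hom_over_assoc[OF lg(1) n lu(1), symmetric])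
  finally show ?thesis using hom_over_assoc[OF k lg(1) i] by simp
qed

text \<open>The bijection sends \<open>(g, k)\<close> to \<open>Lift p g b \<bullet> k\<close>;
  conversely \<open>m\<close> determines \<open>g\<close> as its base and \<open>k\<close> by
  cartesian factorisation. That \<open>g\<close> is a section is not asked of \<open>m\<close>: it
  is the projection of \<open>inj u b \<bullet> m = h\<close>, since \<open>h\<close> is
  vertical.\<close>

lemma quantifier_splitting_iff:
  "quantifier_splitting B F p C a \<longleftrightarrow> a \<in> Obj (Tot p) \<and>
     (\<forall>u\<in>F. \<forall>b\<in>Obj (Tot p). \<forall>h. Cod B u = ob a \<and> ob b = Dom B u \<and>
        h \<in> hom_over p (Id B (ob a)) a (co u b) \<longrightarrow>
        (\<exists>!m. m \<in> hom (Tot p) a b \<and> inj u b \<bullet> m = h))"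
proof -
  have "(\<exists>!gk. case gk of (g, k) \<Rightarrow>
            g \<in> hom B (Cod B u) (Dom B u) \<and> u \<cdot>\<^bsub>B\<^esub> g = Id B (Cod B u) \<and>
            k \<in> hom (fibre B p (Cod B u)) a (re g b) \<and>
            h = (reindex_section B p u g (co u b) \<bullet> AMap (reindex B p g) (Unit C u b)) \<bullet> k)
     \<longleftrightarrow> (\<exists>!m. m \<in> hom (Tot p) a b \<and> inj u b \<bullet> m = h)" (is "?L = ?R")
    if u: "u \<in> F" "Cod B u = ob a" and b: "b \<in> Obj (Tot p)" "ob b = Dom B u"
      and h: "h \<in> hom_over p (Id B (ob a)) a (co u b)" for u b h
  proof -
    note i = inj[OF u(1) b] and u' = display_base[OF u(1)]
    define S where "S gk \<longleftrightarrow> (case gk of (g, k) \<Rightarrow>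
      g \<in> hom B (Cod B u) (Dom B u) \<and> u \<cdot>\<^bsub>B\<^esub> g = Id B (Cod B u) \<and>
      k \<in> hom (fibre B p (Cod B u)) a (re g b) \<and>
      h = (reindex_section B p u g (co u b) \<bullet> AMap (reindex B p g) (Unit C u b)) \<bullet> k)" for gk
    define M where "M m \<longleftrightarrow> m \<in> hom (Tot p) a b \<and> inj u b \<bullet> m = h" for m
    have S_iff: "S (g, k) \<longleftrightarrow> g \<in> hom B (Cod B u) (Dom B u) \<and> u \<cdot>\<^bsub>B\<^esub> g = Id B (Cod B u) \<and>
      k \<in> hom_over p (Id B (Cod B u)) a (re g b) \<and>
      h = (reindex_section B p u g (co u b) \<bullet> AMap (reindex B p g) (Unit C u b)) \<bullet> k" for g k
      by (simp add: S_def hom_fibre)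
    have l: "Lift p g b \<in> hom_over p g (re g b) b" "cartesian B p (Lift p g b)" "ob (re g b) = Cod B u"
      if "g \<in> hom B (Cod B u) (Dom B u)" for g
      using lift[of g b] that b by (auto simp: hom_def)
    have SM: "M (Lift p g b \<bullet> k) \<and> AMap (Prj p) (Lift p g b \<bullet> k) = g" if S: "S (g, k)" for g k
    proof -
      have g: "g \<in> hom B (Cod B u) (Dom B u)" and k: "k \<in> hom_over p (Id B (Cod B u)) a (re g b)"
        using S by (simp_all add: S_iff)
      have "Lift p g b \<bullet> k \<in> hom_over p g a b" using vertical_comp[OF k l(1)[OF g]] u' by simp
      then show ?thesis using S reindex_section[OF u(1) g b k] by (simp add: hom_over_def S_iff M_def)
    qed
    have MS: "\<exists>k. S (AMap (Prj p) m, k) \<and> Lift p (AMap (Prj p) m) b \<bullet> k = m" if M: "M m" for m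
    proof -
      define g where "g = AMap (Prj p) m"
      have m: "m \<in> hom_over p g a b" using M by (simp add: hom_over_def g_def M_def)
      have g: "g \<in> hom B (Cod B u) (Dom B u)" using hom_over_base[OF m] u b by (simp add: hom_def)
      have "u \<cdot>\<^bsub>B\<^esub> g = AMap (Prj p) (inj u b \<bullet> m)" using hom_over_comp[OF m i] by (simp add: hom_over_def)
      also have "\<dots> = Id B (Cod B u)" using M h u by (simp add: hom_over_def M_def)
      finally have ug: "u \<cdot>\<^bsub>B\<^esub> g = Id B (Cod B u)" .
      have "\<exists>!k. k \<in> hom_over p (Id B (Cod B u)) a (re g b) \<and> Lift p g b \<bullet> k = m"
        using cartesian_unique_factor[OF l(2,1)[OF g], of m "Id B (Cod B u)" a] m g u u' l(3)[OF g]
        by (simp add: hom_def)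
      then obtain k where k: "k \<in> hom_over p (Id B (Cod B u)) a (re g b)" "Lift p g b \<bullet> k = m" by blast
      then have "S (g, k)"
        using reindex_section[OF u(1) g b k(1)] g ug M k by (simp add: S_iff M_def)
      then show ?thesis using k unfolding g_def by blast
    qed
    have "(\<exists>!gk. S gk) \<longleftrightarrow> (\<exists>!m. M m)"
    proof
      assume ex: "\<exists>!gk. S gk"
      then obtain g k where S: "S (g, k)" by (metis surj_pair)
      show "\<exists>!m. M m"
      proof (rule ex1I)
        show "M (Lift p g b \<bullet> k)" using SM[OF S] by blast
        fix m assume "M m"
        then obtain k' where k': "S (AMap (Prj p) m, k')" "Lift p (AMap (Prj p) m) b \<bullet> k' = m"
          using MS by blast
        have "(AMap (Prj p) m, k') = (g, k)" using ex S k'(1) by blast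
        then show "m = Lift p g b \<bullet> k" using k'(2) by simp
      qed
    next
      assume ex: "\<exists>!m. M m"
      then obtain m where M: "M m" by blast
      then obtain k where k: "S (AMap (Prj p) m, k)" "Lift p (AMap (Prj p) m) b \<bullet> k = m"
        using MS by blast
      show "\<exists>!gk. S gk"
      proof (rule ex1I[of S, OF k(1)])
        fix gk assume S: "S gk"
        obtain g k' where gk: "gk = (g, k')" by (cases gk)
        have S': "S (g, k')" using S gk by simp
        have eq: "Lift p g b \<bullet> k' = m" using SM[OF S'] ex M by blast
        then have g: "g = AMap (Prj p) m" using SM[OF S'] by simp
        have "g \<in> hom B (Cod B u) (Dom B u)" "k' \<in> hom_over p (Id B (Cod B u)) a (re g b)"
          "k \<in> hom_over p (Id B (Cod B u)) a (re g b)"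
          using S' k(1) g by (simp_all add: S_iff)
        then have "k' = k"
          using cartesian_cancel[OF l(2,1)] eq k(2) g by metis
        then show "gk = (AMap (Prj p) m, k)" using gk g by simp
      qed
    qed
    then show ?thesis unfolding S_def M_def .
  qed
  note * = this
  \<comment> \<open>Stated for arbitrary predicates \<open>X\<close> and \<open>Y\<close>, so that
    the two quantifier prefixes are matched without opening the bodies.\<close>
  have reformulate: "(\<forall>u\<in>F. Cod B u = ob a \<longrightarrow> (\<forall>b\<in>Obj (fibre B p (Dom B u)).
      \<forall>h\<in>hom (fibre B p (Cod B u)) a (co u b). X u b h))
    \<longleftrightarrow> (\<forall>u\<in>F. \<forall>b\<in>Obj (Tot p). \<forall>h. Cod B u = ob a \<and> ob b = Dom B u \<and>
        h \<in> hom_over p (Id B (ob a)) a (co u b) \<longrightarrow> Y u b h)"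
    if "\<And>u b h. u \<in> F \<Longrightarrow> Cod B u = ob a \<Longrightarrow> b \<in> Obj (Tot p) \<Longrightarrow> ob b = Dom B u
      \<Longrightarrow> h \<in> hom_over p (Id B (ob a)) a (co u b) \<Longrightarrow> X u b h \<longleftrightarrow> Y u b h"
    for X Y :: "'c \<Rightarrow> 'e \<Rightarrow> 'f \<Rightarrow> bool"
    using that by (auto simp: Obj_fibre hom_fibre)
  show ?thesis
    unfolding quantifier_splitting_def by (intro conj_cong refl reformulate *)
qed

text \<open>Identifies the Beck-Chevalley map by its effect on injections: restricted along the
  injection at \<open>re g b\<close> and followed by the lift of \<open>f\<close>, it is the lift of
  \<open>g\<close> followed by the injection at \<open>b\<close>. This equation stands in for the
  mate from here on.\<close>

lemma beck_chevalley:
  assumes v: "v \<in> F" and u: "u \<in> F" and pb: "is_pullback B f v u g"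
    and b: "b \<in> Obj (Tot p)" "ob b = Dom B v"
  obtains i j where "vertical_iso (co u (re g b)) (re f (co v b)) i j"
    "Lift p f (co v b) \<bullet> (i \<bullet> inj u (re g b)) = inj v b \<bullet> Lift p g b"
proof -
  have f: "f \<in> Arr B" "Cod B v = Cod B f" "Cod B u = Dom B f" and g: "g \<in> Arr B" "Cod B g = Dom B v" "Dom B g = Dom B u"
    and sq: "f \<cdot>\<^bsub>B\<^esub> u = v \<cdot>\<^bsub>B\<^esub> g"
    using pb unfolding is_pullback_def by (auto simp: hom_def)
  note u' = display_base[OF u] and v' = display_base[OF v]
  note cb = co_obj[OF v b] and n = unit[OF v b] and iv = inj[OF v b]
  have cf: "ob (co v b) = Cod B f" using cb f by simp
  note lf = lift[OF f(1) cb(1) cf] and lv = lift[OF v'(1) cb]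
  have bg: "ob b = Cod B g" "ob (re v (co v b)) = Cod B g" using b g lv by simp_all
  note lg = lift[OF g(1) b(1) bg(1)] and lgv = lift[OF g(1) lv(3) bg(2)]
  have fu: "ob (re f (co v b)) = Cod B u" using lf f by simp
  note lu = lift[OF u'(1) lf(3) fu]
  have n': "Unit C v b \<in> hom_over p (Id B (Cod B g)) b (re v (co v b))" using n g by simp
  note Rn = reindex_arr[OF g(1) n']
  have Rn1: "AMap (reindex B p g) (Unit C v b) \<in> hom_over p (Id B (Dom B u)) (re g b) (re g (re v (co v b)))"
    using Rn(1) g by simp
  note s = reindex_square[OF f(1) v'(1) f(2) u'(1) f(3) g sq cb(1) cf]
  let ?s = "reindex_square B p f v u g (co v b)"
  let ?Rn = "AMap (reindex B p g) (Unit C v b)"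
  let ?bc = "beck_chevalley_map B p C f v u g b"
  have sR: "?s \<bullet> ?Rn \<in> hom_over p (Id B (Dom B u)) (re g b) (re u (re f (co v b)))"
    using comp_vertical[OF Rn1 s(1)] u' by simp
  note t = transpose[OF u sR lf(3) fu]
  \<comment> \<open>Functoriality of the coproduct merges the last two factors, which exhibits the
    map as the transpose of a single arrow.\<close>
  have bc: "?bc = Counit C u (re f (co v b)) \<bullet> AMap (Coprod C u) (?s \<bullet> ?Rn)"
    unfolding beck_chevalley_map_def co_comp[OF u Rn1 s(1)] ..
  have "Lift p f (co v b) \<bullet> (?bc \<bullet> inj u (re g b))
      = Lift p f (co v b) \<bullet> (Lift p u (re f (co v b)) \<bullet> (?s \<bullet> ?Rn))"
    unfolding bc t(2) ..
  also have "\<dots> = (Lift p f (co v b) \<bullet> (Lift p u (re f (co v b)) \<bullet> ?s)) \<bullet> ?Rn"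
    using hom_over_assoc[OF Rn1 s(1) lu(1)] hom_over_assoc[OF Rn1 hom_over_comp[OF s(1) lu(1)] lf(1)] by simp
  also have "\<dots> = Lift p v (co v b) \<bullet> (Unit C v b \<bullet> Lift p g b)"
    unfolding s(2) using hom_over_assoc[OF Rn(1) lgv(1) lv(1)] Rn(2) by simp
  also have "\<dots> = inj v b \<bullet> Lift p g b"
    unfolding inj_def[OF v] by (rule hom_over_assoc[OF lg(1) n lv(1), symmetric])
  finally have eq: "Lift p f (co v b) \<bullet> (?bc \<bullet> inj u (re g b)) = inj v b \<bullet> Lift p g b" .
  have "is_iso (fibre B p (Dom B f)) ?bc"
    using coproducts v u pb b unfolding has_coproducts_def by (simp add: Obj_fibre)
  moreover have gb: "re g b \<in> Obj (Tot p)" "ob (re g b) = Dom B u" using lg g by simp_all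
  have bc': "?bc \<in> hom_over p (Id B (ob (co u (re g b)))) (co u (re g b)) (re f (co v b))"
    using t(1) bc co_obj[OF u gb] by simp
  ultimately have "is_iso (Tot p) ?bc" using is_iso_fibre_iff[OF bc'] co_obj[OF u gb] f by simp
  then obtain j where "vertical_iso (co u (re g b)) (re f (co v b)) ?bc j"
    using is_iso_vertical_iso bc' by blast
  then show thesis using eq by (rule that)
qed

text \<open>Beck--Chevalley turns an arrow \<open>a \<rightarrow> \<Coprod>\<^sub>v b\<close> over an arbitrary \<open>f\<close> into a vertical one
  \<open>a \<rightarrow> \<Coprod>\<^sub>u g\<^sup>*b\<close> along the pullback \<open>u\<close> of \<open>v\<close>, to which the splitting property applies.\<close>

lemma quantifier_splitting_lifts:
  assumes a: "quantifier_splitting B F p C a" and v: "v \<in> F"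
    and b: "b \<in> Obj (Tot p)" "ob b = Dom B v" and h: "h \<in> hom (Tot p) a (co v b)"
  shows "\<exists>!m. m \<in> hom (Tot p) a b \<and> inj v b \<bullet> m = h"
proof -
  define f where "f = AMap (Prj p) h"
  have hf: "h \<in> hom_over p f a (co v b)" using h by (simp add: hom_over_def f_def)
  note v' = display_base[OF v] and cb = co_obj[OF v b] and iv = inj[OF v b]
  have f: "f \<in> Arr B" "Dom B f = ob a" "Cod B f = Cod B v" and a': "a \<in> Obj (Tot p)"
    using hom_over_base[OF hf] cb by auto
  obtain u g where pb: "is_pullback B f v u g" using display.pullback_exists[OF v f(1,3)] by blast
  have u: "u \<in> F" by (rule display.pullback_display[OF v pb])
  have u': "u \<in> Arr B" "Cod B u = ob a" and g: "g \<in> Arr B" "Cod B g = Dom B v" "Dom B g = Dom B u"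
    and sq: "f \<cdot>\<^bsub>B\<^esub> u = v \<cdot>\<^bsub>B\<^esub> g"
    using pb display_base[OF u] f unfolding is_pullback_def by (auto simp: hom_def)
  have univ: "\<exists>k. k \<in> hom B Z (Dom B u) \<and> u \<cdot>\<^bsub>B\<^esub> k = x \<and> g \<cdot>\<^bsub>B\<^esub> k = y"
    if "Z \<in> Obj B" "x \<in> hom B Z (Dom B f)" "y \<in> hom B Z (Dom B v)" "f \<cdot>\<^bsub>B\<^esub> x = v \<cdot>\<^bsub>B\<^esub> y" for Z x y
    using pb that unfolding is_pullback_def by blast
  obtain i j where ij: "vertical_iso (co u (re g b)) (re f (co v b)) i j"
    and i: "Lift p f (co v b) \<bullet> (i \<bullet> inj u (re g b)) = inj v b \<bullet> Lift p g b"
    using beck_chevalley[OF v u pb b] by blast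
  have cf: "ob (co v b) = Cod B f" using cb f by simp
  note lf = lift[OF f(1) cb(1) cf]
  have bg: "ob b = Cod B g" using b g by simp
  note lg = lift[OF g(1) b(1) bg]
  have gb: "re g b \<in> Obj (Tot p)" "ob (re g b) = Dom B u" using lg g by simp_all
  note iu = inj[OF u gb] and cu = co_obj[OF u gb]
  have V: "i \<in> hom_over p (Id B (ob a)) (co u (re g b)) (re f (co v b))"
    "j \<in> hom_over p (Id B (ob a)) (re f (co v b)) (co u (re g b))"
    using vertical_isoD(1,2)[OF ij] cu u' by simp_all
  have aB: "ob a \<in> Obj B" using a' by simp
  have "\<exists>!k. k \<in> hom_over p (Id B (ob a)) a (re f (co v b)) \<and> Lift p f (co v b) \<bullet> k = h"
    using cartesian_unique_factor[OF lf(2,1), of h "Id B (ob a)" a] hf f lf(4) aB by (simp add: hom_def)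
  then obtain h' where h': "h' \<in> hom_over p (Id B (ob a)) a (re f (co v b))" "Lift p f (co v b) \<bullet> h' = h"
    by blast
  have jh: "j \<bullet> h' \<in> hom_over p (Id B (ob a)) a (co u (re g b))" by (rule comp_vertical[OF h'(1) V(2) aB])
  have ex: "\<exists>!m. m \<in> hom (Tot p) a (re g b) \<and> inj u (re g b) \<bullet> m = j \<bullet> h'"
    using a u u'(2) gb jh unfolding quantifier_splitting_iff by blast
  \<comment> \<open>Translates between the two lifting problems. Read forwards, it turns the
    solution for the vertical arrow into one for \<open>h\<close>; read backwards, it shows that a
    competitor comes from the vertical problem.\<close>
  have key: "inj v b \<bullet> (Lift p g b \<bullet> m) = Lift p f (co v b) \<bullet> (i \<bullet> (inj u (re g b) \<bullet> m))"
    if "m \<in> hom (Tot p) a (re g b)" for m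
  proof -
    have m: "m \<in> hom_over p (AMap (Prj p) m) a (re g b)" using that by (simp add: hom_over_def)
    have "inj v b \<bullet> (Lift p g b \<bullet> m) = (Lift p f (co v b) \<bullet> (i \<bullet> inj u (re g b))) \<bullet> m"
      unfolding i by (rule hom_over_assoc[OF m lg(1) iv, symmetric])
    also have "\<dots> = Lift p f (co v b) \<bullet> ((i \<bullet> inj u (re g b)) \<bullet> m)"
      by (rule hom_over_assoc[OF m hom_over_comp[OF iu V(1)] lf(1)])
    also have "(i \<bullet> inj u (re g b)) \<bullet> m = i \<bullet> (inj u (re g b) \<bullet> m)"
      by (rule hom_over_assoc[OF m iu V(1)])
    finally show ?thesis .
  qed
  obtain m where m: "m \<in> hom (Tot p) a (re g b)" "inj u (re g b) \<bullet> m = j \<bullet> h'" using ex by blast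
  have "i \<bullet> (j \<bullet> h') = h'"
    by (rule vertical_iso_cancel(2)[OF vertical_iso_sym[OF ij] h'(1)])
  then have "inj v b \<bullet> (Lift p g b \<bullet> m) = h" using key[OF m(1)] m(2) h'(2) by simp
  moreover have "Lift p g b \<bullet> m \<in> hom (Tot p) a b" using m(1) lg(1) by (simp add: hom_def hom_over_iff)
  moreover have "n = Lift p g b \<bullet> m" if n: "n \<in> hom (Tot p) a b" "inj v b \<bullet> n = h" for n
  proof -
    define x where "x = AMap (Prj p) n"
    have nx: "n \<in> hom_over p x a b" using n by (simp add: hom_over_def x_def)
    have x: "x \<in> hom B (ob a) (Dom B v)" using hom_over_base[OF nx] b by (simp add: hom_def)
    have "v \<cdot>\<^bsub>B\<^esub> x = f" using hom_overD(4)[OF hom_over_comp[OF nx iv]] n hom_overD(4)[OF hf] by simp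
    \<comment> \<open>Since \<open>v\<close> after \<open>x\<close> is \<open>f\<close>, the
      identity and \<open>x\<close> form a cone over the pullback. The induced section
      \<open>k\<close> of \<open>u\<close> is the base over which the competitor \<open>n\<close>
      factors through the lift of \<open>g\<close>.\<close>
    then obtain k where k: "k \<in> hom B (ob a) (Dom B u)" "u \<cdot>\<^bsub>B\<^esub> k = Id B (ob a)" "g \<cdot>\<^bsub>B\<^esub> k = x"
      using univ[OF aB _ x, of "Id B (ob a)"] f aB by (auto simp: hom_def)
    obtain m' where m': "m' \<in> hom_over p k a (re g b)" "Lift p g b \<bullet> m' = n"
      using cartesian_unique_factor[OF lg(2,1), of n k a] nx k gb by auto
    have m'h: "m' \<in> hom (Tot p) a (re g b)" using m' by (simp add: hom_over_def)
    have ium: "inj u (re g b) \<bullet> m' \<in> hom_over p (Id B (ob a)) a (co u (re g b))"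
      using hom_over_comp[OF m'(1) iu] k by simp
    have "i \<bullet> (inj u (re g b) \<bullet> m') = h'"
    proof (rule cartesian_cancel[OF lf(2,1) _ h'(1)])
      show "i \<bullet> (inj u (re g b) \<bullet> m') \<in> hom_over p (Id B (ob a)) a (re f (co v b))"
        by (rule comp_vertical[OF ium V(1) aB])
      show "Lift p f (co v b) \<bullet> (i \<bullet> (inj u (re g b) \<bullet> m')) = Lift p f (co v b) \<bullet> h'"
        using key[OF m'h] m'(2) n(2) h'(2) by simp
    qed
    then have "inj u (re g b) \<bullet> m' = j \<bullet> h'"
      using vertical_iso_cancel(2)[OF ij ium] by simp
    then have "m' = m" using ex m m'h by blast
    then show ?thesis using m' by simp
  qed
  ultimately show ?thesis by blast
qed

lemma inj_universal:
  assumes k: "opcartesian B p k" "k \<in> hom_over p v b y" and v: "v \<in> F"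
  obtains i j where "vertical_iso (co v b) y i j" "i \<bullet> inj v b = k" "j \<bullet> k = inj v b"
proof -
  have b: "b \<in> Obj (Tot p)" "ob b = Dom B v" using hom_over_base[OF k(2)] by auto
  show ?thesis using opcartesian_unique[OF inj_opcartesian[OF v b] inj[OF v b] k] that by blast
qed

text \<open>From left to right the injections serve as the test arrows; from right to left they are
  particular opcartesian arrows over display maps.\<close>

lemma quantifier_splitting_op_projective:
  "quantifier_splitting B F p C a \<longleftrightarrow> op_projective B F p a"
proof
  assume a: "quantifier_splitting B F p C a"
  show "op_projective B F p a"
  proof (rule op_projectiveI)
    show "a \<in> Obj (Tot p)" using a by (simp add: quantifier_splitting_def)
    fix v b assume v: "v \<in> F" and b: "b \<in> Obj (Tot p)" "ob b = Dom B v"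
    then show "\<exists>l y. opcartesian B p l \<and> l \<in> hom_over p v b y \<and>
        (\<forall>h\<in>hom (Tot p) a y. \<exists>!m. m \<in> hom (Tot p) a b \<and> l \<bullet> m = h)"
      using inj[OF v b] inj_opcartesian[OF v b] quantifier_splitting_lifts[OF a v b] by blast
  qed
next
  assume a: "op_projective B F p a"
  show "quantifier_splitting B F p C a"
    unfolding quantifier_splitting_iff
  proof (intro conjI ballI allI impI)
    show "a \<in> Obj (Tot p)" using a by (simp add: op_projective_def)
    fix u b h assume u: "u \<in> F" and b: "b \<in> Obj (Tot p)"
      and *: "Cod B u = ob a \<and> ob b = Dom B u \<and> h \<in> hom_over p (Id B (ob a)) a (co u b)"
    have b': "ob b = Dom B u" using * by simp
    note i = hom_overD[OF inj[OF u b b']]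
    have "h \<in> hom (Tot p) a (Cod (Tot p) (inj u b))" "AMap (Prj p) (inj u b) \<in> F"
      using * i u by (simp_all add: hom_over_def)
    with a inj_opcartesian[OF u b b']
    have "\<exists>!m. m \<in> hom (Tot p) a (Dom (Tot p) (inj u b)) \<and> inj u b \<bullet> m = h"
      unfolding op_projective_def by blast
    then show "\<exists>!m. m \<in> hom (Tot p) a b \<and> inj u b \<bullet> m = h" using i by simp
  qed
qed

text \<open>Cartesian arrows into \<open>a\<close> over the same base arrow have isomorphic sources,
  so ranging over all of them amounts to ranging over the chosen reindexings. This is the form that
  crosses an equivalence.\<close>

lemma quantifier_free_iff:
  "quantifier_free B F p C a \<longleftrightarrow> a \<in> Obj (Tot p) \<and>
     (\<forall>k x. cartesian B p k \<and> k \<in> hom_over p (AMap (Prj p) k) x a \<longrightarrow> op_projective B F p x)"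
proof
  assume a: "quantifier_free B F p C a"
  then have ao: "a \<in> Obj (Tot p)" by (simp add: quantifier_free_def)
  have "op_projective B F p x" if c: "cartesian B p k" and k: "k \<in> hom_over p f x a" for k x f
  proof -
    have f: "f \<in> Arr B" "ob a = Cod B f" using hom_over_base[OF k] by auto
    note l = lift[OF f(1) ao f(2)]
    have "op_projective B F p (re f a)"
      using a f unfolding quantifier_free_def quantifier_splitting_op_projective by simp
    moreover obtain i j where "vertical_iso x (re f a) i j" using cartesian_unique[OF c k l(2,1)] by blast
    ultimately show ?thesis using op_projective_iso by blast
  qed
  with ao show "a \<in> Obj (Tot p) \<and>
     (\<forall>k x. cartesian B p k \<and> k \<in> hom_over p (AMap (Prj p) k) x a \<longrightarrow> op_projective B F p x)" by blast
next
  assume a: "a \<in> Obj (Tot p) \<and>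
     (\<forall>k x. cartesian B p k \<and> k \<in> hom_over p (AMap (Prj p) k) x a \<longrightarrow> op_projective B F p x)"
  show "quantifier_free B F p C a"
    unfolding quantifier_free_def quantifier_splitting_op_projective
  proof (intro conjI ballI impI)
    show "a \<in> Obj (Tot p)" using a by simp
    fix f assume f: "f \<in> Arr B" "Cod B f = ob a"
    have "op_projective B F p x" if "cartesian B p k" "k \<in> hom_over p f x a" for k x
      using a that hom_overD(4)[OF that(2)] by blast
    then show "op_projective B F p (re f a)" using lift(1,2)[OF f(1), of a] f a by simp
  qed
qed

text \<open>Cartesian arrows compose. The consequence wanted is that the cleavage of
  \<open>p\<close> restricts to the quantifier-free objects.\<close>

lemma quantifier_free_reindex:
  assumes a: "quantifier_free B F p C a" and k: "cartesian B p k" "k \<in> hom_over p u x a"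
  shows "quantifier_free B F p C x"
  unfolding quantifier_free_iff
proof (intro conjI allI impI)
  show "x \<in> Obj (Tot p)" using hom_over_base[OF k(2)] by simp
  fix l y assume l: "cartesian B p l \<and> l \<in> hom_over p (AMap (Prj p) l) y x"
  then have kl: "k \<bullet> l \<in> hom_over p (u \<cdot>\<^bsub>B\<^esub> AMap (Prj p) l) y a" "cartesian B p (k \<bullet> l)"
    using k cartesian_comp by blast+
  then show "op_projective B F p y"
    using a hom_overD(4)[OF kl(1)] unfolding quantifier_free_iff by metis
qed

text \<open>The identity arrow is cartesian, so \<open>a\<close> itself is among the sources that
  \<open>quantifier_free_iff\<close> ranges over.\<close>

lemma quantifier_free_op_projective:
  assumes "quantifier_free B F p C a"
  shows "op_projective B F p a"
proof -
  have a: "a \<in> Obj (Tot p)" using assms by (simp add: quantifier_free_def)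
  have "vertical_iso a a (Id (Tot p) a) (Id (Tot p) a)"
    using id_vertical[OF a] a by (simp add: vertical_iso_def)
  note v = vertical_iso_cartesian[OF this] vertical_isoD(1)[OF this]
  show ?thesis using assms v hom_overD(4)[OF v(2)] unfolding quantifier_free_iff by metis
qed

end

section \<open>The coproduct completion\<close>

locale completion = over_category B q + display: display_map_category B F
  for B :: "('b, 'c) cat" and F :: "'c set" and q :: "('b, 'c, 'e, 'f, 'z) over_scheme"
begin

abbreviation "S \<equiv> coproduct_completion B F q"

lemma sigma_simps [simp]:
  "Obj (Tot S) = sigma_obj B F q" "Arr (Tot S) = sigma_arrows B F q"
  "Dom (Tot S) = Src" "Cod (Tot S) = Tgt"
  "Id (Tot S) x = SigmaArr x x (Id B (Cod B (fst x))) (Id B (Dom B (fst x))) (Id (Tot q) (snd x))"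
  "m \<cdot>\<^bsub>Tot S\<^esub> n = SigmaArr (Src n) (Tgt m) (Base m \<cdot>\<^bsub>B\<^esub> Base n) (Index m \<cdot>\<^bsub>B\<^esub> Index n)
                       (Family m \<cdot>\<^bsub>Tot q\<^esub> Family n)"
  "OMap (Prj S) x = Cod B (fst x)" "AMap (Prj S) = Base"
  by (simp_all add: coproduct_completion_def Sigma_cat_def)

lemma sigma_obj_iff:
  "x \<in> sigma_obj B F q \<longleftrightarrow> fst x \<in> F \<and> fst x \<in> Arr B \<and> snd x \<in> Obj (Tot q)
     \<and> OMap (Prj q) (snd x) = Dom B (fst x)"
  using display.display_arr by (auto simp: sigma_obj_def Obj_fibre split: prod.splits)

lemma sigma_arrows_iff:
  "m \<in> sigma_arrows B F q \<longleftrightarrow> Src m \<in> sigma_obj B F q \<and> Tgt m \<in> sigma_obj B F q \<and>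
     Base m \<in> hom B (Cod B (fst (Src m))) (Cod B (fst (Tgt m))) \<and>
     fst (Tgt m) \<cdot>\<^bsub>B\<^esub> Index m = Base m \<cdot>\<^bsub>B\<^esub> fst (Src m) \<and>
     Family m \<in> hom_over q (Index m) (snd (Src m)) (snd (Tgt m))" (is "_ \<longleftrightarrow> ?R m")
proof
  assume "m \<in> sigma_arrows B F q"
  then show "?R m" by (auto simp: sigma_arrows_def hom_over_def)
next
  assume R: "?R m"
  obtain g a h b f0 f1 \<phi> where m: "m = SigmaArr (g, a) (h, b) f0 f1 \<phi>"
    by (metis sigma_arr.exhaust surj_pair)
  have "f1 \<in> hom B (Dom B g) (Dom B h)"
    using R hom_over_base[of \<phi> f1 a b] unfolding m by (simp add: sigma_obj_iff hom_def)
  with R show "m \<in> sigma_arrows B F q"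
    unfolding m by (simp add: sigma_arrows_def hom_over_def)
qed

lemma sigma_hom_over_iff:
  "m \<in> hom_over S w x y \<longleftrightarrow> m = SigmaArr x y w (Index m) (Family m) \<and>
     x \<in> sigma_obj B F q \<and> y \<in> sigma_obj B F q \<and> w \<in> hom B (Cod B (fst x)) (Cod B (fst y)) \<and>
     fst y \<cdot>\<^bsub>B\<^esub> Index m = w \<cdot>\<^bsub>B\<^esub> fst x \<and> Family m \<in> hom_over q (Index m) (snd x) (snd y)"
  by (cases m) (auto simp: hom_over_iff[of _ S] sigma_arrows_iff)

lemma category_sigma: "category (Tot S)"
proof
  fix m assume m: "m \<in> Arr (Tot S)"
  then show "Dom (Tot S) m \<in> Obj (Tot S)" "Cod (Tot S) m \<in> Obj (Tot S)"
    by (simp_all add: sigma_arrows_iff)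
  have f: "Family m \<in> hom_over q (Index m) (snd (Src m)) (snd (Tgt m))"
    and b: "Base m \<in> hom B (Cod B (fst (Src m))) (Cod B (fst (Tgt m)))"
    and o: "Src m \<in> sigma_obj B F q" "Tgt m \<in> sigma_obj B F q"
    using m by (auto simp: sigma_arrows_iff)
  note f' = over_simps[OF f]
  show "Id (Tot S) (Cod (Tot S) m) \<cdot>\<^bsub>Tot S\<^esub> m = m"
    using f' b o by (cases m) (simp add: sigma_obj_iff hom_def)
  show "m \<cdot>\<^bsub>Tot S\<^esub> Id (Tot S) (Dom (Tot S) m) = m"
    using f' b o by (cases m) (simp add: sigma_obj_iff hom_def)
next
  fix x assume x: "x \<in> Obj (Tot S)"
  have "Id (Tot S) x \<in> hom_over S (Id B (Cod B (fst x))) x x"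
    unfolding sigma_hom_over_iff using x id_vertical[of "snd x"]
    by (simp add: sigma_obj_iff hom_def)
  then show "Id (Tot S) x \<in> hom (Tot S) x x" by (simp add: hom_over_def)
next
  fix m n x y z assume m: "m \<in> hom (Tot S) x y" and n: "n \<in> hom (Tot S) y z"
  have M: "m \<in> hom_over S (Base m) x y" and N: "n \<in> hom_over S (Base n) y z"
    using m n by (simp_all add: hom_over_def)
  have fm: "Family m \<in> hom_over q (Index m) (snd x) (snd y)"
    and fn: "Family n \<in> hom_over q (Index n) (snd y) (snd z)"
    using M N by (auto simp: sigma_hom_over_iff)
  note bm = hom_over_base[OF fm] and bn = hom_over_base[OF fn]
  have o: "x \<in> sigma_obj B F q" "y \<in> sigma_obj B F q" "z \<in> sigma_obj B F q"
    and b: "Base m \<in> hom B (Cod B (fst x)) (Cod B (fst y))" "Base n \<in> hom B (Cod B (fst y)) (Cod B (fst z))"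
    and sq: "fst y \<cdot>\<^bsub>B\<^esub> Index m = Base m \<cdot>\<^bsub>B\<^esub> fst x" "fst z \<cdot>\<^bsub>B\<^esub> Index n = Base n \<cdot>\<^bsub>B\<^esub> fst y"
    using M N by (auto simp: sigma_hom_over_iff)
  have st: "Src m = x" "Tgt n = z" using m n by (simp_all add: hom_def)
  \<comment> \<open>The square of the composite is the pasting of the squares of \<open>m\<close>
    and \<open>n\<close>.\<close>
  have "fst z \<cdot>\<^bsub>B\<^esub> (Index n \<cdot>\<^bsub>B\<^esub> Index m) = (fst z \<cdot>\<^bsub>B\<^esub> Index n) \<cdot>\<^bsub>B\<^esub> Index m"
    using bm bn o by (simp add: sigma_obj_iff)
  also have "\<dots> = Base n \<cdot>\<^bsub>B\<^esub> (fst y \<cdot>\<^bsub>B\<^esub> Index m)"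
    unfolding sq(2) using bm bn o b by (simp add: sigma_obj_iff hom_def)
  also have "\<dots> = (Base n \<cdot>\<^bsub>B\<^esub> Base m) \<cdot>\<^bsub>B\<^esub> fst x"
    unfolding sq(1) using bm bn o b by (simp add: sigma_obj_iff hom_def)
  finally have "n \<cdot>\<^bsub>Tot S\<^esub> m \<in> hom_over S (Base n \<cdot>\<^bsub>B\<^esub> Base m) x z"
    unfolding sigma_hom_over_iff using o b hom_over_comp[OF fm fn] st by (simp add: hom_def)
  then show "n \<cdot>\<^bsub>Tot S\<^esub> m \<in> hom (Tot S) x z" by (simp add: hom_over_def)
next
  fix l m n w x y z
  assume *: "l \<in> hom (Tot S) w x" "m \<in> hom (Tot S) x y" "n \<in> hom (Tot S) y z"
  have a: "Family l \<in> hom_over q (Index l) (snd w) (snd x)"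
    "Family m \<in> hom_over q (Index m) (snd x) (snd y)" "Family n \<in> hom_over q (Index n) (snd y) (snd z)"
    "Base l \<in> hom B (Cod B (fst w)) (Cod B (fst x))" "Base m \<in> hom B (Cod B (fst x)) (Cod B (fst y))"
    "Base n \<in> hom B (Cod B (fst y)) (Cod B (fst z))"
    using * by (auto simp: hom_def sigma_arrows_iff)
  show "(n \<cdot>\<^bsub>Tot S\<^esub> m) \<cdot>\<^bsub>Tot S\<^esub> l = n \<cdot>\<^bsub>Tot S\<^esub> (m \<cdot>\<^bsub>Tot S\<^esub> l)"
    using hom_over_assoc[OF a(1-3)] hom_over_base[OF a(1)] hom_over_base[OF a(2)] hom_over_base[OF a(3)]
      a(4-6) by (simp add: hom_def)
qed

lemma over_category_sigma: "over_category B S"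
proof (intro over_category.intro cat_functor.intro category_sigma target.category_axioms cat_functor_axioms.intro)
  show "OMap (Prj S) x \<in> Obj B" "AMap (Prj S) (Id (Tot S) x) = Id B (OMap (Prj S) x)" if "x \<in> Obj (Tot S)" for x
    using that by (simp_all add: sigma_obj_iff)
  show "AMap (Prj S) m \<in> hom B (OMap (Prj S) x) (OMap (Prj S) y)" if "m \<in> hom (Tot S) x y" for m x y
    using that by (auto simp: hom_def sigma_arrows_iff)
  show "AMap (Prj S) (n \<cdot>\<^bsub>Tot S\<^esub> m) = AMap (Prj S) n \<cdot>\<^bsub>B\<^esub> AMap (Prj S) m" for m n
    by simp
qed

sublocale sigma: over_category B S by (rule over_category_sigma)

text \<open>The coproduct injection of the completion. Its index and family are identities, so
  composing with it leaves the index and family of an arrow untouched, and factoring through it only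
  relabels source and base.\<close>

lemma sigma_opcartesian:
  assumes k: "k \<in> F" "k \<cdot>\<^bsub>B\<^esub> fst x \<in> F" and x: "x \<in> sigma_obj B F q" "Cod B (fst x) = Dom B k"
  shows "SigmaArr x (k \<cdot>\<^bsub>B\<^esub> fst x, snd x) k (Id B (Dom B (fst x))) (Id (Tot q) (snd x))
      \<in> hom_over S k x (k \<cdot>\<^bsub>B\<^esub> fst x, snd x)" (is "?k \<in> _")
    and "opcartesian B S (SigmaArr x (k \<cdot>\<^bsub>B\<^esub> fst x, snd x) k (Id B (Dom B (fst x))) (Id (Tot q) (snd x)))"
proof -
  let ?y = "(k \<cdot>\<^bsub>B\<^esub> fst x, snd x)"
  have ka: "k \<in> Arr B" using k display.display_arr by blast
  have xo: "fst x \<in> F" "fst x \<in> Arr B" "snd x \<in> Obj (Tot q)" "OMap (Prj q) (snd x) = Dom B (fst x)"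
    using x by (simp_all add: sigma_obj_iff)
  have y: "?y \<in> sigma_obj B F q" using k ka xo x by (simp add: sigma_obj_iff)
  show 1: "?k \<in> hom_over S k x ?y"
    unfolding sigma_hom_over_iff using x y ka xo id_vertical[OF xo(3)] by (simp add: hom_def)
  show "opcartesian B S ?k"
  proof (rule sigma.opcartesianI[OF 1])
    fix m z w
    assume m: "m \<in> hom_over S (w \<cdot>\<^bsub>B\<^esub> k) x z" and "w \<in> hom B (OMap (Prj S) ?y) (OMap (Prj S) z)"
    then have w: "w \<in> Arr B" "Dom B w = Cod B k" "Cod B w = Cod B (fst z)"
      using ka x xo by (auto simp: hom_def)
    have m': "m = SigmaArr x z (w \<cdot>\<^bsub>B\<^esub> k) (Index m) (Family m)" "z \<in> sigma_obj B F q"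
      "fst z \<cdot>\<^bsub>B\<^esub> Index m = (w \<cdot>\<^bsub>B\<^esub> k) \<cdot>\<^bsub>B\<^esub> fst x"
      and fm: "Family m \<in> hom_over q (Index m) (snd x) (snd z)"
      using m by (auto simp: sigma_hom_over_iff)
    note fb = over_simps[OF fm]
    let ?h = "SigmaArr ?y z w (Index m) (Family m)"
    have "?h \<in> hom_over S w ?y z"
      unfolding sigma_hom_over_iff using m' fm y w ka x xo by (simp add: hom_def)
    moreover have "?h \<cdot>\<^bsub>Tot S\<^esub> ?k = m"
      by (subst m'(1)) (use fb xo in simp)
    ultimately show "\<exists>h \<in> hom_over S w ?y z. h \<cdot>\<^bsub>Tot S\<^esub> ?k = m" by blast
  next
    fix z w h h'
    assume h: "h \<in> hom_over S w ?y z" and h': "h' \<in> hom_over S w ?y z"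
      and eq: "h \<cdot>\<^bsub>Tot S\<^esub> ?k = h' \<cdot>\<^bsub>Tot S\<^esub> ?k"
    have e: "h = SigmaArr ?y z w (Index h) (Family h)" "h' = SigmaArr ?y z w (Index h') (Family h')"
      and f: "Family h \<in> hom_over q (Index h) (snd x) (snd z)" "Family h' \<in> hom_over q (Index h') (snd x) (snd z)"
      using h h' unfolding sigma_hom_over_iff by auto
    have "Index h = Index h'" "Family h = Family h'"
      using eq over_simps[OF f(1)] over_simps[OF f(2)] xo by simp_all
    then show "h = h'" using e by metis
  qed
qed

section \<open>Objects indexed by an identity\<close>

definition unit_obj :: "'e \<Rightarrow> 'c \<times> 'e" where
  "unit_obj a = (Id B (OMap (Prj q) a), a)"

lemma unit_obj_in:
  "has_units B F \<Longrightarrow> a \<in> Obj (Tot q) \<Longrightarrow> unit_obj a \<in> sigma_obj B F q"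
proof -
  assume u: "has_units B F" and a: "a \<in> Obj (Tot q)"
  have "inverse_arrows B (Id B (OMap (Prj q) a)) (Id B (OMap (Prj q) a))"
    using a by (simp add: inverse_arrows_def hom_def)
  then have "Id B (OMap (Prj q) a) \<in> F" using u unfolding has_units_def is_iso_def by blast
  then show ?thesis using a by (simp add: unit_obj_def sigma_obj_iff)
qed

text \<open>An arrow out of an object indexed by an identity is determined by its index and family,
  since the square forces its base. Such arrows into \<open>(v g, \<alpha>)\<close> and into
  \<open>(g, \<alpha>)\<close> therefore correspond: index and family stay, and only the base
  changes.\<close>

lemma unit_obj_op_projective:
  assumes units: "has_units B F" and dep: "has_dependent_coproducts B F" and a: "a \<in> Obj (Tot q)"
  shows "op_projective B F S (unit_obj a)"
proof (rule sigma.op_projectiveI)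
  note ua = unit_obj_in[OF units a]
  show "unit_obj a \<in> Obj (Tot S)" using ua by simp
  fix v x assume v: "v \<in> F" and "x \<in> Obj (Tot S)" "OMap (Prj S) x = Dom B v"
  then have x: "x \<in> sigma_obj B F q" "Cod B (fst x) = Dom B v" by simp_all
  have xo: "fst x \<in> F" "fst x \<in> Arr B" "snd x \<in> Obj (Tot q)" "OMap (Prj q) (snd x) = Dom B (fst x)"
    using x by (simp_all add: sigma_obj_iff)
  have va: "v \<in> Arr B" using v display.display_arr by blast
  have vx: "v \<cdot>\<^bsub>B\<^esub> fst x \<in> F" using dep v xo x unfolding has_dependent_coproducts_def by simp
  note k = sigma_opcartesian[OF v vx x]
  let ?y = "(v \<cdot>\<^bsub>B\<^esub> fst x, snd x)"
  let ?k = "SigmaArr x ?y v (Id B (Dom B (fst x))) (Id (Tot q) (snd x))"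
  have "\<exists>!m. m \<in> hom (Tot S) (unit_obj a) x \<and> ?k \<cdot>\<^bsub>Tot S\<^esub> m = h" if h: "h \<in> hom (Tot S) (unit_obj a) ?y" for h
  proof -
    have "h \<in> hom_over S (Base h) (unit_obj a) ?y" using h by (simp add: hom_over_def)
    then have h': "h = SigmaArr (unit_obj a) ?y (Base h) (Index h) (Family h)"
      "Base h \<in> hom B (OMap (Prj q) a) (Cod B v)" "(v \<cdot>\<^bsub>B\<^esub> fst x) \<cdot>\<^bsub>B\<^esub> Index h = Base h"
      and f: "Family h \<in> hom_over q (Index h) a (snd x)"
      using a va x xo unfolding sigma_hom_over_iff by (auto simp: unit_obj_def hom_def)
    note fb = over_simps[OF f]
    \<comment> \<open>The base is the value forced by a square whose left side is an
      identity.\<close>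
    let ?m = "SigmaArr (unit_obj a) x (fst x \<cdot>\<^bsub>B\<^esub> Index h) (Index h) (Family h)"
    have "?m \<in> hom_over S (fst x \<cdot>\<^bsub>B\<^esub> Index h) (unit_obj a) x"
      unfolding sigma_hom_over_iff using ua x xo f fb a by (simp add: unit_obj_def hom_def)
    then have m: "?m \<in> hom (Tot S) (unit_obj a) x" by (simp add: hom_over_def)
    have km: "?k \<cdot>\<^bsub>Tot S\<^esub> ?m = h"
      by (subst h'(1)) (use h' fb xo x va in simp)
    show ?thesis
    proof (rule ex1I[of _ ?m], intro conjI m km)
      fix n assume n: "n \<in> hom (Tot S) (unit_obj a) x \<and> ?k \<cdot>\<^bsub>Tot S\<^esub> n = h"
      then have "n \<in> hom_over S (Base n) (unit_obj a) x" by (simp add: hom_over_def)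
      then have n': "n = SigmaArr (unit_obj a) x (Base n) (Index n) (Family n)"
        "fst x \<cdot>\<^bsub>B\<^esub> Index n = Base n" and fn: "Family n \<in> hom_over q (Index n) a (snd x)"
        using a unfolding sigma_hom_over_iff by (auto simp: unit_obj_def hom_def)
      have eq: "?k \<cdot>\<^bsub>Tot S\<^esub> n = h" using n by blast
      have "Index h = Index (?k \<cdot>\<^bsub>Tot S\<^esub> n)" "Family h = Family (?k \<cdot>\<^bsub>Tot S\<^esub> n)" unfolding eq by simp_all
      then have "Index h = Index n" "Family h = Family n" using over_simps[OF fn] xo by simp_all
      then show "n = ?m" using n' by simp
    qed
  qed
  with k show "\<exists>l y. opcartesian B S l \<and> l \<in> hom_over S v x y \<and>
      (\<forall>h\<in>hom (Tot S) (unit_obj a) y. \<exists>!m. m \<in> hom (Tot S) (unit_obj a) x \<and> l \<cdot>\<^bsub>Tot S\<^esub> m = h)"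
    by blast
qed

text \<open>Reindexing an object indexed by an identity yields another one, that of the reindexed
  object of \<open>q\<close>; this is the stability that quantifier-freeness demands. The identity
  on the right of the square makes the index of an arrow over \<open>u w\<close> equal to
  \<open>u\<close> after \<open>w\<close> after the indexing map of its source, so the family
  factors by cartesianness in \<open>q\<close>.\<close>

lemma unit_obj_cartesian:
  assumes units: "has_units B F" and k: "cartesian B q k" "k \<in> hom_over q u b a"
  shows "SigmaArr (unit_obj b) (unit_obj a) u u k \<in> hom_over S u (unit_obj b) (unit_obj a)" (is "?k \<in> _")
    and "cartesian B S (SigmaArr (unit_obj b) (unit_obj a) u u k)"
proof -
  note ub = over_simps[OF k(2)]
  note oa = unit_obj_in[OF units ub(9)] and ob = unit_obj_in[OF units ub(8)]
  show 1: "?k \<in> hom_over S u (unit_obj b) (unit_obj a)"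
    unfolding sigma_hom_over_iff using oa ob ub k by (simp add: unit_obj_def hom_def)
  show "cartesian B S ?k"
  proof (rule sigma.cartesianI[OF 1])
    fix m z w
    assume m: "m \<in> hom_over S (u \<cdot>\<^bsub>B\<^esub> w) z (unit_obj a)"
      and "w \<in> hom B (OMap (Prj S) z) (OMap (Prj S) (unit_obj b))"
    then have w: "w \<in> Arr B" "Dom B w = Cod B (fst z)" "Cod B w = Dom B u"
      using ub by (auto simp: hom_def unit_obj_def)
    have m': "m = SigmaArr z (unit_obj a) (u \<cdot>\<^bsub>B\<^esub> w) (Index m) (Family m)" "z \<in> sigma_obj B F q"
      "Id B (OMap (Prj q) a) \<cdot>\<^bsub>B\<^esub> Index m = (u \<cdot>\<^bsub>B\<^esub> w) \<cdot>\<^bsub>B\<^esub> fst z"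
      and fm: "Family m \<in> hom_over q (Index m) (snd z) a"
      using m unfolding sigma_hom_over_iff by (auto simp: unit_obj_def)
    have zo: "fst z \<in> F" "fst z \<in> Arr B" "snd z \<in> Obj (Tot q)" "OMap (Prj q) (snd z) = Dom B (fst z)"
      using m'(2) by (simp_all add: sigma_obj_iff)
    note fb = over_simps[OF fm]
    have I: "Index m = u \<cdot>\<^bsub>B\<^esub> (w \<cdot>\<^bsub>B\<^esub> fst z)" using m'(3) fb ub w zo by simp
    have wz: "w \<cdot>\<^bsub>B\<^esub> fst z \<in> hom B (OMap (Prj q) (snd z)) (OMap (Prj q) b)"
      using w zo ub by (simp add: hom_def)
    obtain h where h: "h \<in> hom_over q (w \<cdot>\<^bsub>B\<^esub> fst z) (snd z) b" "k \<cdot>\<^bsub>Tot q\<^esub> h = Family m"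
      using cartesian_unique_factor[OF k fm[unfolded I] wz] by blast
    let ?h = "SigmaArr z (unit_obj b) w (w \<cdot>\<^bsub>B\<^esub> fst z) h"
    have "?h \<in> hom_over S w z (unit_obj b)"
      unfolding sigma_hom_over_iff using m' h ob w zo ub by (simp add: hom_def unit_obj_def)
    moreover have "?k \<cdot>\<^bsub>Tot S\<^esub> ?h = m"
      by (subst m'(1)) (use I h in simp)
    ultimately show "\<exists>h \<in> hom_over S w z (unit_obj b). ?k \<cdot>\<^bsub>Tot S\<^esub> h = m" by blast
  next
    fix z w h h'
    assume h: "h \<in> hom_over S w z (unit_obj b)" and h': "h' \<in> hom_over S w z (unit_obj b)"
      and eq: "?k \<cdot>\<^bsub>Tot S\<^esub> h = ?k \<cdot>\<^bsub>Tot S\<^esub> h'"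
    have e: "h = SigmaArr z (unit_obj b) w (Index h) (Family h)" "h' = SigmaArr z (unit_obj b) w (Index h') (Family h')"
      and sq: "Id B (OMap (Prj q) b) \<cdot>\<^bsub>B\<^esub> Index h = w \<cdot>\<^bsub>B\<^esub> fst z" "Id B (OMap (Prj q) b) \<cdot>\<^bsub>B\<^esub> Index h' = w \<cdot>\<^bsub>B\<^esub> fst z"
      and f: "Family h \<in> hom_over q (Index h) (snd z) b" "Family h' \<in> hom_over q (Index h') (snd z) b"
      using h h' unfolding sigma_hom_over_iff by (auto simp: unit_obj_def)
    have I: "Index h' = Index h"
      using sq hom_over_base[OF f(1)] hom_over_base[OF f(2)] by simp
    have "k \<cdot>\<^bsub>Tot q\<^esub> Family h = k \<cdot>\<^bsub>Tot q\<^esub> Family h'" using eq by simp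
    then have "Family h = Family h'" using cartesian_cancel[OF k f(1)] f(2) I by simp
    then show "h = h'" using e I by metis
  qed
qed

end

section \<open>The characterisation\<close>

text \<open>The witness for \<open>a\<close> is found in the completion. If \<open>OMap H a\<close>
  is \<open>(g, c)\<close>, it is the target of an opcartesian arrow over \<open>g\<close> from the
  object of \<open>c\<close> indexed by an identity, and a preimage \<open>b\<close> of that object
  up to isomorphism is the quantifier-free one.\<close>

lemma (in coproduct_fibration) enough_quantifier_free_completion:
  fixes q :: "('b, 'c, 'x, 'y) cloven"
  assumes units: "has_units B F" and dep: "has_dependent_coproducts B F"
    and q: "cloven_fibration B q" and "fibred_equivalent B p (coproduct_completion B F q)"
  shows "enough_quantifier_free B F p C"
  unfolding enough_quantifier_free_def
proof (intro conjI ballI coproducts)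
  interpret S: completion B F q
    using q by (intro completion.intro display.display_map_category_axioms over_category.intro)
      (simp add: cloven_fibration_def)
  obtain H where equiv: "over_equivalence B p (coproduct_completion B F q) H"
    using assms(4) by (rule fibred_equivalentE)
  interpret H: over_equivalence B p "coproduct_completion B F q" H by (rule equiv)
  let ?S = "coproduct_completion B F q"
  fix I a assume "I \<in> Obj B" and "a \<in> Obj (fibre B p I)"
  then have a: "a \<in> Obj (Tot p)" "ob a = I" by (simp_all add: Obj_fibre)
  define x where "x = OMap H a"
  have x: "x \<in> sigma_obj B F q" "Cod B (fst x) = I" using H.H.map_obj[OF a(1)] H.over_obj[OF a(1)] a
    by (simp_all add: x_def)
  define g c where "g = fst x" and "c = snd x"
  have g: "g \<in> F" "g \<in> Arr B" and c: "c \<in> Obj (Tot q)" "OMap (Prj q) c = Dom B g" and gI: "Cod B g = I"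
    using x by (simp_all add: S.sigma_obj_iff g_def c_def)
  have u: "S.unit_obj c \<in> sigma_obj B F q" by (rule S.unit_obj_in[OF units c(1)])
  have uc: "Cod B (fst (S.unit_obj c)) = Dom B g" "(g \<cdot>\<^bsub>B\<^esub> fst (S.unit_obj c), snd (S.unit_obj c)) = x"
    "g \<cdot>\<^bsub>B\<^esub> fst (S.unit_obj c) \<in> F"
    using g c by (simp_all add: S.unit_obj_def g_def c_def)
  \<comment> \<open>Since \<open>g\<close> after the identity is \<open>g\<close>, the target of
    this injection is \<open>x\<close> itself and not merely an isomorphic copy.\<close>
  note k = S.sigma_opcartesian[OF g(1) uc(3) u uc(1), unfolded uc(2)]
  define k where "k = SigmaArr (S.unit_obj c) x g (Id B (Dom B (fst (S.unit_obj c)))) (Id (Tot q) (snd (S.unit_obj c)))"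
  note k = k[folded k_def]
  have "S.unit_obj c \<in> Obj (Tot ?S)" using u by simp
  from H.ess_surj[OF this] obtain b i j where b: "b \<in> Obj (Tot p)"
    and ij: "S.sigma.vertical_iso (OMap H b) (S.unit_obj c) i j" by blast
  note V = S.sigma.vertical_isoD[OF ij]
  have ki: "k \<cdot>\<^bsub>Tot ?S\<^esub> i \<in> hom_over ?S g (OMap H b) (OMap H a)"
    using S.sigma.vertical_comp[OF V(1) k(1) V(8)] by (simp only: x_def)
  obtain m where m: "m \<in> hom_over p g b a" "AMap H m = k \<cdot>\<^bsub>Tot ?S\<^esub> i"
    using H.full[OF b a(1) ki] .
  \<comment> \<open>Comparing \<open>m\<close> with the injection of \<open>b\<close> along
    \<open>g\<close>, both opcartesian over \<open>g\<close>, exhibits \<open>a\<close> as the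
    coproduct of \<open>b\<close> up to vertical isomorphism.\<close>
  have "opcartesian B p m"
    using H.reflects_opcartesian[OF m(1)] S.sigma.opcartesian_precomp_iso[OF k(2,1) ij] m(2) by simp
  from inj_universal[OF this m(1) g(1)] obtain r s where "vertical_iso (co g b) a r s" by blast
  then have iso: "isomorphic (fibre B p I) a (co g b)"
    using isomorphic_fibre_iff[of I a] a vertical_iso_sym by blast
  have "quantifier_free B F p C b"
    unfolding quantifier_free_iff
  proof (intro conjI b allI impI)
    fix l y assume "cartesian B p l \<and> l \<in> hom_over p (AMap (Prj p) l) y b"
    then obtain w where l: "cartesian B p l" "l \<in> hom_over p w y b" by blast
    note Hl = H.map_hom_over[OF l(2)] H.preserves_cartesian[OF l(2,1)]
    \<comment> \<open>A cartesian \<open>l\<close> into \<open>b\<close> becomes, after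
      \<open>i\<close>, a cartesian arrow into the unit object of \<open>c\<close>. Its source is
      thus isomorphic to the unit object of the reindexed \<open>c\<close>, from which the lifting
      property travels back to \<open>y\<close>.\<close>
    have il: "i \<cdot>\<^bsub>Tot ?S\<^esub> AMap H l \<in> hom_over ?S w (OMap H y) (S.unit_obj c)"
      by (rule S.sigma.comp_vertical[OF Hl(1) V(1) V(8)])
    have ilc: "cartesian B ?S (i \<cdot>\<^bsub>Tot ?S\<^esub> AMap H l)"
      by (rule S.sigma.cartesian_comp[OF Hl(2,1) S.sigma.vertical_iso_cartesian[OF ij] V(1)])
    have "w \<in> Arr B" "OMap (Prj q) c = Cod B w"
      using S.sigma.hom_over_base[OF il] c display_base(2)[OF g(1)] by (simp_all add: S.unit_obj_def)
    then have "cartesian_lift B q w c (Lift q w c)" using q c by (simp add: cloven_fibration_def)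
    then have n: "cartesian B q (Lift q w c)" "Lift q w c \<in> hom_over q w (Dom (Tot q) (Lift q w c)) c"
      by (auto simp: cartesian_lift_def cartesian_def hom_over_iff)
    obtain i' j' where "S.sigma.vertical_iso (OMap H y) (S.unit_obj (Dom (Tot q) (Lift q w c))) i' j'"
      using S.sigma.cartesian_unique[OF ilc il S.unit_obj_cartesian(2,1)[OF units n]] by blast
    moreover have "op_projective B F ?S (S.unit_obj (Dom (Tot q) (Lift q w c)))"
      by (rule S.unit_obj_op_projective[OF units dep S.hom_over_base(4)[OF n(2)]])
    ultimately have "op_projective B F ?S (OMap H y)" by (rule S.sigma.op_projective_iso)
    moreover have "y \<in> Obj (Tot p)" using hom_over_base[OF l(2)] by simp
    ultimately show "op_projective B F p y" using H.reflects_op_projective by blast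
  qed
  moreover have "ob b = Dom B g" using hom_over_base[OF m(1)] by simp
  ultimately show "\<exists>f\<in>F. Cod B f = I \<and> (\<exists>b\<in>Obj (fibre B p (Dom B f)).
      quantifier_free B F p C b \<and> isomorphic (fibre B p I) a (co f b))"
    using g gI b iso by (intro bexI[of _ g] conjI bexI[of _ b]) (simp_all add: Obj_fibre)
qed

section \<open>The fibration of quantifier-free objects\<close>

context coproduct_fibration
begin

abbreviation "qf \<equiv> quantifier_free B F p C"

text \<open>The full subcategory on the quantifier-free objects, with the cleavage of
  \<open>p\<close> unchanged. It has the types of \<open>p\<close>, which is why the theorem can
  assert a \<open>q\<close> of those types.\<close>

definition qf_fibration :: "('b, 'c, 'e, 'f) cloven" where
  "qf_fibration = p\<lparr>Tot := (Tot p)\<lparr>Obj := {a. qf a},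
     Arr := {f \<in> Arr (Tot p). qf (Dom (Tot p) f) \<and> qf (Cod (Tot p) f)}\<rparr>\<rparr>"

lemma qf_fibration_simps [simp]:
  "a \<in> Obj (Tot qf_fibration) \<longleftrightarrow> qf a"
  "f \<in> Arr (Tot qf_fibration) \<longleftrightarrow> f \<in> Arr (Tot p) \<and> qf (Dom (Tot p) f) \<and> qf (Cod (Tot p) f)"
  "Dom (Tot qf_fibration) = Dom (Tot p)" "Cod (Tot qf_fibration) = Cod (Tot p)"
  "Id (Tot qf_fibration) = Id (Tot p)" "Comp (Tot qf_fibration) = Comp (Tot p)"
  "Prj qf_fibration = Prj p" "Lift qf_fibration = Lift p"
  by (simp_all add: qf_fibration_def)

lemma qf_obj: "qf a \<Longrightarrow> a \<in> Obj (Tot p)"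
  by (simp add: quantifier_free_def)

lemma qf_hom: "f \<in> hom (Tot qf_fibration) a b \<longleftrightarrow> f \<in> hom (Tot p) a b \<and> qf a \<and> qf b"
  by (auto simp: hom_def)

lemma qf_hom_over: "f \<in> hom_over qf_fibration w a b \<longleftrightarrow> f \<in> hom_over p w a b \<and> qf a \<and> qf b"
  by (auto simp: hom_over_iff)

lemma over_category_qf: "over_category B qf_fibration"
proof (intro over_category.intro cat_functor.intro target.category_axioms cat_functor_axioms.intro)
  show "category (Tot qf_fibration)"
    by unfold_locales (auto simp: qf_hom qf_obj source.comp_in source.id_in hom_def)
  show "OMap (Prj qf_fibration) a \<in> Obj B" "AMap (Prj qf_fibration) (Id (Tot qf_fibration) a) = Id B (OMap (Prj qf_fibration) a)"
    if "a \<in> Obj (Tot qf_fibration)" for a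
    using that qf_obj by simp_all
  show "AMap (Prj qf_fibration) f \<in> hom B (OMap (Prj qf_fibration) a) (OMap (Prj qf_fibration) b)"
    if "f \<in> hom (Tot qf_fibration) a b" for f a b
    using that by (auto simp: hom_def)
  show "AMap (Prj qf_fibration) (g \<cdot>\<^bsub>Tot qf_fibration\<^esub> f) = AMap (Prj qf_fibration) g \<cdot>\<^bsub>B\<^esub> AMap (Prj qf_fibration) f"
    if "f \<in> hom (Tot qf_fibration) a b" "g \<in> hom (Tot qf_fibration) b c" for f g a b c
    using that by (auto simp: hom_def)
qed

text \<open>The source of a chosen lift of a quantifier-free object is again quantifier-free, and by
  fullness the factorisations taken in \<open>p\<close> already belong to the subcategory.\<close>

lemma cloven_fibration_qf: "cloven_fibration B qf_fibration"
  unfolding cloven_fibration_def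
proof (intro conjI ballI impI)
  interpret qf: over_category B qf_fibration by (rule over_category_qf)
  show "cat_functor (Tot qf_fibration) B (Prj qf_fibration)" by (rule qf.cat_functor_axioms)
  fix u a assume u: "u \<in> Arr B" and "a \<in> Obj (Tot qf_fibration)" "OMap (Prj qf_fibration) a = Cod B u"
  then have a: "qf a" "a \<in> Obj (Tot p)" "ob a = Cod B u" using qf_obj by simp_all
  note l = lift[OF u a(2,3)]
  have q: "qf (re u a)" by (rule quantifier_free_reindex[OF a(1) l(2,1)])
  have "cartesian B qf_fibration (Lift p u a)"
  proof (rule qf.cartesianI)
    show "Lift p u a \<in> hom_over qf_fibration u (re u a) a" using l a q by (simp add: qf_hom_over)
  next
    fix f c w assume "f \<in> hom_over qf_fibration (u \<cdot>\<^bsub>B\<^esub> w) c a"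
      "w \<in> hom B (OMap (Prj qf_fibration) c) (OMap (Prj qf_fibration) (re u a))"
    then show "\<exists>h \<in> hom_over qf_fibration w c (re u a). Lift p u a \<cdot>\<^bsub>Tot qf_fibration\<^esub> h = f"
      using cartesian_unique_factor[OF l(2,1), of f w c] q by (auto simp: qf_hom_over Bex_def)
  next
    fix c w h h' assume "h \<in> hom_over qf_fibration w c (re u a)" "h' \<in> hom_over qf_fibration w c (re u a)"
      "Lift p u a \<cdot>\<^bsub>Tot qf_fibration\<^esub> h = Lift p u a \<cdot>\<^bsub>Tot qf_fibration\<^esub> h'"
    then show "h = h'" using cartesian_cancel[OF l(2,1), of h w c h'] by (simp add: qf_hom_over)
  qed
  then show "cartesian_lift B qf_fibration u a (Lift qf_fibration u a)"
    using hom_overD[OF l(1)] by (simp add: cartesian_lift_def)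
qed

section \<open>The comparison functor from the completion\<close>

interpretation S: completion B F qf_fibration
  by (intro completion.intro over_category_qf display.display_map_category_axioms)

abbreviation "S \<equiv> coproduct_completion B F qf_fibration"

text \<open>On arrows, the factorisation through the opcartesian injection at the source of the
  family followed by the injection at the target. Defining it by this property rather than by a
  formula with counits makes the functor laws consequences of uniqueness.\<close>

definition total :: "('c \<times> 'e, ('c, 'e, 'f) sigma_arr, 'e, 'f) fctr" where
  "total = \<lparr>OMap = (\<lambda>x. co (fst x) (snd x)),
     AMap = (\<lambda>m. THE k. k \<in> hom_over p (Base m) (co (fst (Src m)) (snd (Src m))) (co (fst (Tgt m)) (snd (Tgt m))) \<and>
       k \<bullet> inj (fst (Src m)) (snd (Src m)) = inj (fst (Tgt m)) (snd (Tgt m)) \<bullet> Family m)\<rparr>"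

lemma sigma_obj_qf:
  assumes "x \<in> sigma_obj B F qf_fibration"
  shows "fst x \<in> F" "fst x \<in> Arr B" "qf (snd x)" "snd x \<in> Obj (Tot p)" "ob (snd x) = Dom B (fst x)"
  using assms qf_obj by (simp_all add: S.sigma_obj_iff)

lemma inj_sigma:
  assumes x: "x \<in> sigma_obj B F qf_fibration"
  shows "inj (fst x) (snd x) \<in> hom_over p (fst x) (snd x) (OMap total x)"
    "opcartesian B p (inj (fst x) (snd x))"
    "OMap total x \<in> Obj (Tot p)" "ob (OMap total x) = Cod B (fst x)"
  using inj inj_opcartesian co_obj sigma_obj_qf[OF x] by (simp_all add: total_def)

lemma total_arr:
  assumes m: "m \<in> hom_over S w x y"
  shows "AMap total m \<in> hom_over p w (OMap total x) (OMap total y)"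
    "AMap total m \<bullet> inj (fst x) (snd x) = inj (fst y) (snd y) \<bullet> Family m"
proof -
  have m': "m = SigmaArr x y w (Index m) (Family m)" and x: "x \<in> sigma_obj B F qf_fibration"
    and y: "y \<in> sigma_obj B F qf_fibration" and w: "w \<in> hom B (Cod B (fst x)) (Cod B (fst y))"
    and sq: "fst y \<cdot>\<^bsub>B\<^esub> Index m = w \<cdot>\<^bsub>B\<^esub> fst x" and f: "Family m \<in> hom_over p (Index m) (snd x) (snd y)"
    using m unfolding S.sigma_hom_over_iff qf_hom_over by blast+
  note ix = inj_sigma[OF x] and iy = inj_sigma[OF y]
  have st: "Src m = x" "Tgt m = y" "Base m = w" using m by (auto simp: hom_over_iff)
  have "inj (fst y) (snd y) \<bullet> Family m \<in> hom_over p (w \<cdot>\<^bsub>B\<^esub> fst x) (snd x) (OMap total y)"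
    using hom_over_comp[OF f iy(1)] sq by simp
  from theI'[OF opcartesian_unique_factor[OF ix(2,1) this]] w ix iy
  have "AMap total m \<in> hom_over p w (OMap total x) (OMap total y) \<and>
    AMap total m \<bullet> inj (fst x) (snd x) = inj (fst y) (snd y) \<bullet> Family m"
    by (simp add: total_def st)
  then show "AMap total m \<in> hom_over p w (OMap total x) (OMap total y)"
    "AMap total m \<bullet> inj (fst x) (snd x) = inj (fst y) (snd y) \<bullet> Family m" by simp_all
qed

lemma total_arr_unique:
  assumes m: "m \<in> hom_over S w x y" and k: "k \<in> hom_over p w (OMap total x) (OMap total y)"
    "k \<bullet> inj (fst x) (snd x) = inj (fst y) (snd y) \<bullet> Family m"
  shows "AMap total m = k"
proof -
  have x: "x \<in> sigma_obj B F qf_fibration" using S.sigma.hom_over_base(4)[OF m] by simp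
  note t = total_arr[OF m]
  show ?thesis by (rule opcartesian_cancel[OF inj_sigma(2,1)[OF x] t(1) k(1)]) (simp add: t k)
qed

lemma total_functor: "cat_functor (Tot S) (Tot p) total"
proof (intro cat_functor.intro S.category_sigma source.category_axioms cat_functor_axioms.intro)
  fix x assume "x \<in> Obj (Tot S)"
  then have x: "x \<in> sigma_obj B F qf_fibration" by simp
  note ix = inj_sigma[OF x]
  show "OMap total x \<in> Obj (Tot p)" by (rule ix)
  show "AMap total (Id (Tot S) x) = Id (Tot p) (OMap total x)"
  proof (rule total_arr_unique)
    show "Id (Tot S) x \<in> hom_over S (Id B (Cod B (fst x))) x x"
      using S.sigma.id_vertical[of x] x by simp
    show "Id (Tot p) (OMap total x) \<in> hom_over p (Id B (Cod B (fst x))) (OMap total x) (OMap total x)"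
      using id_vertical[OF ix(3)] ix(4) by simp
    show "Id (Tot p) (OMap total x) \<bullet> inj (fst x) (snd x) = inj (fst x) (snd x) \<bullet> Family (Id (Tot S) x)"
      using hom_over_id[OF ix(1)] by simp
  qed
next
  fix m x y assume m: "m \<in> hom (Tot S) x y"
  then have M: "m \<in> hom_over S (Base m) x y" by (simp add: hom_over_def)
  note tm = total_arr[OF M]
  show "AMap total m \<in> hom (Tot p) (OMap total x) (OMap total y)"
    using tm by (simp add: hom_over_def)
  fix n z assume n: "n \<in> hom (Tot S) y z"
  then have N: "n \<in> hom_over S (Base n) y z" by (simp add: hom_over_def)
  note tn = total_arr[OF N]
  have x: "x \<in> sigma_obj B F qf_fibration" and y: "y \<in> sigma_obj B F qf_fibration"
    and z: "z \<in> sigma_obj B F qf_fibration"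
    using S.sigma.hom_over_base(4,5)[OF M] S.sigma.hom_over_base(5)[OF N] by simp_all
  note ix = inj_sigma[OF x] and iy = inj_sigma[OF y] and iz = inj_sigma[OF z]
  have fm: "Family m \<in> hom_over p (Index m) (snd x) (snd y)" and fn: "Family n \<in> hom_over p (Index n) (snd y) (snd z)"
    using M N unfolding S.sigma_hom_over_iff qf_hom_over by blast+
  show "AMap total (n \<cdot>\<^bsub>Tot S\<^esub> m) = AMap total n \<bullet> AMap total m"
  proof (rule total_arr_unique[OF S.sigma.hom_over_comp[OF M N] hom_over_comp[OF tm(1) tn(1)]])
    have "(AMap total n \<bullet> AMap total m) \<bullet> inj (fst x) (snd x)
        = AMap total n \<bullet> (inj (fst y) (snd y) \<bullet> Family m)"
      using hom_over_assoc[OF ix(1) tm(1) tn(1)] tm(2) by simp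
    also have "\<dots> = (inj (fst z) (snd z) \<bullet> Family n) \<bullet> Family m"
      using hom_over_assoc[OF fm iy(1) tn(1)] tn(2) by simp
    also have "\<dots> = inj (fst z) (snd z) \<bullet> Family (n \<cdot>\<^bsub>Tot S\<^esub> m)"
      using hom_over_assoc[OF fm fn iz(1)] by simp
    finally show "(AMap total n \<bullet> AMap total m) \<bullet> inj (fst x) (snd x)
        = inj (fst z) (snd z) \<bullet> Family (n \<cdot>\<^bsub>Tot S\<^esub> m)" .
  qed
qed

lemma total_equivalence:
  assumes "enough_quantifier_free B F p C"
  shows "over_equivalence B S p total"
proof (intro over_equivalence.intro S.over_category_sigma over_category_axioms total_functor
    over_equivalence_axioms.intro)
  show "ob (OMap total x) = OMap (Prj S) x" if "x \<in> Obj (Tot S)" for x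
    using that inj_sigma(4) by simp
  show "AMap (Prj p) (AMap total m) = AMap (Prj S) m" if "m \<in> Arr (Tot S)" for m
    using total_arr(1)[OF S.sigma.hom_overI[OF that]] by (simp add: hom_over_def)
next
  fix a assume "a \<in> Obj (Tot p)"
  then have "a \<in> Obj (fibre B p (ob a))" "ob a \<in> Obj B" by (simp_all add: Obj_fibre)
  then obtain f b where f: "f \<in> F" "Cod B f = ob a" and b: "b \<in> Obj (fibre B p (Dom B f))" "qf b"
    and "isomorphic (fibre B p (ob a)) a (co f b)"
    using assms unfolding enough_quantifier_free_def by blast
  then obtain i j where ij: "vertical_iso a (co f b) i j" using isomorphic_fibre_iff by blast
  have "(f, b) \<in> Obj (Tot S)"
    using f b display_base[OF f(1)] by (simp add: S.sigma_obj_iff Obj_fibre)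
  moreover have "vertical_iso (OMap total (f, b)) a j i"
    using vertical_iso_sym[OF ij] by (simp add: total_def)
  ultimately show "\<exists>x\<in>Obj (Tot S). \<exists>i j. vertical_iso (OMap total x) a i j" by blast
next
  fix x y h w assume "x \<in> Obj (Tot S)" "y \<in> Obj (Tot S)"
    and h: "h \<in> hom_over p w (OMap total x) (OMap total y)"
  then have x: "x \<in> sigma_obj B F qf_fibration" and y: "y \<in> sigma_obj B F qf_fibration" by simp_all
  note ix = inj_sigma[OF x] and iy = inj_sigma[OF y] and x' = sigma_obj_qf[OF x] and y' = sigma_obj_qf[OF y]
  note hi = hom_over_comp[OF ix(1) h]
  \<comment> \<open>This is lifting out of the quantifier-free \<open>snd x\<close> against the
    injection at \<open>y\<close>, which is opcartesian over the display map
    \<open>fst y\<close>.\<close>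
  have "\<exists>!m. m \<in> hom (Tot p) (snd x) (Dom (Tot p) (inj (fst y) (snd y))) \<and>
      inj (fst y) (snd y) \<bullet> m = h \<bullet> inj (fst x) (snd x)"
    if "h \<bullet> inj (fst x) (snd x) \<in> hom (Tot p) (snd x) (Cod (Tot p) (inj (fst y) (snd y)))"
      "AMap (Prj p) (inj (fst y) (snd y)) \<in> F"
    using quantifier_free_op_projective[OF x'(3)] iy(2) that unfolding op_projective_def by blast
  then have ex: "\<exists>!m. m \<in> hom (Tot p) (snd x) (snd y) \<and> inj (fst y) (snd y) \<bullet> m = h \<bullet> inj (fst x) (snd x)"
    using hom_overD[OF iy(1)] y'(1) hi by (simp add: hom_over_def)
  then obtain f where f: "f \<in> hom (Tot p) (snd x) (snd y)" "inj (fst y) (snd y) \<bullet> f = h \<bullet> inj (fst x) (snd x)"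
    by blast
  define v where "v = AMap (Prj p) f"
  have fv: "f \<in> hom_over p v (snd x) (snd y)" using f by (simp add: hom_over_def v_def)
  \<comment> \<open>The index is the base of the lift, and the square demanded of an arrow of the
    completion is the lifting equation projected to \<open>B\<close>.\<close>
  have sq: "fst y \<cdot>\<^bsub>B\<^esub> v = w \<cdot>\<^bsub>B\<^esub> fst x"
    using hom_overD(4)[OF hom_over_comp[OF fv iy(1)]] hom_overD(4)[OF hi] f(2) by simp
  let ?m = "SigmaArr x y w v f"
  have m: "?m \<in> hom_over S w x y"
    unfolding S.sigma_hom_over_iff
    using x y sq fv x'(3) y'(3) hom_over_base[OF h] ix iy by (simp add: qf_hom_over hom_def)
  show "\<exists>!m. m \<in> hom_over S w x y \<and> AMap total m = h"
  proof (rule ex1I[of _ ?m], intro conjI m)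
    show "AMap total ?m = h" by (rule total_arr_unique[OF m h]) (simp add: f)
    fix n assume n: "n \<in> hom_over S w x y \<and> AMap total n = h"
    have n': "n = SigmaArr x y w (Index n) (Family n)" "Family n \<in> hom_over p (Index n) (snd x) (snd y)"
      using n unfolding S.sigma_hom_over_iff qf_hom_over by blast+
    have "inj (fst y) (snd y) \<bullet> Family n = h \<bullet> inj (fst x) (snd x)"
      using total_arr(2)[of n w x y] n by simp
    moreover have "Family n \<in> hom (Tot p) (snd x) (snd y)" using n'(2) by (simp add: hom_over_def)
    \<comment> \<open>Uniqueness of the lift fixes the family; the index is then fixed too, being
      the base of the family.\<close>
    ultimately have "Family n = f" using ex f by blast
    then have "Family n = f" "Index n = v" using n'(2) fv by (auto simp: hom_over_def)
    then show "n = ?m" using n'(1) by simp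
  qed
qed

end

text \<open>Types cannot be quantified inside the existential, so the first conjunct takes
  \<open>q\<close> over the types of \<open>p\<close>. The second conjunct gives the implication to
  enough quantifier-free objects for \<open>q\<close> with any types of objects and arrows in its
  total category.\<close>

theorem theorem5p9:
  fixes B :: "('b, 'c) cat" and F :: "'c set"
    and p :: "('b, 'c, 'e, 'f) cloven" and C :: "('c, 'e, 'f) coprods"
  assumes "display_map_category B F"
    and "has_units B F"
    and "has_dependent_coproducts B F"
    and "cloven_fibration B p"
    and "has_coproducts B F p C"
  shows "((\<exists>q :: ('b, 'c, 'e, 'f) cloven.
             cloven_fibration B q \<and> fibred_equivalent B p (coproduct_completion B F q))
           \<longleftrightarrow> enough_quantifier_free B F p C) \<and>
         (\<forall>q :: ('b, 'c, 'x, 'y) cloven.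
             cloven_fibration B q \<and> fibred_equivalent B p (coproduct_completion B F q)
           \<longrightarrow> enough_quantifier_free B F p C)"
proof -
  interpret coproduct_fibration B F p C
    using assms by (simp add: coproduct_fibration_def coproduct_fibration_axioms_def
      over_category_def cloven_fibration_def)
  have sufficient: "fibred_equivalent B p (coproduct_completion B F qf_fibration)"
    if "enough_quantifier_free B F p C"
  proof -
    interpret T: over_equivalence B "coproduct_completion B F qf_fibration" p total
      by (rule total_equivalence[OF that])
    have "fibration B p" using assms(4) unfolding fibration_def cloven_fibration_def by blast
    then show ?thesis by (rule T.fibred_equivalent)
  qed
  show ?thesis
  proof (intro conjI iffI allI impI)
    assume "\<exists>q :: ('b, 'c, 'e, 'f) cloven.
      cloven_fibration B q \<and> fibred_equivalent B p (coproduct_completion B F q)"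
    then show "enough_quantifier_free B F p C"
      by (elim exE conjE) (rule enough_quantifier_free_completion[OF assms(2,3)])
  next
    assume "enough_quantifier_free B F p C"
    then show "\<exists>q :: ('b, 'c, 'e, 'f) cloven.
      cloven_fibration B q \<and> fibred_equivalent B p (coproduct_completion B F q)"
      using sufficient cloven_fibration_qf by (intro exI[of _ qf_fibration] conjI)
  next
    fix q :: "('b, 'c, 'x, 'y) cloven"
    assume "cloven_fibration B q \<and> fibred_equivalent B p (coproduct_completion B F q)"
    then show "enough_quantifier_free B F p C"
      by (elim conjE) (rule enough_quantifier_free_completion[OF assms(2,3)])
  qed
qed

end
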